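(* Let $\mathcal{H}$ be a nontrivial hereditary property such that $\mathcal{F}(\mathcal{H})$ contains a complete graph, and let $h$ be the minimum positive integer such that $\mathcal{H}\subseteq{\rm Forb}(K_h)$. Let $\chi=\chi(\mathcal{H})$ be the chromatic number of $\mathcal{H}$, and let $m$ be the smallest positive integer such that $\mathcal{F}(\mathcal{H})$ contains a complete multipartite graph with $m$ parts. Then $\chi\leq m\leq h$, and for all $p\in[0,1]$, $$ \min\left\{\frac{p}{\chi-1},\frac{1-p}{\chi-1}+\frac{2p-1}{m-1}\right\}\leq \textit{ed}_{\mathcal{H}}(p)\leq\min\left\{\frac{p}{\chi-1},1-p+\frac{2p-1}{m-1}\right\}. $$ In particular, $\textit{ed}_{{\rm Forb}(K_h)}(p)=\frac{p}{\chi-1}$, where $\chi$ here denotes the chromatic number of the property ${\rm Forb}(K_h)$ (which equals $h$).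
   Context: All graphs are finite and simple. A hereditary property $\mathcal{H}$ is a family of graphs closed under taking induced subgraphs; it is nontrivial if it contains graphs on $n$ vertices for arbitrarily large $n$ (equivalently for all $n$). For a graph $H$, ${\rm Forb}(H)$ is the hereditary property of graphs containing no induced copy of $H$. $\mathcal{F}(\mathcal{H})$ denotes the set of forbidden graphs of $\mathcal{H}$: the graphs not in $\mathcal{H}$ all of whose proper induced subgraphs are in $\mathcal{H}$, so that $\mathcal{H}=\bigcap_{F\in\mathcal{F}(\mathcal{H})}{\rm Forb}(F)$. The chromatic number of $\mathcal{H}$ is $\chi(\mathcal{H})=\min\{\chi(F):F\in\mathcal{F}(\mathcal{H})\}$. For graphs $G,G'$ on the same labeled vertex set, ${\rm dist}(G,G')=|E(G)\triangle E(G')|$, and ${\rm dist}(G,\mathcal{H})=\min\{{\rm dist}(G,G'): V(G')=V(G), G'\in\mathcal{H}\}$. The edit distance function is $\textit{ed}_{\mathcal{H}}(p)=\lim_{n\to\infty}\max\{{\rm dist}(G,\mathcal{H}): |V(G)|=n, |E(G)|=\lfloor p\binom{n}{2}\rfloor\}/\binom{n}{2}$, which exists for nontrivial hereditary properties. *)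

theory Defs
  imports Complex_Main "HOL-Library.Disjoint_Sets"
begin

text \<open>
  Every finite graph is isomorphic to one whose vertices are natural numbers, so a graph property
  is a set of graphs over \<^typ>\<open>nat\<close> that is closed under isomorphism.
\<close>

datatype ugraph = UGraph (verts: "nat set") (edges: "nat set set")

definition all_pairs :: "nat set \<Rightarrow> nat set set" where
  "all_pairs V = {e. e \<subseteq> V \<and> card e = 2}"

definition finite_simple :: "ugraph \<Rightarrow> bool" where
  "finite_simple G \<longleftrightarrow> finite (verts G) \<and> edges G \<subseteq> all_pairs (verts G)"

definition graph_iso :: "ugraph \<Rightarrow> ugraph \<Rightarrow> bool" where
  "graph_iso G G' \<longleftrightarrow>
     (\<exists>f. bij_betw f (verts G) (verts G') \<and> edges G' = (\<lambda>e. f ` e) ` edges G)"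

definition induced_subgraph :: "ugraph \<Rightarrow> nat set \<Rightarrow> ugraph" where
  "induced_subgraph G W = UGraph W {e \<in> edges G. e \<subseteq> W}"

definition complete_graph :: "nat \<Rightarrow> ugraph" where
  "complete_graph n = UGraph {..<n} (all_pairs {..<n})"

text \<open>The parts of a complete multipartite graph are nonempty (by \<^const>\<open>partition_on\<close>).\<close>

definition complete_multipartite :: "nat \<Rightarrow> ugraph \<Rightarrow> bool" where
  "complete_multipartite m G \<longleftrightarrow>
     (\<exists>P. partition_on (verts G) P \<and> card P = m \<and>
          edges G = {e \<in> all_pairs (verts G). \<not> (\<exists>A\<in>P. e \<subseteq> A)})"

definition chromatic_number :: "ugraph \<Rightarrow> nat" where
  "chromatic_number G =
     (LEAST k. \<exists>c. c ` verts G \<subseteq> {..<k} \<and> (\<forall>u v. {u, v} \<in> edges G \<longrightarrow> c u \<noteq> (c v :: nat)))"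

definition hereditary :: "ugraph set \<Rightarrow> bool" where
  "hereditary \<H> \<longleftrightarrow>
     (\<forall>G\<in>\<H>. finite_simple G) \<and>
     (\<forall>G\<in>\<H>. \<forall>G'. graph_iso G G' \<longrightarrow> G' \<in> \<H>) \<and>
     (\<forall>G\<in>\<H>. \<forall>W\<subseteq>verts G. induced_subgraph G W \<in> \<H>)"

definition nontrivial :: "ugraph set \<Rightarrow> bool" where
  "nontrivial \<H> \<longleftrightarrow> (\<forall>N. \<exists>G\<in>\<H>. card (verts G) \<ge> N)"

definition Forb :: "ugraph \<Rightarrow> ugraph set" where
  "Forb F = {G. finite_simple G \<and> \<not> (\<exists>W\<subseteq>verts G. graph_iso (induced_subgraph G W) F)}"

definition forbidden_graphs :: "ugraph set \<Rightarrow> ugraph set" where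
  "forbidden_graphs \<H> =
     {F. finite_simple F \<and> F \<notin> \<H> \<and> (\<forall>W. W \<subset> verts F \<longrightarrow> induced_subgraph F W \<in> \<H>)}"

text \<open>On \<^typ>\<open>nat\<close> the infimum of a nonempty set is its minimum, also when the set is infinite.\<close>

definition property_chromatic_number :: "ugraph set \<Rightarrow> nat" where
  "property_chromatic_number \<H> = (INF F\<in>forbidden_graphs \<H>. chromatic_number F)"

definition edit_dist :: "ugraph \<Rightarrow> ugraph \<Rightarrow> nat" where
  "edit_dist G G' = card ((edges G - edges G') \<union> (edges G' - edges G))"

text \<open>
  The sets under \<^const>\<open>Min\<close> and \<^const>\<open>Max\<close> below are finite, as the distances on \<open>n\<close> vertices are
  at most \<open>n choose 2\<close>; for a nontrivial hereditary property and \<open>0 \<le> p \<le> 1\<close> they are also nonempty.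
\<close>

definition dist_to_property :: "ugraph \<Rightarrow> ugraph set \<Rightarrow> nat" where
  "dist_to_property G \<H> = Min {edit_dist G G' | G'. verts G' = verts G \<and> G' \<in> \<H>}"

definition max_dist :: "ugraph set \<Rightarrow> real \<Rightarrow> nat \<Rightarrow> nat" where
  "max_dist \<H> p n =
     Max {dist_to_property G \<H> | G. finite_simple G \<and> card (verts G) = n \<and>
            int (card (edges G)) = \<lfloor>p * real (n choose 2)\<rfloor>}"

definition edit_distance_function :: "ugraph set \<Rightarrow> real \<Rightarrow> real" where
  "edit_distance_function \<H> p = lim (\<lambda>n. real (max_dist \<H> p n) / real (n choose 2))"

end

theory Submission
  imports Defs "HOL-Library.FuncSet" "HOL-Library.Ramsey" "HOL-Computational_Algebra.Primes"
begin

text \<open>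
  For the upper bounds, average over random vertex colourings: deleting the monochromatic edges of a
  random \<open>\<chi> - 1\<close>-colouring, or editing to the complete multipartite graph of a random
  \<open>m - 1\<close>-colouring, leaves no forbidden graph.

  The limit exists because a transversal of the blow-up of a graph \<open>G\<close> is a copy of \<open>G\<close>; averaging over
  the transversals shows that the normalised distance is almost increasing.

  For the lower bound, take a quasirandom graph \<open>G\<close> of density \<open>p\<close> and \<open>G'\<close> in the property. Inside
  any \<open>s\<close> disjoint clusters there are subclusters that are pairwise regular for \<open>G'\<close>, almost
  independent in \<open>G'\<close> (here a clique is forbidden), and between which the edit density is not larger
  on average. Call a pair of subclusters white, gray or black as its density in \<open>G'\<close> is near \<open>0\<close>,
  intermediate or near \<open>1\<close>. Then \<open>\<chi>\<close> pairwise gray clusters, or \<open>m\<close> pairwise nonwhite ones, would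
  contain a forbidden graph. A white pair costs \<open>p\<close> and a black one \<open>1 - p\<close>, so Turan's theorem, applied
  to the gray and to the nonwhite pairs, bounds the cost from below.
\<close>

section \<open>Induced copies and edit distance\<close>

text \<open>A single tuple of clusters can represent the whole graph because a quasirandom graph
  looks alike everywhere: arbitrary disjoint intervals serve as initial clusters. The danger is that
  the subclusters found inside them carry denser edits than the intervals; this is why the edit
  density is the leading term of the potential and the squared density of \<open>G'\<close> only a
  small perturbation. A cluster that is sparse inside hosts independent sets, that is, colour
  classes. On gray pairs both edges and nonedges are available, so any proper colouring of a
  forbidden graph places it. On nonwhite pairs nonedges may be missing, so that all pairs from
  different classes should be edges: this is where complete multipartite graphs enter. Up to small
  errors a pair costs at least \<open>p\<close>, minus \<open>2 * p - 1\<close> if it is nonwhite,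
  minus \<open>1 - p\<close> if it is gray. These coefficients are nonnegative for \<open>p\<close>
  at least 1/2; for smaller \<open>p\<close> a black pair costs no less than a white one, and it is
  enough to count gray pairs.\<close>

lemma finite_all_pairs: "finite V \<Longrightarrow> finite (all_pairs V)"
  unfolding all_pairs_def by auto

lemma card_all_pairs: "finite V \<Longrightarrow> card (all_pairs V) = card V choose 2"
  unfolding all_pairs_def by (simp add: n_subsets)

lemma doubleton_in_all_pairs: "{x, y} \<in> all_pairs V \<longleftrightarrow> x \<in> V \<and> y \<in> V \<and> x \<noteq> y"
  unfolding all_pairs_def by (auto simp: card_insert_if)

lemma all_pairsE:
  assumes "e \<in> all_pairs V"
  obtains x y where "e = {x, y}" "x \<in> V" "y \<in> V" "x \<noteq> y"
  using assms unfolding all_pairs_def by (auto simp: card_2_iff)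

lemma finite_simpleD:
  assumes "finite_simple G"
  shows "finite (verts G)" "edges G \<subseteq> all_pairs (verts G)" "finite (edges G)"
  using assms finite_all_pairs finite_subset unfolding finite_simple_def by auto

text \<open>Distances compare graphs on one labelled vertex set, so copies must live on a prescribed
  set \<open>V\<close>. For injective \<open>f\<close> this is the subgraph induced on the image of
  \<open>V\<close>, relabelled by \<open>V\<close>.\<close>

definition pullback :: "(nat \<Rightarrow> nat) \<Rightarrow> nat set \<Rightarrow> ugraph \<Rightarrow> ugraph" where
  "pullback f V G = UGraph V {e \<in> all_pairs V. f ` e \<in> edges G}"

lemma pullback_sel [simp]:
  "verts (pullback f V G) = V"
  "edges (pullback f V G) = {e \<in> all_pairs V. f ` e \<in> edges G}"
  by (simp_all add: pullback_def)

lemma pullback_iso: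
  assumes "finite_simple G" "inj_on f V" "f ` V \<subseteq> verts G"
  shows "graph_iso (induced_subgraph G (f ` V)) (pullback f V G)"
proof -
  let ?g = "inv_into V f"
  have inv: "?g (f x) = x" if "x \<in> V" for x
    using assms(2) that by simp
  have "edges (pullback f V G) = (\<lambda>e. ?g ` e) ` {e \<in> edges G. e \<subseteq> f ` V}"
  proof (intro equalityI subsetI)
    fix e assume e: "e \<in> edges (pullback f V G)"
    then obtain x y where xy: "e = {x, y}" "x \<in> V" "y \<in> V" "x \<noteq> y"
      by (auto elim: all_pairsE)
    then have "e = ?g ` (f ` e)" by (auto simp: inv)
    moreover have "f ` e \<in> {e \<in> edges G. e \<subseteq> f ` V}" using e xy by auto
    ultimately show "e \<in> (\<lambda>e. ?g ` e) ` {e \<in> edges G. e \<subseteq> f ` V}" by blast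
  next
    fix e assume "e \<in> (\<lambda>e. ?g ` e) ` {e \<in> edges G. e \<subseteq> f ` V}"
    then obtain d where d: "e = ?g ` d" "d \<in> edges G" "d \<subseteq> f ` V" by blast
    with assms(1) have "d \<in> all_pairs (verts G)" by (auto simp: finite_simple_def)
    then obtain u v where "d = {u, v}" "u \<noteq> v" by (auto elim: all_pairsE)
    with d(3) obtain x y where xy: "d = {f x, f y}" "x \<in> V" "y \<in> V" "f x \<noteq> f y" by auto
    then have "e = {x, y}" using d(1) inv by simp
    then show "e \<in> edges (pullback f V G)" using xy d(2) by (auto simp: doubleton_in_all_pairs)
  qed
  moreover have "bij_betw ?g (f ` V) V"
    using assms(2) by (simp add: bij_betw_inv_into inj_on_imp_bij_betw)
  ultimately show ?thesis
    unfolding graph_iso_def induced_subgraph_def by auto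
qed

lemma hereditary_finite_simple: "hereditary \<H> \<Longrightarrow> G \<in> \<H> \<Longrightarrow> finite_simple G"
  unfolding hereditary_def by blast

lemma hereditary_pullback:
  assumes "hereditary \<H>" "G \<in> \<H>" "inj_on f V" "f ` V \<subseteq> verts G"
  shows "pullback f V G \<in> \<H>"
proof -
  have "induced_subgraph G (f ` V) \<in> \<H>"
    using assms unfolding hereditary_def by blast
  moreover have "graph_iso (induced_subgraph G (f ` V)) (pullback f V G)"
    using assms by (intro pullback_iso hereditary_finite_simple)
  ultimately show ?thesis
    using assms(1) unfolding hereditary_def by blast
qed

lemma pullback_eqI:
  assumes "finite_simple F"
    and "\<And>x y. x \<in> verts F \<Longrightarrow> y \<in> verts F \<Longrightarrow> x \<noteq> y \<Longrightarrow>
           {f x, f y} \<in> edges G \<longleftrightarrow> {x, y} \<in> edges F"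
  shows "pullback f (verts F) G = F"
proof -
  have "e \<in> all_pairs (verts F) \<and> f ` e \<in> edges G \<longleftrightarrow> e \<in> edges F" for e
    using assms by (auto simp: finite_simple_def elim!: all_pairsE)
  then show ?thesis
    by (cases F) (auto simp: pullback_def)
qed

lemma hereditary_induced_copy:
  assumes "hereditary \<H>" "G \<in> \<H>" "finite_simple F" "inj_on f (verts F)" "f ` verts F \<subseteq> verts G"
    and "\<And>x y. x \<in> verts F \<Longrightarrow> y \<in> verts F \<Longrightarrow> x \<noteq> y \<Longrightarrow>
           {f x, f y} \<in> edges G \<longleftrightarrow> {x, y} \<in> edges F"
  shows "F \<in> \<H>"
  using hereditary_pullback[OF assms(1,2,4,5)] pullback_eqI[OF assms(3,6)] by metis

text \<open>Nontriviality only gives large graphs, but an induced subgraph of one can be relabelled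
  to any prescribed vertex set. So distances to the property are minima over nonempty sets, and the
  empty graph is a member.\<close>

lemma exists_on_vertex_set:
  assumes "hereditary \<H>" "nontrivial \<H>" "finite V"
  obtains G where "G \<in> \<H>" "verts G = V"
proof -
  obtain G where G: "G \<in> \<H>" "card (verts G) \<ge> card V"
    using assms(2) unfolding nontrivial_def by blast
  then have "finite (verts G)"
    using assms(1) hereditary_finite_simple finite_simpleD by blast
  with G(2) assms(3) obtain f where "f ` V \<subseteq> verts G" "inj_on f V"
    by (meson card_le_inj)
  then have "pullback f V G \<in> \<H>"
    using hereditary_pullback assms(1) G(1) by blast
  then show ?thesis using that pullback_sel(1) by blast
qed

lemma finite_simple_induced: "finite_simple G \<Longrightarrow> W \<subseteq> verts G \<Longrightarrow> finite_simple (induced_subgraph G W)"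
  unfolding finite_simple_def induced_subgraph_def all_pairs_def
  by (auto intro: finite_subset)

lemma induced_subgraph_self: "finite_simple G \<Longrightarrow> induced_subgraph G (verts G) = G"
  by (cases G) (auto simp: induced_subgraph_def finite_simple_def all_pairs_def)

text \<open>Forbidden graphs are the minimal graphs outside the property, so a descent through
  induced subgraphs outside it must end at one.\<close>

lemma contains_forbidden:
  assumes "finite_simple G" "G \<notin> \<H>"
  obtains W where "W \<subseteq> verts G" "induced_subgraph G W \<in> forbidden_graphs \<H>"
proof -
  have "\<exists>W\<subseteq>verts G. induced_subgraph G W \<in> forbidden_graphs \<H>"
    using assms
  proof (induction "card (verts G)" arbitrary: G rule: less_induct)
    case less
    show ?case
    proof (cases "G \<in> forbidden_graphs \<H>")
      case True
      then show ?thesis using induced_subgraph_self[OF less.prems(1)] by (metis order_refl)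
    next
      case False
      then obtain W where W: "W \<subset> verts G" "induced_subgraph G W \<notin> \<H>"
        using less.prems unfolding forbidden_graphs_def by auto
      then have "card (verts (induced_subgraph G W)) < card (verts G)"
        using less.prems(1) by (auto simp: induced_subgraph_def finite_simple_def psubset_card_mono)
      then obtain U where U: "U \<subseteq> W"
        "induced_subgraph (induced_subgraph G W) U \<in> forbidden_graphs \<H>"
        using less.hyps[of "induced_subgraph G W"] less.prems(1) W finite_simple_induced[of G W]
        by (auto simp: induced_subgraph_def)
      moreover have "induced_subgraph (induced_subgraph G W) U = induced_subgraph G U"
        using U(1) by (auto simp: induced_subgraph_def)
      ultimately show ?thesis using W(1) by auto
    qed
  qed
  then show ?thesis using that by blast
qed

lemma forbidden_graphs_finite_simple: "F \<in> forbidden_graphs \<H> \<Longrightarrow> finite_simple F"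
  unfolding forbidden_graphs_def by blast

lemma forbidden_graphs_notin: "F \<in> forbidden_graphs \<H> \<Longrightarrow> F \<notin> \<H>"
  unfolding forbidden_graphs_def by blast

section \<open>Distance to a property\<close>

lemma edit_dist_triangle:
  assumes "finite_simple G1" "finite_simple G2" "finite_simple G3"
  shows "edit_dist G1 G3 \<le> edit_dist G1 G2 + edit_dist G2 G3"
proof -
  let ?D = "\<lambda>A B. (edges A - edges B) \<union> (edges B - edges A)"
  have "?D G1 G3 \<subseteq> ?D G1 G2 \<union> ?D G2 G3" by auto
  then have "card (?D G1 G3) \<le> card (?D G1 G2 \<union> ?D G2 G3)"
    using assms by (intro card_mono) (auto simp: finite_simpleD)
  also have "\<dots> \<le> card (?D G1 G2) + card (?D G2 G3)" by (rule card_Un_le)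
  finally show ?thesis by (simp add: edit_dist_def)
qed

lemma edit_dist_le:
  assumes "finite_simple G" "finite_simple G'" "verts G' = verts G"
  shows "edit_dist G G' \<le> card (verts G) choose 2"
proof -
  have "edit_dist G G' \<le> card (all_pairs (verts G))"
    unfolding edit_dist_def using assms
    by (intro card_mono finite_all_pairs) (auto simp: finite_simple_def)
  then show ?thesis
    using assms(1) by (simp add: card_all_pairs finite_simple_def)
qed

lemma dist_set_finite:
  assumes "hereditary \<H>" "finite_simple G"
  shows "finite {edit_dist G G' | G'. verts G' = verts G \<and> G' \<in> \<H>}"
  by (rule finite_subset[of _ "{..card (verts G) choose 2}"])
    (use assms edit_dist_le hereditary_finite_simple in blast)+

lemma dist_to_property_le:
  assumes "hereditary \<H>" "finite_simple G" "G' \<in> \<H>" "verts G' = verts G"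
  shows "dist_to_property G \<H> \<le> edit_dist G G'"
  unfolding dist_to_property_def
  by (rule Min_le[OF dist_set_finite[OF assms(1,2)]]) (use assms in blast)

lemma dist_to_property_attained:
  assumes "hereditary \<H>" "nontrivial \<H>" "finite_simple G"
  obtains G' where "G' \<in> \<H>" "verts G' = verts G" "dist_to_property G \<H> = edit_dist G G'"
proof -
  obtain G' where "G' \<in> \<H>" "verts G' = verts G"
    using exists_on_vertex_set assms finite_simpleD(1) by metis
  then have "{edit_dist G G' | G'. verts G' = verts G \<and> G' \<in> \<H>} \<noteq> {}" by blast
  from Min_in[OF dist_set_finite[OF assms(1,3)] this] show ?thesis
    using that unfolding dist_to_property_def by auto
qed

section \<open>Graphs with the prescribed number of edges\<close>

abbreviation edge_target :: "real \<Rightarrow> nat \<Rightarrow> nat" where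
  "edge_target p n \<equiv> nat \<lfloor>p * real (n choose 2)\<rfloor>"

lemma edge_target_bounds:
  assumes "0 \<le> p" "p \<le> 1"
  shows "edge_target p n \<le> n choose 2" "int (edge_target p n) = \<lfloor>p * real (n choose 2)\<rfloor>"
    "real (edge_target p n) \<le> p * real (n choose 2)"
    "p * real (n choose 2) - 1 \<le> real (edge_target p n)"
proof -
  have nn: "0 \<le> p * real (n choose 2)" using assms by simp
  then show 1: "int (edge_target p n) = \<lfloor>p * real (n choose 2)\<rfloor>" by simp
  then have 2: "real (edge_target p n) = real_of_int \<lfloor>p * real (n choose 2)\<rfloor>"
    by (metis of_int_of_nat_eq)
  then show 3: "real (edge_target p n) \<le> p * real (n choose 2)" by linarith
  show "p * real (n choose 2) - 1 \<le> real (edge_target p n)" using 2 by linarith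
  have "p * real (n choose 2) \<le> real (n choose 2)" using assms by (simp add: mult_left_le_one_le)
  with 3 show "edge_target p n \<le> n choose 2" by linarith
qed

lemma max_set_finite:
  assumes "hereditary \<H>" "nontrivial \<H>"
  shows "finite {dist_to_property G \<H> | G. finite_simple G \<and> card (verts G) = n \<and>
            int (card (edges G)) = \<lfloor>p * real (n choose 2)\<rfloor>}" (is "finite ?S")
proof (rule finite_subset)
  show "?S \<subseteq> {..n choose 2}"
  proof
    fix d assume "d \<in> ?S"
    then obtain G where G: "d = dist_to_property G \<H>" "finite_simple G" "card (verts G) = n" by blast
    then obtain G' where "G' \<in> \<H>" "verts G' = verts G" "d = edit_dist G G'"
      using dist_to_property_attained[OF assms G(2)] by metis
    then show "d \<in> {..n choose 2}"
      using edit_dist_le[OF G(2)] G(3) hereditary_finite_simple[OF assms(1)] by auto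
  qed
qed simp

lemma dist_le_max_dist:
  assumes "hereditary \<H>" "nontrivial \<H>" "0 \<le> p" "p \<le> 1"
    and "finite_simple G" "card (verts G) = n" "card (edges G) = edge_target p n"
  shows "dist_to_property G \<H> \<le> max_dist \<H> p n"
  unfolding max_dist_def
  by (rule Max_ge[OF max_set_finite[OF assms(1,2)]])
    (use assms edge_target_bounds(2)[OF assms(3,4)] in auto)

lemma adjust_edge_count:
  assumes "finite_simple G" "e \<le> card (verts G) choose 2"
  obtains G2 where "finite_simple G2" "verts G2 = verts G" "card (edges G2) = e"
    "edit_dist G G2 = (if e \<le> card (edges G) then card (edges G) - e else e - card (edges G))"
proof (cases "e \<le> card (edges G)")
  case True
  then obtain E where E: "E \<subseteq> edges G" "card E = e"
    using obtain_subset_with_card_n by metis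
  have "finite E" using E assms(1) finite_subset finite_simpleD(3) by blast
  moreover have "(edges G - E) \<union> (E - edges G) = edges G - E" using E by auto
  ultimately show ?thesis using E assms(1) True
    by (intro that[of "UGraph (verts G) E"])
      (auto simp: finite_simple_def edit_dist_def card_Diff_subset)
next
  case False
  have fin: "finite (all_pairs (verts G))" using assms(1) by (simp add: finite_all_pairs finite_simple_def)
  have sub: "edges G \<subseteq> all_pairs (verts G)" and fE: "finite (edges G)" using finite_simpleD assms(1) by blast+
  have "card (all_pairs (verts G)) = card (verts G) choose 2"
    using assms(1) by (simp add: card_all_pairs finite_simple_def)
  then have "e - card (edges G) \<le> card (all_pairs (verts G) - edges G)"
    using assms(2) sub fE by (simp add: card_Diff_subset)
  then obtain E where E: "E \<subseteq> all_pairs (verts G) - edges G" "card E = e - card (edges G)"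
    using obtain_subset_with_card_n by metis
  then have fE': "finite E" using fin finite_subset by blast
  have "card (edges G \<union> E) = e" using E False fE fE'
    by (subst card_Un_disjoint) auto
  moreover have "(edges G - (edges G \<union> E)) \<union> ((edges G \<union> E) - edges G) = E" using E by auto
  ultimately show ?thesis using E assms(1) False sub
    by (intro that[of "UGraph (verts G) (edges G \<union> E)"])
      (auto simp: finite_simple_def edit_dist_def)
qed

text \<open>The test graphs, blow-ups and quasirandom graphs, have only approximately the prescribed
  number of edges. Correcting the number by adding or deleting edges changes the distance by at most
  the error.\<close>

lemma max_dist_ge:
  assumes "hereditary \<H>" "nontrivial \<H>" "0 \<le> p" "p \<le> 1" "finite_simple G" "card (verts G) = n"
  shows "real (dist_to_property G \<H>) - \<bar>real (card (edges G)) - real (edge_target p n)\<bar>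
           \<le> real (max_dist \<H> p n)"
proof -
  have "edge_target p n \<le> card (verts G) choose 2" using assms edge_target_bounds(1) by blast
  from adjust_edge_count[OF assms(5) this] obtain G2 where G2: "finite_simple G2" "verts G2 = verts G"
    "card (edges G2) = edge_target p n"
    "real (edit_dist G G2) = \<bar>real (card (edges G)) - real (edge_target p n)\<bar>"
    by (smt (verit) of_nat_diff of_nat_le_iff nle_le)
  obtain G' where G': "G' \<in> \<H>" "verts G' = verts G2" "dist_to_property G2 \<H> = edit_dist G2 G'"
    using dist_to_property_attained[OF assms(1,2) G2(1)] by metis
  have "dist_to_property G \<H> \<le> edit_dist G G'"
    using dist_to_property_le assms G' G2 by metis
  also have "\<dots> \<le> edit_dist G G2 + edit_dist G2 G'"
    using edit_dist_triangle assms G' G2 hereditary_finite_simple by metis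
  also have "edit_dist G2 G' \<le> max_dist \<H> p n"
    using dist_le_max_dist assms G2 G'(3) by metis
  finally have "real (dist_to_property G \<H>) \<le> real (edit_dist G G2) + real (max_dist \<H> p n)" by linarith
  then show ?thesis using G2(4) by linarith
qed

lemma max_dist_attained:
  assumes "hereditary \<H>" "nontrivial \<H>" "0 \<le> p" "p \<le> 1"
  obtains G where "finite_simple G" "card (verts G) = n" "card (edges G) = edge_target p n"
    "max_dist \<H> p n = dist_to_property G \<H>"
proof -
  let ?S = "{dist_to_property G \<H> | G. finite_simple G \<and> card (verts G) = n \<and>
            int (card (edges G)) = \<lfloor>p * real (n choose 2)\<rfloor>}"
  have "finite_simple (UGraph {..<n} {})" by (simp add: finite_simple_def)
  moreover have "edge_target p n \<le> card (verts (UGraph {..<n} {})) choose 2"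
    using edge_target_bounds(1)[OF assms(3,4)] by simp
  ultimately obtain G where "finite_simple G" "card (verts G) = n" "card (edges G) = edge_target p n"
    by (metis adjust_edge_count card_lessThan ugraph.sel(1))
  then have "?S \<noteq> {}" using edge_target_bounds(2)[OF assms(3,4)] by auto
  from Max_in[OF max_set_finite[OF assms(1,2)] this] obtain G where
    "finite_simple G" "card (verts G) = n" "int (card (edges G)) = \<lfloor>p * real (n choose 2)\<rfloor>"
    "max_dist \<H> p n = dist_to_property G \<H>"
    unfolding max_dist_def by blast
  then show ?thesis using that edge_target_bounds(2)[OF assms(3,4)] by (metis of_nat_eq_iff)
qed

lemma max_dist_le:
  assumes "hereditary \<H>" "nontrivial \<H>" "0 \<le> p" "p \<le> 1"
  shows "max_dist \<H> p n \<le> n choose 2"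
proof -
  obtain G where G: "finite_simple G" "card (verts G) = n" "max_dist \<H> p n = dist_to_property G \<H>"
    using max_dist_attained[OF assms] by metis
  then obtain G' where "G' \<in> \<H>" "verts G' = verts G" "max_dist \<H> p n = edit_dist G G'"
    using dist_to_property_attained[OF assms(1,2) G(1)] by metis
  then show ?thesis
    using edit_dist_le[OF G(1)] G(2) hereditary_finite_simple[OF assms(1)] by auto
qed

section \<open>Upper bounds by random colourings\<close>

lemma exists_le_average:
  fixes f :: "nat \<Rightarrow> real"
  assumes "0 < k"
  obtains a where "a < k" "f a \<le> (\<Sum>a<k. f a) / k"
proof -
  have "\<exists>a<k. f a \<le> (\<Sum>a<k. f a) / k"
  proof (rule ccontr)
    assume "\<not> ?thesis"
    then have "(\<Sum>a<k. (\<Sum>a<k. f a) / k) < (\<Sum>a<k. f a)"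
      using assms by (intro sum_strict_mono) auto
    then show False using assms by simp
  qed
  then show ?thesis using that by blast
qed

text \<open>
  The method of conditional expectations; the unary weights \<open>r\<close> absorb the vertices already assigned.
\<close>

lemma exists_assignment_unary:
  fixes w :: "'a \<Rightarrow> 'a \<Rightarrow> nat \<Rightarrow> nat \<Rightarrow> real" and r :: "'a \<Rightarrow> nat \<Rightarrow> real"
  assumes "0 < k" "finite V"
  shows "\<exists>c. (\<forall>v. c v < k) \<and>
     (\<Sum>u\<in>V. r u (c u)) + (\<Sum>u\<in>V. \<Sum>v\<in>V - {u}. w u v (c u) (c v))
       \<le> (\<Sum>u\<in>V. \<Sum>a<k. r u a) / k + (\<Sum>u\<in>V. \<Sum>v\<in>V - {u}. \<Sum>a<k. \<Sum>b<k. w u v a b) / k\<^sup>2"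
  using assms(2)
proof (induction V arbitrary: r rule: finite_induct)
  case empty
  show ?case using assms(1) by auto
next
  case (insert x V)
  define S where "S = (\<Sum>u\<in>V. \<Sum>v\<in>V - {u}. \<Sum>a<k. \<Sum>b<k. w u v a b)"
  \<comment> \<open>\<open>r' a\<close> charges to each remaining vertex its two interactions with
    \<open>x\<close> when \<open>x\<close> gets the colour \<open>a\<close>. Then \<open>h a\<close>
    is the expected cost given that choice, up to the constant \<open>S / k\<^sup>2\<close>.\<close>
  define r' where "r' a u b = r u b + (w x u a b + w u x b a)" for a u b
  define h where "h a = r x a + (\<Sum>u\<in>V. \<Sum>b<k. r' a u b) / k" for a
  obtain a where a: "a < k" "h a \<le> (\<Sum>a<k. h a) / k"
    using exists_le_average[OF assms(1)] .
  obtain c where c: "\<forall>v. c v < k"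
    "(\<Sum>u\<in>V. r' a u (c u)) + (\<Sum>u\<in>V. \<Sum>v\<in>V - {u}. w u v (c u) (c v))
       \<le> (\<Sum>u\<in>V. \<Sum>b<k. r' a u b) / k + S / k\<^sup>2"
    using insert.IH[of "r' a"] unfolding S_def by blast
  have split: "(\<Sum>u\<in>insert x V. \<Sum>v\<in>insert x V - {u}. f u v)
      = (\<Sum>u\<in>V. f x u + f u x) + (\<Sum>u\<in>V. \<Sum>v\<in>V - {u}. f u v)" for f :: "'a \<Rightarrow> 'a \<Rightarrow> real"
  proof -
    have "(\<Sum>u\<in>insert x V. \<Sum>v\<in>insert x V - {u}. f u v)
        = (\<Sum>v\<in>V. f x v) + (\<Sum>u\<in>V. \<Sum>v\<in>insert x V - {u}. f u v)"
      using insert.hyps by simp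
    also have "(\<Sum>u\<in>V. \<Sum>v\<in>insert x V - {u}. f u v) = (\<Sum>u\<in>V. f u x + (\<Sum>v\<in>V - {u}. f u v))"
    proof (rule sum.cong)
      fix u assume "u \<in> V"
      then have "insert x V - {u} = insert x (V - {u})" using insert.hyps by auto
      then show "(\<Sum>v\<in>insert x V - {u}. f u v) = f u x + (\<Sum>v\<in>V - {u}. f u v)"
        using insert.hyps by simp
    qed simp
    finally show ?thesis by (simp add: sum.distrib)
  qed
  define c' where "c' = c(x := a)"
  have c'V: "c' u = c u" if "u \<in> V" for u using that insert.hyps by (auto simp: c'_def)
  have "(\<Sum>u\<in>insert x V. r u (c' u)) + (\<Sum>u\<in>insert x V. \<Sum>v\<in>insert x V - {u}. w u v (c' u) (c' v))
      = r x a + (\<Sum>u\<in>V. r u (c u)) + ((\<Sum>u\<in>V. w x u a (c u) + w u x (c u) a)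
          + (\<Sum>u\<in>V. \<Sum>v\<in>V - {u}. w u v (c u) (c v)))"
    using insert.hyps by (simp add: split c'V) (simp add: c'_def)
  also have "\<dots> = r x a + ((\<Sum>u\<in>V. r' a u (c u)) + (\<Sum>u\<in>V. \<Sum>v\<in>V - {u}. w u v (c u) (c v)))"
    by (simp add: r'_def sum.distrib)
  also have "\<dots> \<le> h a + S / k\<^sup>2"
    using c(2) by (simp add: h_def)
  also have "\<dots> \<le> (\<Sum>a<k. h a) / k + S / k\<^sup>2" using a by simp
  also have "(\<Sum>a<k. h a) / k = (\<Sum>u\<in>insert x V. \<Sum>a<k. r u a) / k
       + (\<Sum>u\<in>V. (\<Sum>a<k. \<Sum>b<k. w x u a b) + (\<Sum>a<k. \<Sum>b<k. w u x a b)) / k\<^sup>2"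
  proof -
    have "(\<Sum>a<k. \<Sum>u\<in>V. \<Sum>b<k. r' a u b) = (\<Sum>u\<in>V. \<Sum>a<k. \<Sum>b<k. r' a u b)"
      by (rule sum.swap)
    also have "\<dots> = (\<Sum>u\<in>V. k * (\<Sum>b<k. r u b) + ((\<Sum>a<k. \<Sum>b<k. w x u a b) + (\<Sum>a<k. \<Sum>b<k. w u x a b)))"
    proof (rule sum.cong[OF refl])
      fix u
      have "(\<Sum>a<k. \<Sum>b<k. w u x b a) = (\<Sum>a<k. \<Sum>b<k. w u x a b)" by (rule sum.swap)
      then show "(\<Sum>a<k. \<Sum>b<k. r' a u b)
         = k * (\<Sum>b<k. r u b) + ((\<Sum>a<k. \<Sum>b<k. w x u a b) + (\<Sum>a<k. \<Sum>b<k. w u x a b))"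
        by (simp add: r'_def sum.distrib)
    qed
    also have "\<dots> = k * (\<Sum>u\<in>V. \<Sum>b<k. r u b)
       + (\<Sum>u\<in>V. (\<Sum>a<k. \<Sum>b<k. w x u a b) + (\<Sum>a<k. \<Sum>b<k. w u x a b))"
      by (simp add: sum.distrib sum_distrib_left)
    finally show ?thesis
      using insert.hyps assms(1)
      by (simp add: h_def sum.distrib sum_divide_distrib[symmetric] add_divide_distrib power2_eq_square)
  qed
  finally have "(\<Sum>u\<in>insert x V. r u (c' u)) + (\<Sum>u\<in>insert x V. \<Sum>v\<in>insert x V - {u}. w u v (c' u) (c' v))
     \<le> (\<Sum>u\<in>insert x V. \<Sum>a<k. r u a) / k
       + (\<Sum>u\<in>insert x V. \<Sum>v\<in>insert x V - {u}. \<Sum>a<k. \<Sum>b<k. w u v a b) / k\<^sup>2"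
    unfolding split S_def by (simp add: add_divide_distrib)
  moreover have "\<forall>v. c' v < k" using c(1) a(1) by (simp add: c'_def)
  ultimately show ?case by blast
qed

text \<open>Besides colours, the labels assigned in this way are the representatives of the classes
  of a blow-up.\<close>

lemma exists_assignment_le_average:
  fixes w :: "'a \<Rightarrow> 'a \<Rightarrow> nat \<Rightarrow> nat \<Rightarrow> real"
  assumes "0 < k" "finite V"
  obtains c where "\<And>v. c v < k"
    "(\<Sum>u\<in>V. \<Sum>v\<in>V - {u}. w u v (c u) (c v))
       \<le> (\<Sum>u\<in>V. \<Sum>v\<in>V - {u}. \<Sum>a<k. \<Sum>b<k. w u v a b) / k\<^sup>2"
  using exists_assignment_unary[OF assms, of "\<lambda>_ _. 0" w] by auto

lemma sum_ordered_pairs: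
  assumes "finite V" "E \<subseteq> all_pairs V"
  shows "(\<Sum>u\<in>V. \<Sum>v\<in>V - {u}. of_bool ({u, v} \<in> E)) = 2 * real (card E)"
proof -
  have fE: "finite E" using assms finite_all_pairs finite_subset by blast
  define T where "T = (SIGMA u:V. {v \<in> V - {u}. {u, v} \<in> E})"
  have T: "T = {(u, v). {u, v} \<in> E}"
    using assms(2) doubleton_in_all_pairs[of _ _ V] by (fastforce simp: T_def)
  have "(\<Sum>u\<in>V. \<Sum>v\<in>V - {u}. of_bool ({u, v} \<in> E)) = (\<Sum>u\<in>V. real (card {v \<in> V - {u}. {u, v} \<in> E}))"
    using assms(1) by (intro sum.cong) (auto simp: Int_def of_bool_def sum.If_cases)
  also have "\<dots> = real (card T)"
    unfolding T_def using assms(1) by (subst card_SigmaI) auto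
  also have "card T = (\<Sum>e\<in>E. card {t \<in> T. (\<lambda>(u, v). {u, v}) t = e})"
  proof -
    have "card T = card (\<Union>e\<in>E. {t \<in> T. (\<lambda>(u, v). {u, v}) t = e})"
      by (rule arg_cong[where f = card]) (auto simp: T)
    also have "\<dots> = (\<Sum>e\<in>E. card {t \<in> T. (\<lambda>(u, v). {u, v}) t = e})"
      using fE assms(1) by (intro card_UN_disjoint) (auto simp: T_def)
    finally show ?thesis .
  qed
  also have "\<dots> = (\<Sum>e\<in>E. 2)"
  proof (rule sum.cong[OF refl])
    fix e assume e: "e \<in> E"
    then have "e \<in> all_pairs V" using assms(2) by blast
    then obtain x y where xy: "e = {x, y}" "x \<noteq> y" by (auto elim: all_pairsE)
    then have "{t \<in> T. (\<lambda>(u, v). {u, v}) t = e} = {(x, y), (y, x)}"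
      using e by (auto simp: T doubleton_eq_iff insert_commute)
    then show "card {t \<in> T. (\<lambda>(u, v). {u, v}) t = e} = 2" using xy by simp
  qed
  finally show ?thesis by simp
qed

text \<open>A random colouring makes a pair monochromatic with probability 1/k. Pairs in
  \<open>E\<close> are charged when monochromatic, pairs in \<open>N\<close> when not. With
  \<open>N\<close> the nonedges this counts the edits to a complete multipartite graph, with
  \<open>N\<close> empty the deletions that leave a \<open>k\<close>-colourable graph.\<close>

lemma exists_good_colouring:
  fixes k :: nat
  assumes "0 < k" "finite V" "E \<subseteq> all_pairs V" "N \<subseteq> all_pairs V"
  obtains c where "\<And>v. c v < k"
    "real (card {e \<in> E. \<exists>a. c ` e = {a}}) + real (card {e \<in> N. \<not> (\<exists>a. c ` e = {a})})
       \<le> card E / k + card N * (1 - 1 / k)"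
proof -
  define w :: "nat \<Rightarrow> nat \<Rightarrow> nat \<Rightarrow> nat \<Rightarrow> real" where "w u v a b = of_bool ({u, v} \<in> E) * of_bool (a = b) + of_bool ({u, v} \<in> N) * (1 - of_bool (a = b))"
    for u v a b
  have "(\<Sum>a<k. \<Sum>b<k. w u v a b)
     = (of_bool ({u, v} \<in> E) :: real) * real k + (of_bool ({u, v} \<in> N) :: real) * (real k * real k - real k)" for u v :: nat
  proof -
    have "(\<Sum>a<k. \<Sum>b<k. x * of_bool (a = b) + y * (1 - of_bool (a = b))) = x * real k + y * (real k * real k - real k)"
      for x y :: real
    proof -
      have "(\<Sum>b<k. x * of_bool (a = b) + y * (1 - of_bool (a = b))) = x + y * (real k - 1)" if "a < k" for a
      proof -
        have "(\<Sum>b<k. of_bool (a = b)) = (1 :: real)" using that by (simp add: of_bool_def)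
        then show ?thesis by (simp only: sum.distrib sum_subtractf sum_distrib_left[symmetric]) simp
      qed
      then have "(\<Sum>a<k. \<Sum>b<k. x * of_bool (a = b) + y * (1 - of_bool (a = b))) = (\<Sum>a<k. x + y * (real k - 1))"
        by (intro sum.cong) auto
      then show ?thesis by (simp add: algebra_simps)
    qed
    then show ?thesis unfolding w_def .
  qed
  then have tot: "(\<Sum>u\<in>V. \<Sum>v\<in>V - {u}. \<Sum>a<k. \<Sum>b<k. w u v a b)
     = 2 * card E * k + 2 * card N * (real k * real k - real k)"
    using sum_ordered_pairs[OF assms(2,3)] sum_ordered_pairs[OF assms(2,4)]
    by (simp add: sum.distrib sum_distrib_right[symmetric])
  obtain c where c: "\<And>v. c v < k" "(\<Sum>u\<in>V. \<Sum>v\<in>V - {u}. w u v (c u) (c v))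
       \<le> (\<Sum>u\<in>V. \<Sum>v\<in>V - {u}. \<Sum>a<k. \<Sum>b<k. w u v a b) / k\<^sup>2"
    using exists_assignment_le_average[OF assms(1,2), of w] by blast
  let ?E = "{e \<in> E. \<exists>a. c ` e = {a}}" and ?N = "{e \<in> N. \<not> (\<exists>a. c ` e = {a})}"
  have "w u v (c u) (c v) = of_bool ({u, v} \<in> ?E) + of_bool ({u, v} \<in> ?N)" for u v
    by (auto simp: w_def)
  then have "(\<Sum>u\<in>V. \<Sum>v\<in>V - {u}. w u v (c u) (c v)) = 2 * card ?E + 2 * card ?N"
    using sum_ordered_pairs[of V ?E] sum_ordered_pairs[of V ?N] assms
    by (simp add: sum.distrib subset_iff)
  then have "2 * real (card ?E) + 2 * card ?N \<le> (2 * card E * k + 2 * card N * (real k * real k - real k)) / k\<^sup>2"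
    using c(2) tot by simp
  also have "\<dots> = 2 * (card E / k + card N * (1 - 1 / k))"
    using assms(1) by (simp add: field_simps power2_eq_square)
  finally have "real (card ?E) + card ?N \<le> card E / k + card N * (1 - 1 / k)"
    by (simp add: distrib_left[symmetric] del: distrib_left_numeral)
  then show ?thesis using that[of c] c(1) by blast
qed

section \<open>Membership in the property by colourings\<close>

lemma chromatic_number_le:
  assumes "c ` verts G \<subseteq> {..<k}" "\<And>u v. {u, v} \<in> edges G \<Longrightarrow> c u \<noteq> (c v :: nat)"
  shows "chromatic_number G \<le> k"
  unfolding chromatic_number_def by (rule Least_le) (use assms in blast)

lemma property_chromatic_number_le:
  "F \<in> forbidden_graphs \<H> \<Longrightarrow> property_chromatic_number \<H> \<le> chromatic_number F"
  unfolding property_chromatic_number_def by (rule cINF_lower) auto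

lemma finite_simple_edge_distinct: "finite_simple G \<Longrightarrow> {u, v} \<in> edges G \<Longrightarrow> u \<in> verts G \<and> v \<in> verts G \<and> u \<noteq> v"
  using doubleton_in_all_pairs unfolding finite_simple_def by blast

text \<open>Colourability passes to induced subgraphs, whereas a forbidden one would need more than
  \<open>k\<close> colours.\<close>

lemma colourable_in_property:
  assumes "finite_simple G" "\<And>v. c v < k" "\<And>u v. {u, v} \<in> edges G \<Longrightarrow> c u \<noteq> c v"
    and "k < property_chromatic_number \<H>"
  shows "G \<in> \<H>"
proof (rule ccontr)
  assume "G \<notin> \<H>"
  then obtain W where W: "W \<subseteq> verts G" "induced_subgraph G W \<in> forbidden_graphs \<H>"
    using contains_forbidden assms(1) by blast
  have "chromatic_number (induced_subgraph G W) \<le> k"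
    using assms by (intro chromatic_number_le[of c]) (auto simp: induced_subgraph_def)
  with property_chromatic_number_le[OF W(2)] assms(4) show False by simp
qed

text \<open>Parts must be nonempty, so only the colours that occur are counted.\<close>

lemma complete_multipartite_by_colouring:
  assumes "edges G = {e \<in> all_pairs (verts G). \<not> (\<exists>a. c ` e = {a})}"
  shows "complete_multipartite (card (c ` verts G)) G"
proof -
  define P where "P = (\<lambda>a. {v \<in> verts G. c v = a}) ` (c ` verts G)"
  have inj: "inj_on (\<lambda>a. {v \<in> verts G. c v = a}) (c ` verts G)"
    by (rule inj_onI) blast
  have "partition_on (verts G) P"
    unfolding P_def by (rule partition_onI) (auto simp: disjnt_def)
  moreover have "card P = card (c ` verts G)"
    unfolding P_def using inj by (rule card_image)
  moreover have "(\<exists>A\<in>P. e \<subseteq> A) \<longleftrightarrow> (\<exists>a. c ` e = {a})" if e: "e \<in> all_pairs (verts G)" for e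
  proof -
    from e obtain x y where "e = {x, y}" "x \<in> verts G" "y \<in> verts G" by (rule all_pairsE)
    then show ?thesis by (auto simp: P_def)
  qed
  then have "edges G = {e \<in> all_pairs (verts G). \<not> (\<exists>A\<in>P. e \<subseteq> A)}"
    unfolding assms by blast
  ultimately show ?thesis
    unfolding complete_multipartite_def by blast
qed

lemma complete_multipartite_in_property:
  assumes "hereditary \<H>" "nontrivial \<H>" "finite_simple G" "\<And>v. c v < k"
    and edges: "edges G = {e \<in> all_pairs (verts G). \<not> (\<exists>a. c ` e = {a})}"
    and "\<And>j F. 0 < j \<Longrightarrow> j \<le> k \<Longrightarrow> F \<in> forbidden_graphs \<H> \<Longrightarrow> \<not> complete_multipartite j F"
  shows "G \<in> \<H>"
proof (rule ccontr)
  assume "G \<notin> \<H>"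
  then obtain W where W: "W \<subseteq> verts G" "induced_subgraph G W \<in> forbidden_graphs \<H>"
    using contains_forbidden assms(3) by blast
  let ?F = "induced_subgraph G W"
  \<comment> \<open>Only positive numbers of parts are excluded by assumption. The empty graph has
    zero parts and is ruled out by nontriviality, which makes it a member.\<close>
  have "W \<noteq> {}"
  proof
    assume "W = {}"
    moreover obtain G0 where "G0 \<in> \<H>" "verts G0 = {}"
      using exists_on_vertex_set[OF assms(1,2)] by blast
    moreover have "all_pairs {} = {}" by (auto simp: all_pairs_def)
    then have "edges G0 = {}"
      using hereditary_finite_simple[OF assms(1) \<open>G0 \<in> \<H>\<close>] \<open>verts G0 = {}\<close>
      by (simp add: finite_simple_def)
    moreover have "{} \<notin> edges G"
      using finite_simpleD(2)[OF assms(3)] by (auto simp: all_pairs_def)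
    then have "?F = UGraph {} {}"
      using \<open>W = {}\<close> by (auto simp: induced_subgraph_def)
    ultimately have "?F = G0" by (cases G0) simp
    then have "?F \<in> \<H>" using \<open>G0 \<in> \<H>\<close> by simp
    with W(2) show False using forbidden_graphs_notin by blast
  qed
  have fin: "finite W" using W(1) assms(3) finite_subset finite_simpleD(1) by blast
  have "edges ?F = {e \<in> all_pairs (verts ?F). \<not> (\<exists>a. c ` e = {a})}"
    using W(1) edges by (auto simp: induced_subgraph_def all_pairs_def)
  from complete_multipartite_by_colouring[OF this]
  have "complete_multipartite (card (c ` W)) ?F" by (simp add: induced_subgraph_def)
  moreover have "0 < card (c ` W)" using \<open>W \<noteq> {}\<close> fin by (simp add: card_gt_0_iff)
  moreover have "card (c ` W) \<le> k"
    using card_mono[of "{..<k}" "c ` W"] assms(4) by auto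
  ultimately show False using assms(6) W(2) by blast
qed

lemma max_dist_upper_chromatic:
  fixes k :: nat
  assumes "hereditary \<H>" "nontrivial \<H>" "0 \<le> p" "p \<le> 1"
    and "0 < k" "k < property_chromatic_number \<H>"
  shows "real (max_dist \<H> p n) \<le> p / k * real (n choose 2)"
proof -
  obtain G where G: "finite_simple G" "card (verts G) = n" "card (edges G) = edge_target p n"
    "max_dist \<H> p n = dist_to_property G \<H>"
    using max_dist_attained[OF assms(1-4)] .
  obtain c where c: "\<And>v. c v < k" "real (card {e \<in> edges G. \<exists>a. c ` e = {a}}) \<le> card (edges G) / k"
    by (rule exists_good_colouring[OF assms(5) finite_simpleD(1,2)[OF G(1)], of "{}"]) auto
  let ?M = "{e \<in> edges G. \<exists>a. c ` e = {a}}"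
  let ?G' = "UGraph (verts G) (edges G - ?M)"
  have fs: "finite_simple ?G'" using G(1) by (auto simp: finite_simple_def)
  have "?G' \<in> \<H>"
  proof (rule colourable_in_property[OF fs c(1) _ assms(6)])
    fix u v assume "{u, v} \<in> edges ?G'"
    then have "c ` {u, v} \<noteq> {c u}" by auto
    then show "c u \<noteq> c v" by auto
  qed
  moreover have "edit_dist G ?G' = card ?M"
    unfolding edit_dist_def by (rule arg_cong[where f = card]) auto
  ultimately have "max_dist \<H> p n \<le> card ?M"
    using dist_to_property_le[OF assms(1) G(1), of ?G'] G(4) by simp
  then have "real (max_dist \<H> p n) \<le> edge_target p n / k" using c(2) G(3) by simp
  also have "\<dots> \<le> (p * real (n choose 2)) / k"
    using edge_target_bounds(3)[OF assms(3,4)] by (intro divide_right_mono) auto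
  finally show ?thesis by simp
qed

text \<open>The average number of edits per pair is p/k + (1 - p)(1 - 1/k), which equals the
  coefficient here; the final 1 absorbs the rounding of the number of edges.\<close>

lemma max_dist_upper_multipartite:
  fixes k :: nat
  assumes "hereditary \<H>" "nontrivial \<H>" "0 \<le> p" "p \<le> 1" "0 < k"
    and "\<And>j F. 0 < j \<Longrightarrow> j \<le> k \<Longrightarrow> F \<in> forbidden_graphs \<H> \<Longrightarrow> \<not> complete_multipartite j F"
  shows "real (max_dist \<H> p n) \<le> (1 - p + (2 * p - 1) / k) * real (n choose 2) + 1"
proof -
  obtain G where G: "finite_simple G" "card (verts G) = n" "card (edges G) = edge_target p n"
    "max_dist \<H> p n = dist_to_property G \<H>"
    using max_dist_attained[OF assms(1-4)] .
  let ?N = "all_pairs (verts G) - edges G"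
  have "?N \<subseteq> all_pairs (verts G)" by auto
  then obtain c where c: "\<And>v. c v < k"
    "real (card {e \<in> edges G. \<exists>a. c ` e = {a}}) + real (card {e \<in> ?N. \<not> (\<exists>a. c ` e = {a})})
       \<le> card (edges G) / k + card ?N * (1 - 1 / k)"
    by (rule exists_good_colouring[OF assms(5) finite_simpleD(1,2)[OF G(1)], of ?N]) auto
  let ?M = "{e \<in> edges G. \<exists>a. c ` e = {a}}" and ?M' = "{e \<in> ?N. \<not> (\<exists>a. c ` e = {a})}"
  let ?G' = "UGraph (verts G) {e \<in> all_pairs (verts G). \<not> (\<exists>a. c ` e = {a})}"
  have fs: "finite_simple ?G'" using G(1) by (auto simp: finite_simple_def)
  have "?G' \<in> \<H>"
    using assms(1,2) fs c(1) by (rule complete_multipartite_in_property) (use assms(6) in auto)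
  then have "max_dist \<H> p n \<le> edit_dist G ?G'"
    using dist_to_property_le[OF assms(1) G(1), of ?G'] G(4) by simp
  also have "edit_dist G ?G' = card (?M \<union> ?M')"
    unfolding edit_dist_def using finite_simpleD(2)[OF G(1)]
    by (intro arg_cong[where f = card]) auto
  also have "\<dots> \<le> card ?M + card ?M'" by (rule card_Un_le)
  finally have 1: "real (max_dist \<H> p n) \<le> card (edges G) / k + card ?N * (1 - 1 / k)"
    using c(2) by linarith
  let ?C = "real (n choose 2)" and ?e = "real (edge_target p n)"
  have "card ?N = (n choose 2) - edge_target p n"
    using finite_simpleD[OF G(1)] G(2,3) by (simp add: card_Diff_subset card_all_pairs)
  then have N: "real (card ?N) = ?C - ?e"
    using edge_target_bounds(1)[OF assms(3,4)] by (simp add: of_nat_diff)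
  have k: "0 \<le> 1 / real k" "1 / real k \<le> 1" using assms(5) by auto
  have e: "0 \<le> p * ?C - ?e" "p * ?C - ?e \<le> 1"
    using edge_target_bounds(3,4)[OF assms(3,4), of n] by linarith+
  have "card (edges G) / k + card ?N * (1 - 1 / k)
      = (1 - p + (2 * p - 1) / k) * ?C + (p * ?C - ?e) * (1 - 2 * (1 / k))"
    unfolding N G(3) using assms(5) by (simp add: field_simps)
  also have "(p * ?C - ?e) * (1 - 2 * (1 / k)) \<le> 1 * 1"
    using e k by (smt (verit, best) mult_left_le mult_less_0_iff mult_nonneg_nonpos)
  finally show ?thesis using 1 by linarith
qed

section \<open>Blow-ups and existence of the limit\<close>

text \<open>Take an extremal graph on \<open>n\<close> vertices, replace each vertex by an
  independent class of size \<open>t\<close>, and add isolated vertices. Let \<open>D\<close> be the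
  edits from the blow-up to a nearest member of the property. A random transversal contains a given
  edit between two classes with probability \<open>1 / t^2\<close>, and the member restricted to the
  transversal is a member close to the extremal graph. The subtracted term corrects the number of
  edges.\<close>

lemma max_dist_blowup:
  assumes "hereditary \<H>" "nontrivial \<H>" "0 \<le> p" "p \<le> 1" "0 < n" "n * t \<le> N"
  shows "real t ^ 2 * max_dist \<H> p n - \<bar>real t ^ 2 * edge_target p n - edge_target p N\<bar>
           \<le> real (max_dist \<H> p N)"
proof (cases "t = 0")
  case True
  obtain G where "finite_simple G" "card (verts G) = N" "card (edges G) = edge_target p N"
    using max_dist_attained[OF assms(1-4)] .
  then show ?thesis using True by simp
next
  case False
  obtain G0 where G0: "finite_simple G0" "card (verts G0) = n" "card (edges G0) = edge_target p n"
    "max_dist \<H> p n = dist_to_property G0 \<H>"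
    using max_dist_attained[OF assms(1-4)] .
  obtain \<beta> where \<beta>: "bij_betw \<beta> {..<n} (verts G0)"
    using ex_bij_betw_nat_finite[OF finite_simpleD(1)[OF G0(1)]] G0(2) atLeast0LessThan by metis
  define \<iota> where "\<iota> = inv_into {..<n} \<beta>"
  define V where "V = verts G0"
  have fV: "finite V" using G0(1) finite_simpleD(1) V_def by blast
  have \<iota>: "\<iota> u < n" "\<beta> (\<iota> u) = u" if "u \<in> V" for u
    using that \<beta> unfolding \<iota>_def V_def
    by (metis bij_betw_inv_into bij_betwE lessThan_iff) (metis that \<beta> V_def bij_betw_inv_into_right)
  have \<iota>_inj: "\<iota> u = \<iota> v \<longleftrightarrow> u = v" if "u \<in> V" "v \<in> V" for u v using \<iota> that by metis
  \<comment> \<open>The class of \<open>u\<close> is the block of \<open>t\<close> consecutive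
    numbers starting at \<open>\<iota> u * t\<close>; \<open>cls\<close> and \<open>mod\<close>
    recover the class and the position in it.\<close>
  define vx where "vx u a = \<iota> u * t + a" for u a
  have vx_lt: "vx u a < n * t" if "u \<in> V" "a < t" for u a
  proof -
    have "\<iota> u * t + a < Suc (\<iota> u) * t" using that by simp
    also have "\<dots> \<le> n * t" using \<iota>(1)[OF that(1)] by (intro mult_le_mono1) simp
    finally show ?thesis by (simp add: vx_def)
  qed
  have vx_div: "vx u a div t = \<iota> u" "vx u a mod t = a" if "a < t" for u a
    using that by (auto simp: vx_def)
  define cls where "cls x = \<beta> (x div t)" for x
  have cls_vx: "cls (vx u a) = u" if "u \<in> V" "a < t" for u a
    using that by (simp add: cls_def vx_div \<iota>)
  have cls_in: "cls x \<in> V" and vx_cls: "vx (cls x) (x mod t) = x" if "x < n * t" for x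
  proof -
    have "x div t < n" using that False by (simp add: less_mult_imp_div_less)
    then show 1: "cls x \<in> V" using \<beta> unfolding cls_def V_def by (meson bij_betwE lessThan_iff)
    have "\<iota> (cls x) = x div t"
      using \<open>x div t < n\<close> \<beta> unfolding \<iota>_def cls_def by (metis bij_betw_inv_into_left lessThan_iff)
    then show "vx (cls x) (x mod t) = x" by (simp add: vx_def)
  qed
  \<comment> \<open>A pair inside one class has a singleton image under \<open>cls\<close>, which is
    no edge; so the classes are independent.\<close>
  define EB where "EB = {e \<in> all_pairs {..<n * t}. cls ` e \<in> edges G0}"
  define B where "B = UGraph {..<N} EB"
  have all_sub: "all_pairs {..<n * t} \<subseteq> all_pairs {..<N}" using assms(6) by (auto simp: all_pairs_def)
  have B: "finite_simple B" using all_sub by (auto simp: B_def EB_def finite_simple_def)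
  have sum_blow: "(\<Sum>x<n*t. h (cls x) (x mod t)) = (\<Sum>u\<in>V. \<Sum>a<t. h u a)" for h :: "nat \<Rightarrow> nat \<Rightarrow> real"
  proof -
    have "(\<Sum>x<n*t. h (cls x) (x mod t)) = (\<Sum>(u, a)\<in>V \<times> {..<t}. h u a)"
      by (rule sum.reindex_bij_witness[of _ "\<lambda>(u, a). vx u a" "\<lambda>x. (cls x, x mod t)"])
        (use False in \<open>auto simp: vx_cls cls_in cls_vx vx_div vx_lt\<close>)
    then show ?thesis by (simp add: sum.cartesian_product)
  qed
  have pair_sum: "(\<Sum>u\<in>V. \<Sum>v\<in>V - {u}. \<Sum>a<t. \<Sum>b<t. of_bool ({vx u a, vx v b} \<in> E))
       \<le> 2 * real (card E)" if E: "E \<subseteq> all_pairs {..<N}" for E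
  proof -
    have "(\<Sum>u\<in>V. \<Sum>v\<in>V - {u}. \<Sum>a<t. \<Sum>b<t. of_bool ({vx u a, vx v b} \<in> E))
        \<le> (\<Sum>u\<in>V. \<Sum>v\<in>V. \<Sum>a<t. \<Sum>b<t. (of_bool ({vx u a, vx v b} \<in> E) :: real))"
      by (intro sum_mono sum_mono2) (auto simp: fV sum_nonneg)
    also have "\<dots> = (\<Sum>u\<in>V. \<Sum>a<t. \<Sum>v\<in>V. \<Sum>b<t. of_bool ({vx u a, vx v b} \<in> E))"
      by (rule sum.cong[OF refl], rule sum.swap)
    also have "\<dots> = (\<Sum>x<n*t. \<Sum>y<n*t. of_bool ({vx (cls x) (x mod t), vx (cls y) (y mod t)} \<in> E))"
      by (simp only: sum_blow[symmetric])
    also have "\<dots> = (\<Sum>x<n*t. \<Sum>y<n*t. of_bool ({x, y} \<in> E))"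
      by (intro sum.cong refl) (simp add: vx_cls)
    also have "\<dots> = (\<Sum>x<n*t. \<Sum>y\<in>{..<n*t} - {x}. of_bool ({x, y} \<in> E))"
    proof (rule sum.cong[OF refl], rule sum.mono_neutral_right)
      fix x
      show "\<forall>i\<in>{..<n * t} - ({..<n * t} - {x}). of_bool ({x, i} \<in> E) = (0::real)"
        using E by (auto simp: all_pairs_def)
    qed auto
    also have "\<dots> \<le> (\<Sum>x<N. \<Sum>y\<in>{..<N} - {x}. of_bool ({x, y} \<in> E))"
    proof (rule order_trans)
      show "(\<Sum>x<n*t. \<Sum>y\<in>{..<n*t} - {x}. of_bool ({x, y} \<in> E))
         \<le> (\<Sum>x<n*t. \<Sum>y\<in>{..<N} - {x}. (of_bool ({x, y} \<in> E) :: real))"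
        using assms(6) by (intro sum_mono sum_mono2) auto
      show "\<dots> \<le> (\<Sum>x<N. \<Sum>y\<in>{..<N} - {x}. of_bool ({x, y} \<in> E))"
        using assms(6) by (intro sum_mono2) (auto simp: sum_nonneg)
    qed
    also have "\<dots> = 2 * real (card E)" using E by (intro sum_ordered_pairs) auto
    finally show ?thesis .
  qed
  have cardEB: "real (card EB) = real t ^ 2 * edge_target p n"
  proof -
    have "2 * real (card EB) = (\<Sum>x<n*t. \<Sum>y\<in>{..<n*t} - {x}. of_bool ({x, y} \<in> EB))"
      by (intro sum_ordered_pairs[symmetric]) (auto simp: EB_def)
    also have "\<dots> = (\<Sum>x<n*t. \<Sum>y<n*t. of_bool ({cls x, cls y} \<in> edges G0))"
    proof (rule sum.cong[OF refl])
      fix x assume x: "x \<in> {..<n*t}"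
      have "{cls x} \<notin> edges G0" using finite_simpleD(2)[OF G0(1)] by (auto simp: all_pairs_def)
      then have "(\<Sum>y<n*t. of_bool ({cls x, cls y} \<in> edges G0)) =
            (\<Sum>y\<in>{..<n*t} - {x}. (of_bool ({cls x, cls y} \<in> edges G0) :: real))"
        by (intro sum.mono_neutral_right) auto
      then show "(\<Sum>y\<in>{..<n*t} - {x}. of_bool ({x, y} \<in> EB))
          = (\<Sum>y<n*t. (of_bool ({cls x, cls y} \<in> edges G0) :: real))"
        using x by (auto simp: EB_def doubleton_in_all_pairs intro!: sum.cong)
    qed
    also have "\<dots> = (\<Sum>u\<in>V. \<Sum>a<t. \<Sum>v\<in>V. \<Sum>b<t. of_bool ({u, v} \<in> edges G0))"
      by (simp only: sum_blow[symmetric])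
    also have "\<dots> = real t ^ 2 * (\<Sum>u\<in>V. \<Sum>v\<in>V. of_bool ({u, v} \<in> edges G0))"
      by (simp add: sum_distrib_left[symmetric] power2_eq_square del: sum_of_bool_eq)
    also have "(\<Sum>u\<in>V. \<Sum>v\<in>V. of_bool ({u, v} \<in> edges G0)) =
        (\<Sum>u\<in>V. \<Sum>v\<in>V - {u}. (of_bool ({u, v} \<in> edges G0) :: real))"
    proof (rule sum.cong[OF refl], rule sum.mono_neutral_right)
      fix x
      show "\<forall>i\<in>V - (V - {x}). of_bool ({x, i} \<in> edges G0) = (0::real)"
        using finite_simpleD(2)[OF G0(1)] by (auto simp: all_pairs_def)
    qed (auto simp: fV)
    also have "\<dots> = 2 * real (card (edges G0))"
      using finite_simpleD(2)[OF G0(1)] fV unfolding V_def by (intro sum_ordered_pairs)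
    finally show ?thesis using G0(3) by simp
  qed
  have far: "real t ^ 2 * max_dist \<H> p n \<le> real (dist_to_property B \<H>)"
  proof -
    obtain G' where G': "G' \<in> \<H>" "verts G' = verts B" "dist_to_property B \<H> = edit_dist B G'"
      using dist_to_property_attained[OF assms(1,2) B] .
    define D where "D = (edges B - edges G') \<union> (edges G' - edges B)"
    have D: "D \<subseteq> all_pairs {..<N}"
      using finite_simpleD(2)[OF hereditary_finite_simple[OF assms(1) G'(1)]] finite_simpleD(2)[OF B] G'(2)
      by (auto simp: D_def B_def)
    \<comment> \<open>\<open>c\<close> picks one position in each class so that the edits among the
      picked vertices are at most the average.\<close>
    obtain c where c: "\<And>v. c v < t"
      "(\<Sum>u\<in>V. \<Sum>v\<in>V - {u}. of_bool ({vx u (c u), vx v (c v)} \<in> D))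
       \<le> (\<Sum>u\<in>V. \<Sum>v\<in>V - {u}. \<Sum>a<t. \<Sum>b<t. (of_bool ({vx u a, vx v b} \<in> D) :: real)) / t\<^sup>2"
      using exists_assignment_le_average[of t V "\<lambda>u v a b. of_bool ({vx u a, vx v b} \<in> D)"] False fV
      by blast
    define f where "f u = vx u (c u)" for u
    have f_inj: "inj_on f V"
      by (rule inj_onI) (metis c(1) f_def cls_vx)
    have f_im: "f ` V \<subseteq> verts G'"
    proof
      fix x assume "x \<in> f ` V"
      then obtain u where "u \<in> V" "x = vx u (c u)" by (auto simp: f_def)
      then have "x < n * t" using vx_lt c(1) by simp
      then show "x \<in> verts G'" using assms(6) G'(2) by (simp add: B_def)
    qed
    define H where "H = pullback f V G'"
    have H: "H \<in> \<H>" unfolding H_def by (rule hereditary_pullback[OF assms(1) G'(1) f_inj f_im])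
    have "max_dist \<H> p n \<le> edit_dist G0 H"
      using dist_to_property_le[OF assms(1) G0(1) H] G0(4) by (simp add: H_def V_def)
    also have "real (edit_dist G0 H) =
       real (card ((edges G0 - edges H) \<union> (edges H - edges G0)))" by (simp add: edit_dist_def)
    also have "2 * \<dots> = (\<Sum>u\<in>V. \<Sum>v\<in>V - {u}. of_bool ({u, v} \<in> (edges G0 - edges H) \<union> (edges H - edges G0)))"
      using finite_simpleD(2)[OF G0(1)] fV
      by (intro sum_ordered_pairs[symmetric]) (auto simp: H_def V_def)
    also have "\<dots> = (\<Sum>u\<in>V. \<Sum>v\<in>V - {u}. of_bool ({vx u (c u), vx v (c v)} \<in> D))"
    proof (intro sum.cong refl)
      fix u v assume uv: "u \<in> V" "v \<in> V - {u}"
      then have ne: "vx u (c u) \<noteq> vx v (c v)" using c(1) cls_vx by (metis DiffD2 DiffD1 insertI1)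
      have "{vx u (c u), vx v (c v)} \<in> edges B \<longleftrightarrow> {u, v} \<in> edges G0"
        using uv ne c(1) by (simp add: B_def EB_def doubleton_in_all_pairs vx_lt cls_vx)
      moreover have "{vx u (c u), vx v (c v)} \<in> edges G' \<longleftrightarrow> {u, v} \<in> edges H"
        using uv by (simp add: H_def doubleton_in_all_pairs f_def)
      ultimately show "of_bool ({u, v} \<in> (edges G0 - edges H) \<union> (edges H - edges G0)) =
          (of_bool ({vx u (c u), vx v (c v)} \<in> D) :: real)"
        by (simp add: D_def)
    qed
    also have "\<dots> \<le> 2 * real (card D) / t\<^sup>2"
      using c(2) divide_right_mono[OF pair_sum[OF D], of "real (t\<^sup>2)"] by simp
    also have "card D = dist_to_property B \<H>" using G'(3) by (simp add: D_def edit_dist_def)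
    finally show ?thesis using False by (simp add: field_simps)
  qed
  have "real (dist_to_property B \<H>) - \<bar>real (card (edges B)) - real (edge_target p N)\<bar>
           \<le> real (max_dist \<H> p N)"
    by (rule max_dist_ge[OF assms(1-4) B]) (simp add: B_def)
  then show ?thesis using far cardEB by (simp add: B_def)
qed

text \<open>The limit is the supremum of \<open>a n - C / n\<close> over positive \<open>n\<close>,
  which \<open>b\<close> lists with a shift that avoids index 0. By \<open>incr\<close> the sequence
  eventually exceeds every smaller number, and \<open>a N\<close> is at most the supremum plus
  \<open>C / N\<close>.\<close>

lemma convergent_if_almost_increasing:
  fixes a :: "nat \<Rightarrow> real"
  assumes "\<And>n. \<bar>a n\<bar> \<le> 1"
    and incr: "\<And>n e. 0 < n \<Longrightarrow> 0 < e \<Longrightarrow> \<forall>\<^sub>F N in sequentially. a n - C / n - e \<le> a N"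
  shows "convergent a"
proof -
  define b where "b n = a (Suc n) - C / Suc n" for n
  have "b n \<le> 1 + \<bar>C\<bar>" for n
  proof -
    have "\<bar>C\<bar> / Suc n \<le> \<bar>C\<bar> / 1" by (intro divide_left_mono) auto
    then have "\<bar>C / Suc n\<bar> \<le> \<bar>C\<bar>" by simp
    then show ?thesis using assms(1)[of "Suc n"] unfolding b_def by linarith
  qed
  then have bdd: "bdd_above (range b)" by (intro bdd_aboveI) auto
  define L where "L = (SUP n. b n)"
  have "a \<longlonglongrightarrow> L"
  proof (rule order_tendstoI)
    fix y assume "y < L"
    then obtain n where "y < b n" unfolding L_def using less_cSUP_iff[OF _ bdd] by auto
    then have "\<forall>\<^sub>F N in sequentially. a (Suc n) - C / Suc n - (b n - y) / 2 \<le> a N"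
      by (intro incr) auto
    then show "\<forall>\<^sub>F N in sequentially. y < a N"
    proof (rule eventually_mono)
      fix N assume "a (Suc n) - C / Suc n - (b n - y) / 2 \<le> a N"
      moreover have "a (Suc n) - C / Suc n = b n" by (simp add: b_def)
      ultimately have "b n - (b n - y) / 2 \<le> a N" by simp
      then show "y < a N" using \<open>y < b n\<close> by argo
    qed
  next
    fix y assume y: "L < y"
    have "(\<lambda>n. C / real n) \<longlonglongrightarrow> 0" by (rule lim_const_over_n)
    from order_tendstoD(2)[OF this, of "y - L"] y
    have "\<forall>\<^sub>F N in sequentially. C / real N < y - L" by simp
    then show "\<forall>\<^sub>F N in sequentially. a N < y"
      using eventually_gt_at_top[of 0]
    proof eventually_elim
      case (elim N)
      then have "b (N - 1) \<le> L" unfolding L_def using bdd by (intro cSUP_upper) auto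
      then show ?case using elim by (simp add: b_def)
    qed
  qed
  then show ?thesis by (rule convergentI)
qed

section \<open>Asymptotics of the normalised distance\<close>

lemma choose_two_real: "real (n choose 2) = real n * (real n - 1) / 2"
proof -
  have "even (n * (n - 1))" by (cases n) auto
  then have "real (n choose 2) = real (n * (n - 1)) / 2"
    unfolding choose_two by (simp add: real_of_nat_div)
  then show ?thesis by (cases n) (auto simp: algebra_simps)
qed

lemma choose_two_asymp: "(\<lambda>N. real (N choose 2) / real N ^ 2) \<longlonglongrightarrow> 1 / 2"
proof -
  have "(\<lambda>N. (1 - 1 / real N) / 2) \<longlonglongrightarrow> (1 - 0) / 2"
    by (intro tendsto_intros lim_1_over_n) simp
  moreover have "\<forall>\<^sub>F N in sequentially. (1 - 1 / real N) / 2 = real (N choose 2) / real N ^ 2"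
    using eventually_gt_at_top[of 0]
    by eventually_elim (simp add: choose_two_real power2_eq_square field_simps)
  ultimately show ?thesis using tendsto_cong by fastforce
qed

lemma div_asymp:
  assumes "0 < n"
  shows "(\<lambda>N. real (N div n) / real N) \<longlonglongrightarrow> 1 / real n"
proof (rule tendsto_sandwich)
  show "(\<lambda>N. 1 / real n - 1 / real N) \<longlonglongrightarrow> 1 / real n"
    using tendsto_diff[OF tendsto_const lim_1_over_n, of "1 / real n"] by simp
  show "(\<lambda>_. 1 / real n) \<longlonglongrightarrow> 1 / real n" by simp
  show "\<forall>\<^sub>F N in sequentially. 1 / real n - 1 / real N \<le> real (N div n) / real N"
    using eventually_gt_at_top[of 0]
  proof eventually_elim
    case (elim N)
    have "real N \<le> real n * real (N div n) + real n"
      using div_mult_mod_eq[of N n] mod_less_divisor[OF assms, of N]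
      by (metis add_le_cancel_left less_imp_le mult.commute of_nat_add of_nat_le_iff of_nat_mult)
    then have "real N / (real n * real N) \<le> (real n * real (N div n) + real n) / (real n * real N)"
      by (intro divide_right_mono) auto
    also have "\<dots> = real (N div n) / real N + 1 / real N" using elim assms by (simp add: field_simps)
    finally show ?case using elim by simp
  qed
  show "\<forall>\<^sub>F N in sequentially. real (N div n) / real N \<le> 1 / real n"
    using eventually_gt_at_top[of 0]
  proof eventually_elim
    case (elim N)
    have "real (N div n) * real n \<le> real N"
      by (metis div_times_less_eq_dividend of_nat_le_iff of_nat_mult)
    then show ?case using elim assms by (simp add: field_simps)
  qed
qed

text \<open>A blow-up from \<open>n\<close> to \<open>N\<close> vertices with classes of size
  \<open>N div n\<close> loses asymptotically at most 4/n: 1/n because n choose 2 falls short of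
  n^2/2, at most 2/n by rounding the number of edges, and 1/n because pairs inside classes are
  missing.\<close>

lemma max_dist_convergent:
  assumes "hereditary \<H>" "nontrivial \<H>" "0 \<le> p" "p \<le> 1"
  shows "convergent (\<lambda>n. real (max_dist \<H> p n) / real (n choose 2))"
proof (rule convergent_if_almost_increasing[where C = 4])
  let ?a = "\<lambda>n. real (max_dist \<H> p n) / real (n choose 2)"
  have a_le: "?a n \<le> 1" for n
    using max_dist_le[OF assms, of n] by (cases "n choose 2 = 0") (auto simp: divide_le_eq_1)
  then show "\<bar>?a n\<bar> \<le> 1" for n by simp
  fix n :: nat and e :: real assume n: "0 < n" and e: "0 < e"
  let ?M = "real (max_dist \<H> p n)" and ?C = "\<lambda>N. real (N choose 2)"
  define r where "r N = real (N div n) / real N" for N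
  \<comment> \<open>The bound of \<open>max_dist_blowup\<close>, with numerator and denominator
    divided by \<open>N ^ 2\<close> so that every constituent has a limit. The terms
    \<open>r N ^ 2\<close> and \<open>1 / N ^ 2\<close> pay for the two roundings.\<close>
  define low where "low N = (r N ^ 2 * ?M - (r N ^ 2 + 1 / real N ^ 2 + \<bar>?C N / real N ^ 2 - r N ^ 2 * ?C n\<bar>))
      / (?C N / real N ^ 2)" for N
  have low: "low \<longlonglongrightarrow> ((1 / n) ^ 2 * ?M - ((1 / n) ^ 2 + 0 + \<bar>1 / 2 - (1 / n) ^ 2 * ?C n\<bar>)) / (1 / 2)"
  proof -
    have "(\<lambda>N. 1 / real N ^ 2) \<longlonglongrightarrow> 0"
      using tendsto_power[OF lim_1_over_n, of 2] by (simp add: power_one_over)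
    then show ?thesis
      unfolding low_def r_def
      by (intro tendsto_intros div_asymp[OF n] choose_two_asymp) auto
  qed
  have "?a n - 4 / n - e < ((1 / n) ^ 2 * ?M - ((1 / n) ^ 2 + 0 + \<bar>1 / 2 - (1 / n) ^ 2 * ?C n\<bar>)) / (1 / 2)"
  proof -
    have 1: "1 / 2 - (1 / n) ^ 2 * ?C n = 1 / (2 * n)"
      using n by (simp add: choose_two_real field_simps power2_eq_square)
    have "2 * (1 / n) ^ 2 * ?M \<ge> ?a n - 1 / n"
    proof (cases "n = 1")
      case True
      then show ?thesis using a_le[of 1] by simp
    next
      case False
      then have "2 * (1 / n) ^ 2 * ?M = ?a n * (1 - 1 / n)"
        using n by (simp add: choose_two_real field_simps power2_eq_square)
      also have "\<dots> = ?a n - ?a n * (1 / n)" by (simp only: right_diff_distrib mult_1_right)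
      finally have "2 * (1 / n) ^ 2 * ?M = ?a n - ?a n * (1 / n)" .
      moreover have "?a n * (1 / n) \<le> 1 * (1 / n)" using a_le by (intro mult_right_mono) auto
      ultimately show ?thesis by linarith
    qed
    moreover have "(1 / real n) ^ 2 \<le> 1 / n" using n by (simp add: power2_eq_square field_simps)
    moreover have "\<bar>1 / 2 - (1 / n) ^ 2 * ?C n\<bar> = 1 / n / 2" unfolding 1 by simp
    moreover have arith: "A - 4 / real n - e < (q * M - (q + 0 + u)) / (1 / 2)"
      if "A - 1 / n \<le> 2 * q * M" "q \<le> 1 / n" "u = 1 / n / 2" for A q M u :: real
    proof -
      have "(q * M - (q + 0 + u)) / (1 / 2) = 2 * q * M - 2 * q - 2 * u" by simp
      moreover have "A - 4 * d - e < B - 2 * q - 2 * u"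
        if "A - d \<le> B" "q \<le> d" "u = d / 2" for B d using that e by linarith
      from this[OF that] have "A - 4 * (1 / n) - e < 2 * q * M - 2 * q - 2 * u" .
      ultimately show ?thesis by simp
    qed
    ultimately show ?thesis by blast
  qed
  then have "\<forall>\<^sub>F N in sequentially. ?a n - 4 / n - e < low N"
    using low order_tendstoD(1) by blast
  then show "\<forall>\<^sub>F N in sequentially. ?a n - 4 / real n - e \<le> ?a N"
    using eventually_gt_at_top[of 1]
  proof eventually_elim
    case (elim N)
    let ?t = "N div n"
    have "n * ?t \<le> N" by simp
    note b = max_dist_blowup[OF assms n this]
    have "\<bar>real ?t ^ 2 * edge_target p n - edge_target p N\<bar> \<le> real ?t ^ 2 + 1 + \<bar>?C N - real ?t ^ 2 * ?C n\<bar>"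
    proof -
      have 1: "real ?t ^ 2 * edge_target p n \<le> real ?t ^ 2 * (p * ?C n)"
        using edge_target_bounds(3)[OF assms(3,4)] by (intro mult_left_mono) auto
      have 2: "real ?t ^ 2 * (p * ?C n - 1) \<le> real ?t ^ 2 * edge_target p n"
        using edge_target_bounds(4)[OF assms(3,4)] by (intro mult_left_mono) auto
      have 3: "\<bar>p * (?C N - real ?t ^ 2 * ?C n)\<bar> \<le> 1 * \<bar>?C N - real ?t ^ 2 * ?C n\<bar>"
        unfolding abs_mult using assms(3,4) by (intro mult_right_mono) auto
      have arith: "\<bar>x - f\<bar> \<le> T + 1 + \<bar>d\<bar>"
        if "x \<le> y" "y - T \<le> x" "\<bar>Q - y\<bar> \<le> \<bar>d\<bar>" "f \<le> Q" "Q - 1 \<le> f" "0 \<le> T" for x y T Q f d :: real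
        using that by linarith
      show ?thesis
      proof (rule arith[OF 1 _ _ edge_target_bounds(3,4)[OF assms(3,4), of N] zero_le_power2])
        show "real ?t ^ 2 * (p * ?C n) - real ?t ^ 2 \<le> real ?t ^ 2 * edge_target p n"
          using 2 by (simp only: right_diff_distrib mult_1_right)
        show "\<bar>p * ?C N - real ?t ^ 2 * (p * ?C n)\<bar> \<le> \<bar>?C N - real ?t ^ 2 * ?C n\<bar>"
          using 3 by (simp only: right_diff_distrib mult.left_commute[of p] mult_1)
      qed
    qed
    with b have "real ?t ^ 2 * ?M - (real ?t ^ 2 + 1 + \<bar>?C N - real ?t ^ 2 * ?C n\<bar>) \<le> real (max_dist \<H> p N)"
      by linarith
    then have "(real ?t ^ 2 * ?M - (real ?t ^ 2 + 1 + \<bar>?C N - real ?t ^ 2 * ?C n\<bar>)) / ?C N \<le> ?a N"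
      by (intro divide_right_mono) auto
    moreover have "low N = (real ?t ^ 2 * ?M - (real ?t ^ 2 + 1 + \<bar>?C N - real ?t ^ 2 * ?C n\<bar>)) / ?C N"
    proof -
      have N: "real N ^ 2 > 0" using elim by simp
      have "\<bar>?C N / real N ^ 2 - r N ^ 2 * ?C n\<bar> = \<bar>?C N - real ?t ^ 2 * ?C n\<bar> / real N ^ 2"
        using N by (simp add: r_def power_divide diff_divide_distrib[symmetric] abs_divide)
      then have "low N = ((real ?t ^ 2 * ?M - (real ?t ^ 2 + 1 + \<bar>?C N - real ?t ^ 2 * ?C n\<bar>)) / real N ^ 2)
          / (?C N / real N ^ 2)"
        by (simp add: low_def r_def power_divide add_divide_distrib diff_divide_distrib)
      then show ?thesis using N by simp
    qed
    ultimately show ?case using elim by simp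
  qed
qed

lemma edit_distance_function_tendsto:
  assumes "hereditary \<H>" "nontrivial \<H>" "0 \<le> p" "p \<le> 1"
  shows "(\<lambda>n. real (max_dist \<H> p n) / real (n choose 2)) \<longlonglongrightarrow> edit_distance_function \<H> p"
  using max_dist_convergent[OF assms] unfolding edit_distance_function_def
  by (simp add: convergent_LIMSEQ_iff)

section \<open>Quasirandom graphs\<close>

text \<open>An affine map with invertible slope permutes the residues.\<close>

lemma sum_affine_mod:
  fixes h :: "int \<Rightarrow> real"
  assumes "0 < q" "coprime \<alpha> q"
  shows "(\<Sum>t\<in>{0..<q}. h ((\<alpha> * t + \<beta>) mod q)) = (\<Sum>t\<in>{0..<q}. h t)"
proof -
  let ?f = "\<lambda>t. (\<alpha> * t + \<beta>) mod q"
  have "inj_on ?f {0..<q}"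
  proof (rule inj_onI)
    fix x y assume xy: "x \<in> {0..<q}" "y \<in> {0..<q}" "?f x = ?f y"
    then have "q dvd (\<alpha> * x + \<beta>) - (\<alpha> * y + \<beta>)" by (simp add: mod_eq_dvd_iff)
    then have "q dvd \<alpha> * (x - y)" by (simp add: algebra_simps)
    then have "q dvd x - y" using assms(2) by (simp add: coprime_commute coprime_dvd_mult_right_iff)
    then have "x mod q = y mod q" by (simp add: mod_eq_dvd_iff)
    then show "x = y" using xy by simp
  qed
  moreover have "?f ` {0..<q} \<subseteq> {0..<q}" using assms(1) by auto
  ultimately have "bij_betw ?f {0..<q} {0..<q}"
    by (simp add: bij_betw_def endo_inj_surj)
  then show ?thesis by (rule sum.reindex_bij_betw)
qed

text \<open>Distinct slopes make the two residues uniformly and independently distributed over the plane.\<close>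

lemma affine_pair_orthogonal:
  fixes g :: "int \<Rightarrow> real"
  assumes "prime q" "0 \<le> a" "a < q" "0 \<le> a'" "a' < q" "a \<noteq> a'"
    and "(\<Sum>t\<in>{0..<q}. g t) = 0"
  shows "(\<Sum>c\<in>{0..<q}. \<Sum>d\<in>{0..<q}. g ((a * c + b + d) mod q) * g ((a' * c + b' + d) mod q)) = 0"
proof -
  have q: "0 < q" using assms(1) by (simp add: prime_gt_0_int)
  have cop: "coprime (a' - a) q"
  proof -
    have "\<not> q dvd a' - a"
    proof
      assume "q dvd a' - a"
      then have "a' mod q = a mod q" by (simp add: mod_eq_dvd_iff)
      then show False using assms by simp
    qed
    then show ?thesis using assms(1) by (simp add: coprime_commute prime_imp_coprime)
  qed
  have "(\<Sum>d\<in>{0..<q}. g ((a * c + b + d) mod q) * g ((a' * c + b' + d) mod q))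
      = (\<Sum>t\<in>{0..<q}. g t * g (((a' - a) * c + (b' - b + t)) mod q))" for c
  proof -
    \<comment> \<open>With the first residue as new variable \<open>t\<close>, the second has slope
      \<open>a' - a\<close> in \<open>c\<close>, which is invertible modulo the prime. The sum over
      \<open>c\<close> is then the full sum of \<open>g\<close>, which is 0.\<close>
    let ?h = "\<lambda>t. g t * g (((a' - a) * c + (b' - b + t)) mod q)"
    have "g ((a * c + b + d) mod q) * g ((a' * c + b' + d) mod q) = ?h ((1 * d + (a * c + b)) mod q)" for d
    proof -
      have "((a' - a) * c + (b' - b + (1 * d + (a * c + b)) mod q)) mod q
          = ((a' - a) * c + (b' - b + (1 * d + (a * c + b)))) mod q"
        by (metis (no_types, lifting) mod_add_right_eq)
      also have "(a' - a) * c + (b' - b + (1 * d + (a * c + b))) = a' * c + b' + d"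
        by (simp add: algebra_simps)
      finally show ?thesis by (simp add: algebra_simps)
    qed
    then show ?thesis using sum_affine_mod[OF q, of 1 ?h "a * c + b"] by simp
  qed
  then have "(\<Sum>c\<in>{0..<q}. \<Sum>d\<in>{0..<q}. g ((a * c + b + d) mod q) * g ((a' * c + b' + d) mod q))
      = (\<Sum>c\<in>{0..<q}. \<Sum>t\<in>{0..<q}. g t * g (((a' - a) * c + (b' - b + t)) mod q))" by simp
  also have "\<dots> = (\<Sum>t\<in>{0..<q}. \<Sum>c\<in>{0..<q}. g t * g (((a' - a) * c + (b' - b + t)) mod q))"
    by (rule sum.swap)
  also have "\<dots> = (\<Sum>t\<in>{0..<q}. g t * (\<Sum>c\<in>{0..<q}. g (((a' - a) * c + (b' - b + t)) mod q)))"
    by (simp add: sum_distrib_left)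
  also have "\<dots> = (\<Sum>t\<in>{0..<q}. g t * (\<Sum>t\<in>{0..<q}. g t))"
    by (simp only: sum_affine_mod[OF q cop])
  finally show ?thesis using assms(7) by simp
qed

section \<open>Discrepancy in the plane over a prime field\<close>

lemma sum_squared_le_card_sum_squares:
  fixes f :: "'a \<Rightarrow> real"
  assumes "finite Y"
  shows "(\<Sum>y\<in>Y. f y)\<^sup>2 \<le> card Y * (\<Sum>y\<in>Y. (f y)\<^sup>2)"
proof (cases "Y = {}")
  case False
  define m where "m = (\<Sum>y\<in>Y. f y) / card Y"
  have c: "card Y > 0" using assms False by (simp add: card_gt_0_iff)
  have S: "(\<Sum>y\<in>Y. f y) = m * card Y" using c by (simp add: m_def)
  have "0 \<le> (\<Sum>y\<in>Y. (f y - m)\<^sup>2)" by (simp add: sum_nonneg)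
  also have "\<dots> = (\<Sum>y\<in>Y. (f y)\<^sup>2 - 2 * m * f y + m\<^sup>2)"
    by (intro sum.cong) (auto simp: power2_diff)
  also have "\<dots> = (\<Sum>y\<in>Y. (f y)\<^sup>2) - 2 * m * (\<Sum>y\<in>Y. f y) + card Y * m\<^sup>2"
    by (simp add: sum.distrib sum_subtractf sum_distrib_left)
  also have "\<dots> = (\<Sum>y\<in>Y. (f y)\<^sup>2) - card Y * m\<^sup>2"
    unfolding S by (simp add: power2_eq_square)
  finally have "card Y * m\<^sup>2 \<le> (\<Sum>y\<in>Y. (f y)\<^sup>2)" by simp
  then have "card Y * (card Y * m\<^sup>2) \<le> card Y * (\<Sum>y\<in>Y. (f y)\<^sup>2)" by (intro mult_left_mono) auto
  then show ?thesis unfolding S by (simp add: power2_eq_square mult_ac)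
qed simp

text \<open>
  A number \<open>x < q\<^sup>2\<close> encodes the point \<open>(x div q, x mod q)\<close> of the plane over the prime field.
\<close>

definition plane_form :: "nat \<Rightarrow> nat \<Rightarrow> nat \<Rightarrow> int" where
  "plane_form q x y = (int (x div q) * int (y div q) + int (x mod q) + int (y mod q)) mod int q"

lemma plane_form_commute: "plane_form q x y = plane_form q y x"
  by (simp add: plane_form_def algebra_simps)

lemma sum_plane:
  fixes h :: "int \<Rightarrow> int \<Rightarrow> real"
  assumes "0 < q"
  shows "(\<Sum>y<q * q. h (int (y div q)) (int (y mod q))) = (\<Sum>c\<in>{0..<int q}. \<Sum>d\<in>{0..<int q}. h c d)"
proof -
  have "(\<Sum>y<q * q. h (int (y div q)) (int (y mod q)))
      = (\<Sum>(c, d)\<in>{0..<int q} \<times> {0..<int q}. h c d)"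
  proof (rule sum.reindex_bij_witness[of _ "\<lambda>(c, d). nat c * q + nat d" "\<lambda>y. (int (y div q), int (y mod q))"])
    fix z assume "z \<in> {0..<int q} \<times> {0..<int q}"
    then obtain c d where z: "z = (c, d)" "0 \<le> c" "c < int q" "0 \<le> d" "d < int q" by auto
    then show "(\<lambda>y. (int (y div q), int (y mod q))) ((\<lambda>(c, d). nat c * q + nat d) z) = z"
      using assms by auto
    have "nat c * q + nat d < Suc (nat c) * q" using z by auto
    also have "\<dots> \<le> q * q" using z by (intro mult_le_mono1) auto
    finally show "(\<lambda>(c, d). nat c * q + nat d) z \<in> {..<q * q}" using z by simp
  qed (use assms in \<open>auto simp: less_mult_imp_div_less\<close>)
  then show ?thesis by (simp add: sum.cartesian_product)
qed

text \<open>By Cauchy-Schwarz, taken over all \<open>q^2\<close> points \<open>y\<close>, the square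
  is at most \<open>q^2\<close> times the sum of the correlations \<open>k x x'\<close>. These
  vanish unless \<open>x\<close> and \<open>x'\<close> have the same first coordinate, which leaves
  at most \<open>q\<close> choices of \<open>x'\<close> for each \<open>x\<close>, each contributing
  at most \<open>q^2\<close>. The trivial bound would be \<open>q^8\<close>.\<close>

lemma plane_discrepancy:
  fixes g :: "int \<Rightarrow> real"
  assumes "prime q" "(\<Sum>t\<in>{0..<int q}. g t) = 0" "\<And>t. \<bar>g t\<bar> \<le> 1"
    and "X \<subseteq> {..<q * q}" "Y \<subseteq> {..<q * q}"
  shows "(\<Sum>y\<in>Y. \<Sum>x\<in>X. g (plane_form q x y))\<^sup>2 \<le> real q ^ 7"
proof -
  let ?n = "q * q"
  have q: "0 < q" using assms(1) prime_gt_0_nat by blast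
  have fin: "finite X" "finite Y" using assms(4,5) finite_subset by auto
  have cX: "card X \<le> ?n" and cY: "card Y \<le> ?n"
    using card_mono[OF _ assms(4)] card_mono[OF _ assms(5)] by auto
  define k where "k x x' = (\<Sum>y<?n. g (plane_form q x y) * g (plane_form q x' y))" for x x'
  have k0: "k x x' = 0" if "x < ?n" "x' < ?n" "x div q \<noteq> x' div q" for x x'
  proof -
    have "k x x' = (\<Sum>c\<in>{0..<int q}. \<Sum>d\<in>{0..<int q}. g ((int (x div q) * c + int (x mod q) + d) mod int q)
         * g ((int (x' div q) * c + int (x' mod q) + d) mod int q))"
      unfolding k_def plane_form_def by (rule sum_plane[OF q])
    also have "\<dots> = 0"
      using assms(1,2) that by (intro affine_pair_orthogonal) (auto simp: less_mult_imp_div_less)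
    finally show ?thesis .
  qed
  have k1: "k x x' \<le> ?n" for x x'
  proof -
    have "g s * g t \<le> 1" for s t
    proof -
      have "\<bar>g s * g t\<bar> \<le> 1 * 1" unfolding abs_mult using assms(3) by (intro mult_mono) auto
      then show ?thesis by linarith
    qed
    then have "k x x' \<le> (\<Sum>y<?n. 1)" unfolding k_def by (intro sum_mono) auto
    then show ?thesis by simp
  qed
  have "(\<Sum>x\<in>X. \<Sum>x'\<in>X. k x x') \<le> (\<Sum>x\<in>X. real q * ?n)"
  proof (rule sum_mono)
    fix x assume x: "x \<in> X"
    let ?S = "{x' \<in> X. x' div q = x div q}"
    have "(\<Sum>x'\<in>X. k x x') = (\<Sum>x'\<in>?S. k x x')"
      using x assms(4) by (intro sum.mono_neutral_right fin) (auto intro!: k0)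
    also have "\<dots> \<le> (\<Sum>x'\<in>?S. real ?n)" using k1 by (intro sum_mono)
    also have "\<dots> = real (card ?S) * ?n" by simp
    also have "\<dots> \<le> real q * ?n"
    proof (intro mult_right_mono)
      have "inj_on (\<lambda>x'. x' mod q) ?S"
        by (rule inj_onI) (metis (mono_tags, lifting) div_mult_mod_eq mem_Collect_eq)
      moreover have "(\<lambda>x'. x' mod q) ` ?S \<subseteq> {..<q}" using q by auto
      ultimately have "card ?S \<le> card {..<q}" by (rule card_inj_on_le) simp
      then show "real (card ?S) \<le> real q" by simp
    qed simp
    finally show "(\<Sum>x'\<in>X. k x x') \<le> real q * ?n" .
  qed
  also have "\<dots> \<le> real ?n * (real q * ?n)"
    using cX of_nat_le_iff[of "card X" ?n, where 'a = real]
    by (simp only: sum_constant) (intro mult_right_mono, auto)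
  finally have quad: "(\<Sum>x\<in>X. \<Sum>x'\<in>X. k x x') \<le> real ?n * (real q * ?n)" .
  let ?S = "\<lambda>y. \<Sum>x\<in>X. g (plane_form q x y)"
  have "(\<Sum>y\<in>Y. ?S y)\<^sup>2 \<le> real (card Y) * (\<Sum>y\<in>Y. (?S y)\<^sup>2)"
    by (rule sum_squared_le_card_sum_squares[OF fin(2)])
  also have "\<dots> \<le> real ?n * (\<Sum>y<?n. (?S y)\<^sup>2)"
    using cY assms(5) by (intro mult_mono sum_mono2) (auto simp: sum_nonneg simp del: of_nat_mult)
  also have "(\<Sum>y<?n. (?S y)\<^sup>2) = (\<Sum>x\<in>X. \<Sum>x'\<in>X. k x x')"
  proof -
    have "(\<Sum>y<?n. (?S y)\<^sup>2) = (\<Sum>y<?n. \<Sum>x\<in>X. \<Sum>x'\<in>X. g (plane_form q x y) * g (plane_form q x' y))"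
      by (simp add: power2_eq_square sum_product)
    also have "\<dots> = (\<Sum>x\<in>X. \<Sum>y<?n. \<Sum>x'\<in>X. g (plane_form q x y) * g (plane_form q x' y))"
      by (rule sum.swap)
    also have "\<dots> = (\<Sum>x\<in>X. \<Sum>x'\<in>X. k x x')"
      unfolding k_def by (rule sum.cong[OF refl], rule sum.swap)
    finally show ?thesis .
  qed
  also have "real ?n * \<dots> \<le> real ?n * (real ?n * (real q * ?n))"
    using quad by (intro mult_left_mono) auto
  also have "\<dots> = real q ^ 7" by (simp add: eval_nat_numeral)
  finally show ?thesis by simp
qed

text \<open>Points are joined when \<open>plane_form\<close> is among the first \<open>k\<close>
  residues, where \<open>k / q\<close> is near \<open>p\<close>. Only squares of primes occur as
  \<open>n\<close>; the lower bound can work with them because the limit is known to exist. A point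
  may be joined to itself, and \<open>far_graph\<close> drops these loops.\<close>

lemma exists_quasirandom:
  fixes p \<epsilon> :: real
  assumes "0 \<le> p" "p \<le> 1" "0 < \<epsilon>"
  shows "\<exists>n\<ge>n0. \<exists>adj :: nat \<Rightarrow> nat \<Rightarrow> bool. (\<forall>x y. adj x y = adj y x) \<and>
    (\<forall>X\<subseteq>{..<n}. \<forall>Y\<subseteq>{..<n}.
       \<bar>(\<Sum>x\<in>X. \<Sum>y\<in>Y. of_bool (adj x y)) - p * real (card X) * real (card Y)\<bar> \<le> \<epsilon> * real n ^ 2)"
proof -
  \<comment> \<open>\<open>q \<ge> 4 / \<epsilon>^2\<close> makes \<open>q^7\<close> at most the
    square of \<open>\<epsilon> / 2 * q^4\<close>, and \<open>q \<ge> 2 / \<epsilon>\<close> keeps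
    the rounding of \<open>p\<close> to \<open>k / q\<close> within the other half of the
    error.\<close>
  obtain q where q: "prime q" "n0 + nat \<lceil>4 / \<epsilon>\<^sup>2\<rceil> + nat \<lceil>2 / \<epsilon>\<rceil> < q"
    using bigger_prime by blast
  then have q0: "0 < q" and qn: "n0 \<le> q" by auto
  have qe: "4 / \<epsilon>\<^sup>2 \<le> q" "2 / \<epsilon> \<le> q" using q(2) by linarith+
  define k where "k = \<lfloor>p * real q\<rfloor>"
  have k: "0 \<le> k" "k \<le> int q"
  proof -
    show "0 \<le> k" unfolding k_def using assms by simp
    have "p * real q \<le> real q" using assms by (simp add: mult_left_le_one_le)
    then show "k \<le> int q" unfolding k_def by linarith
  qed
  define g where "g t = of_bool (t < k) - real_of_int k / real q" for t :: int
  have kq: "0 \<le> real_of_int k / real q" "real_of_int k / real q \<le> 1"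
    using k q0 by (auto simp: divide_le_eq_1)
  have "(\<Sum>t\<in>{0..<int q}. of_bool (t < k)) = real_of_int k"
  proof -
    have "(\<Sum>t\<in>{0..<int q}. of_bool (t < k)) = (\<Sum>t\<in>{0..<k}. (1::real))"
      using k by (intro sum.mono_neutral_cong_right) auto
    then show ?thesis using k by simp
  qed
  then have g0: "(\<Sum>t\<in>{0..<int q}. g t) = 0"
    unfolding g_def using q0 by (simp add: sum_subtractf del: sum_of_bool_eq)
  have g1: "\<bar>g t\<bar> \<le> 1" for t unfolding g_def using kq by auto
  define adj where "adj x y \<longleftrightarrow> plane_form q x y < k" for x y
  show ?thesis
  proof (intro exI[of _ "q * q"] exI[of _ adj] conjI allI impI)
    have "q * 1 \<le> q * q" using q0 by (intro mult_le_mono2) simp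
    then show "n0 \<le> q * q" using qn by linarith
    show "adj x y = adj y x" for x y by (simp add: adj_def plane_form_commute)
    fix X Y assume XY: "X \<subseteq> {..<q * q}" "Y \<subseteq> {..<q * q}"
    let ?c = "real (card X) * real (card Y)"
    have c: "?c \<le> real q ^ 4"
    proof -
      have "real (card X) \<le> real (q * q)" "real (card Y) \<le> real (q * q)"
        using card_mono[OF _ XY(1)] card_mono[OF _ XY(2)] by (auto simp del: of_nat_mult)
      then have "?c \<le> real (q * q) * real (q * q)" by (intro mult_mono) auto
      then show ?thesis by (simp add: eval_nat_numeral)
    qed
    have "(\<Sum>y\<in>Y. \<Sum>x\<in>X. g (plane_form q x y)) = (\<Sum>x\<in>X. \<Sum>y\<in>Y. g (plane_form q x y))"
      by (rule sum.swap)
    also have "\<dots> = (\<Sum>x\<in>X. \<Sum>y\<in>Y. of_bool (adj x y)) - real_of_int k / real q * ?c"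
      unfolding g_def adj_def by (simp add: sum_subtractf del: sum_of_bool_eq)
    finally have eq: "(\<Sum>y\<in>Y. \<Sum>x\<in>X. g (plane_form q x y)) = \<dots>" .
    have "\<bar>\<Sum>y\<in>Y. \<Sum>x\<in>X. g (plane_form q x y)\<bar> \<le> \<epsilon> / 2 * real q ^ 4"
    proof -
      have "(\<Sum>y\<in>Y. \<Sum>x\<in>X. g (plane_form q x y))\<^sup>2 \<le> (\<epsilon> / 2 * real q ^ 4)\<^sup>2"
      proof -
        have "4 \<le> real q * \<epsilon>\<^sup>2" using qe(1) assms(3) by (simp add: field_simps)
        then have "real q ^ 7 * 4 \<le> real q ^ 7 * (real q * \<epsilon>\<^sup>2)" by (intro mult_left_mono) auto
        then have "real q ^ 7 \<le> (\<epsilon> / 2 * real q ^ 4)\<^sup>2"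
          by (simp add: power_mult_distrib power_divide eval_nat_numeral algebra_simps)
        with plane_discrepancy[OF q(1) g0 g1 XY] show ?thesis by linarith
      qed
      then have "\<bar>\<Sum>y\<in>Y. \<Sum>x\<in>X. g (plane_form q x y)\<bar> \<le> \<bar>\<epsilon> / 2 * real q ^ 4\<bar>"
        by (simp only: abs_le_square_iff)
      then show ?thesis using assms(3) by simp
    qed
    moreover have "\<bar>real_of_int k / real q * ?c - p * ?c\<bar> \<le> \<epsilon> / 2 * real q ^ 4"
    proof -
      have "\<bar>real_of_int k / real q - p\<bar> \<le> 1 / real q"
      proof -
        have "\<bar>real_of_int k - p * real q\<bar> \<le> 1" unfolding k_def by linarith
        then have "\<bar>real_of_int k - p * real q\<bar> / real q \<le> 1 / real q" by (intro divide_right_mono) auto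
        moreover have "real_of_int k / real q - p = (real_of_int k - p * real q) / real q"
          using q0 by (simp add: field_simps)
        ultimately show ?thesis by (simp add: abs_divide)
      qed
      also have "1 / real q \<le> \<epsilon> / 2" using qe(2) assms(3) q0 by (simp add: field_simps)
      finally have "\<bar>real_of_int k / real q - p\<bar> * ?c \<le> \<epsilon> / 2 * real q ^ 4"
        using c assms(3) by (intro mult_mono) auto
      moreover have "real_of_int k / real q * ?c - p * ?c = (real_of_int k / real q - p) * ?c"
        by (simp add: left_diff_distrib)
      ultimately show ?thesis by (simp add: abs_mult)
    qed
    moreover have "\<epsilon> * real (q * q) ^ 2 = \<epsilon> / 2 * real q ^ 4 + \<epsilon> / 2 * real q ^ 4"
      by (simp add: eval_nat_numeral)
    ultimately show "\<bar>(\<Sum>x\<in>X. \<Sum>y\<in>Y. of_bool (adj x y)) - p * real (card X) * real (card Y)\<bar> \<le> \<epsilon> * real (q * q) ^ 2"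
      unfolding eq mult.assoc by linarith
  qed
qed

section \<open>Regular tuples of clusters\<close>

text \<open>Division by zero gives an empty set density 0, so \<open>dens_nonneg\<close> and
  \<open>dens_le_1\<close> cover empty sets too.\<close>

definition dens :: "('a \<Rightarrow> 'a \<Rightarrow> real) \<Rightarrow> 'a set \<Rightarrow> 'a set \<Rightarrow> real" where
  "dens w X Y = (\<Sum>x\<in>X. \<Sum>y\<in>Y. w x y) / (real (card X) * real (card Y))"

lemma dens_commute:
  assumes "\<And>x y. w x y = w y x"
  shows "dens w X Y = dens w Y X"
proof -
  have "(\<Sum>x\<in>X. \<Sum>y\<in>Y. w x y) = (\<Sum>y\<in>Y. \<Sum>x\<in>X. w x y)" by (rule sum.swap)
  also have "\<dots> = (\<Sum>y\<in>Y. \<Sum>x\<in>X. w y x)" using assms by (intro sum.cong) auto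
  finally show ?thesis by (simp add: dens_def mult.commute)
qed

lemma dens_nonneg: "(\<And>x y. 0 \<le> w x y) \<Longrightarrow> 0 \<le> dens w X Y"
  by (simp add: dens_def sum_nonneg)

lemma dens_le_1:
  assumes "\<And>x y. w x y \<le> 1"
  shows "dens w X Y \<le> 1"
proof -
  have "(\<Sum>x\<in>X. \<Sum>y\<in>Y. w x y) \<le> (\<Sum>x\<in>X. \<Sum>y\<in>Y. 1)" using assms by (intro sum_mono)
  then have "(\<Sum>x\<in>X. \<Sum>y\<in>Y. w x y) \<le> real (card X) * real (card Y)" by simp
  then show ?thesis
    unfolding dens_def by (cases "real (card X) * real (card Y) = 0") (auto simp: divide_le_eq_1)
qed

lemma dens_split:
  assumes "finite X" "B \<subseteq> X" "B \<noteq> {}" "X - B \<noteq> {}"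
  shows "dens w X Y = card B / card X * dens w B Y + (1 - card B / card X) * dens w (X - B) Y"
proof -
  have fB: "finite B" using assms finite_subset by blast
  have c: "card B > 0" "card (X - B) > 0" using assms fB by (auto simp: card_gt_0_iff)
  have cX: "card X = card B + card (X - B)"
    using assms fB by (simp add: card_Diff_subset card_mono)
  have "(\<Sum>x\<in>X. \<Sum>y\<in>Y. w x y) = (\<Sum>x\<in>X - B. \<Sum>y\<in>Y. w x y) + (\<Sum>x\<in>B. \<Sum>y\<in>Y. w x y)"
    using assms by (intro sum.subset_diff)
  moreover have "1 - card B / card X = card (X - B) / card X"
    unfolding cX using c by (simp add: field_simps)
  ultimately show ?thesis
    using c by (simp add: dens_def cX add_divide_distrib)
qed

text \<open>The gain from convexity is b(1 - b)(x - y)^2. Of this, the deviation of the first part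
  from the mean is kept, which is b(1 - b)^2(x - y)^2; the rest is nonnegative.\<close>

lemma weighted_variance:
  fixes x y b :: real
  assumes "0 \<le> b" "b \<le> 1" "d = b * x + (1 - b) * y"
  shows "d\<^sup>2 + b * (x - d)\<^sup>2 \<le> b * x\<^sup>2 + (1 - b) * y\<^sup>2"
proof -
  have "b * x\<^sup>2 + (1 - b) * y\<^sup>2 - (d\<^sup>2 + b * (x - d)\<^sup>2) = b\<^sup>2 * (1 - b) * (x - y)\<^sup>2"
    unfolding assms(3) by (simp add: power2_eq_square algebra_simps)
  moreover have "0 \<le> b\<^sup>2 * (1 - b) * (x - y)\<^sup>2" using assms by simp
  ultimately show ?thesis by linarith
qed

text \<open>Applied to \<open>b\<close> and to \<open>1 - b\<close>, this bounds the entropy of a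
  splitting into two pieces by \<open>(1 - b) + b\<close>, so that a splitting loses at most
  \<open>\<theta>\<close>.\<close>

lemma ln_inverse_bound:
  assumes "0 < x"
  shows "x * ln (1 / x) \<le> 1 - (x::real)"
proof -
  have "ln (1 / x) \<le> 1 / x - 1" using assms by (intro ln_le_minus_one) auto
  then have "x * ln (1 / x) \<le> x * (1 / x - 1)" using assms by (intro mult_left_mono) auto
  then show ?thesis using assms by (simp add: algebra_simps)
qed

text \<open>
  Regularity for a single tuple of clusters, without partitions: minimise the edit density minus
  \<open>\<eta>\<close> times the squared densities, with an entropy penalty \<open>\<theta>\<close> for small clusters. Splitting a cluster
  preserves the edit density on average and loses at most \<open>\<theta>\<close> in entropy, so the variance of the
  densities over the two pieces is small.
\<close>

locale potential =
  fixes I :: "'i set" and w g :: "'a \<Rightarrow> 'a \<Rightarrow> real" and \<eta> \<theta> :: real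
  assumes fin_I: "finite I"
    and w_commute: "\<And>x y. w x y = w y x" and w_ge: "\<And>x y. 0 \<le> w x y" and w_le: "\<And>x y. w x y \<le> 1"
    and g_commute: "\<And>x y. g x y = g y x" and g_ge: "\<And>x y. 0 \<le> g x y" and g_le: "\<And>x y. g x y \<le> 1"
    and eta: "0 < \<eta>" "\<eta> \<le> 1" and theta: "0 < \<theta>"
begin

text \<open>Subtracting the convex square makes the score fall on average under a splitting, in
  proportion to the variance of the densities.\<close>

definition score :: "'a set \<Rightarrow> 'a set \<Rightarrow> real" where
  "score X Y = dens w X Y - \<eta> * (dens g X Y)\<^sup>2"

definition energy :: "('i \<Rightarrow> 'a set) \<Rightarrow> real" where
  "energy A = (\<Sum>i\<in>I. \<Sum>j\<in>I - {i}. score (A i) (A j))"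

text \<open>The logarithm makes the loss additive along successive shrinkings.\<close>

definition entropy_loss :: "('i \<Rightarrow> 'a set) \<Rightarrow> ('i \<Rightarrow> 'a set) \<Rightarrow> real" where
  "entropy_loss A C = (\<Sum>i\<in>I. ln (card (A i) / card (C i)))"

text \<open>
  Minimality of the potential up to the slack \<open>T - \<theta>\<close>. With this normalisation, passing to a part of
  relative size \<open>b\<close> in one cluster multiplies \<open>T\<close> by \<open>2 / b\<close>.
\<close>

definition near :: "real \<Rightarrow> real \<Rightarrow> ('i \<Rightarrow> 'a set) \<Rightarrow> bool" where
  "near T e A \<longleftrightarrow> \<theta> \<le> T \<and> (\<forall>i\<in>I. finite (A i) \<and> A i \<noteq> {}) \<and> energy A \<le> e + T \<and>
     (\<forall>C. (\<forall>i\<in>I. C i \<noteq> {} \<and> C i \<subseteq> A i) \<longrightarrow>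
        energy A - (T - \<theta>) - \<theta> * entropy_loss A C \<le> energy C)"

lemma score_commute: "score X Y = score Y X"
  unfolding score_def using dens_commute[of w] dens_commute[of g] w_commute g_commute by metis

lemma score_bounds: "- \<eta> \<le> score X Y" "score X Y \<le> 1"
proof -
  have "0 \<le> dens w X Y" "0 \<le> dens g X Y" using w_ge g_ge by (auto intro: dens_nonneg)
  moreover have "dens w X Y \<le> 1" "dens g X Y \<le> 1" using w_le g_le by (auto intro: dens_le_1)
  ultimately have "0 \<le> (dens g X Y)\<^sup>2" "(dens g X Y)\<^sup>2 \<le> 1" "0 \<le> dens w X Y" "dens w X Y \<le> 1"
    by (auto simp: power_le_one)
  moreover have "0 \<le> \<eta> * (dens g X Y)\<^sup>2" "\<eta> * (dens g X Y)\<^sup>2 \<le> \<eta> * 1"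
    using eta calculation by (auto intro: mult_left_mono)
  ultimately show "- \<eta> \<le> score X Y" "score X Y \<le> 1" unfolding score_def by linarith+
qed

lemma energy_cong: "(\<And>i. i \<in> I \<Longrightarrow> A i = C i) \<Longrightarrow> energy A = energy C"
  unfolding energy_def by (auto intro!: sum.cong)

lemma score_split:
  assumes "finite X" "B \<subseteq> X" "B \<noteq> {}" "X - B \<noteq> {}" "b = card B / card X"
  shows "b * score B Y + (1 - b) * score (X - B) Y \<le> score X Y - \<eta> * b * (dens g B Y - dens g X Y)\<^sup>2"
proof -
  have b: "0 \<le> b" "b \<le> 1"
    using assms card_mono[of X B] by (auto simp: divide_le_eq_1)
  let ?x = "dens g B Y" and ?y = "dens g (X - B) Y" and ?d = "dens g X Y"
  have "?d = b * ?x + (1 - b) * ?y" and w: "dens w X Y = b * dens w B Y + (1 - b) * dens w (X - B) Y"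
    using dens_split[OF assms(1-4)] assms(5) by auto
  from weighted_variance[OF b this(1)]
  have "\<eta> * (?d\<^sup>2 + b * (?x - ?d)\<^sup>2) \<le> \<eta> * (b * ?x\<^sup>2 + (1 - b) * ?y\<^sup>2)"
    using eta by (intro mult_left_mono) auto
  then show ?thesis unfolding score_def w by (simp add: algebra_simps)
qed

text \<open>Every pair involving cluster \<open>i\<close> is convex under the splitting; the
  variance is kept only for the ordered pair of \<open>i\<close> and \<open>j\<close>. The choice
  \<open>j = i\<close> yields the inequality with no variance term.\<close>

lemma energy_split:
  assumes "i \<in> I" "finite (A i)" "B \<subseteq> A i" "B \<noteq> {}" "A i - B \<noteq> {}" "b = card B / card (A i)"
  shows "b * energy (A(i := B)) + (1 - b) * energy (A(i := A i - B))
     \<le> energy A - (if j \<in> I - {i} then \<eta> * b * (dens g B (A j) - dens g (A i) (A j))\<^sup>2 else 0)"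
proof -
  let ?D = "\<eta> * b * (dens g B (A j) - dens g (A i) (A j))\<^sup>2"
  have b: "0 \<le> b" using assms(6) by simp
  have split: "b * score B Y + (1 - b) * score (A i - B) Y \<le> score (A i) Y - \<eta> * b * (dens g B Y - dens g (A i) Y)\<^sup>2" for Y
    by (rule score_split[OF assms(2-6)])
  have nn: "0 \<le> \<eta> * b * z\<^sup>2" for z using eta b by simp
  have split0: "b * score B Y + (1 - b) * score (A i - B) Y \<le> score (A i) Y" for Y
    using split[of Y] nn[of "dens g B Y - dens g (A i) Y"] by linarith
  have "b * energy (A(i := B)) + (1 - b) * energy (A(i := A i - B))
      = (\<Sum>k\<in>I. \<Sum>l\<in>I - {k}. b * score ((A(i := B)) k) ((A(i := B)) l)
          + (1 - b) * score ((A(i := A i - B)) k) ((A(i := A i - B)) l))"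
    by (simp only: energy_def sum_distrib_left sum.distrib)
  also have "\<dots> \<le> (\<Sum>k\<in>I. \<Sum>l\<in>I - {k}. score (A k) (A l) - (if k = i then if l = j then ?D else 0 else 0))"
  proof (intro sum_mono)
    fix k l assume kl: "k \<in> I" "l \<in> I - {k}"
    show "b * score ((A(i := B)) k) ((A(i := B)) l) + (1 - b) * score ((A(i := A i - B)) k) ((A(i := A i - B)) l)
        \<le> score (A k) (A l) - (if k = i then if l = j then ?D else 0 else 0)"
    proof (cases "k = i")
      case True
      then show ?thesis using split[of "A l"] split0[of "A l"] kl by auto
    next
      case False
      then show ?thesis
      proof (cases "l = i")
        case True
        then show ?thesis using split0[of "A k"] \<open>k \<noteq> i\<close> by (simp add: score_commute[of "A k"])
      qed (simp add: algebra_simps)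
    qed
  qed
  also have "\<dots> = energy A - (\<Sum>k\<in>I. \<Sum>l\<in>I - {k}. if k = i then if l = j then ?D else 0 else 0)"
    by (simp only: energy_def sum_subtractf)
  also have "(\<Sum>k\<in>I. \<Sum>l\<in>I - {k}. if k = i then if l = j then ?D else 0 else 0)
      = (\<Sum>k\<in>I. if k = i then if j \<in> I - {i} then ?D else 0 else 0)"
    using fin_I by (intro sum.cong) auto
  also have "\<dots> = (if j \<in> I - {i} then ?D else 0)"
    using fin_I assms(1) by simp
  finally show ?thesis .
qed

lemma entropy_loss_update:
  assumes "i \<in> I" "\<And>k. k \<in> I \<Longrightarrow> finite (A k) \<and> A k \<noteq> {}"
  shows "entropy_loss A (A(i := B)) = ln (card (A i) / card B)"
proof -
  have "entropy_loss A (A(i := B)) = (\<Sum>k\<in>I. if k = i then ln (card (A i) / card B) else 0)"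
    unfolding entropy_loss_def using assms(2) by (intro sum.cong) auto
  then show ?thesis using assms(1) fin_I by simp
qed

lemma entropy_loss_trans:
  assumes "\<And>k. k \<in> I \<Longrightarrow> card (A k) > 0 \<and> card (B k) > 0 \<and> card (C k) > 0"
  shows "entropy_loss A C = entropy_loss A B + entropy_loss B C"
  unfolding entropy_loss_def sum.distrib[symmetric]
  using assms by (intro sum.cong) (auto simp: ln_div)

lemma near_mono:
  assumes "near T e A" "T \<le> T'"
  shows "near T' e A"
  unfolding near_def
proof (intro conjI allI impI)
  fix C assume "\<forall>i\<in>I. C i \<noteq> {} \<and> C i \<subseteq> A i"
  then have "energy A - (T - \<theta>) - \<theta> * entropy_loss A C \<le> energy C"
    using assms(1) unfolding near_def by blast
  then show "energy A - (T' - \<theta>) - \<theta> * entropy_loss A C \<le> energy C" using assms(2) by linarith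
qed (use assms in \<open>auto simp: near_def\<close>)

text \<open>Both \<open>B\<close> and its complement in \<open>A i\<close> are competitors, so their
  energies are bounded below, while their weighted mean lies below the energy of \<open>A\<close> by
  the variance term. This leaves at most \<open>T\<close> for the variance. Since the complement
  cannot have too small an energy, \<open>B\<close> cannot have too large a one, and so it inherits
  near-minimality.\<close>

lemma near_shrink:
  assumes near: "near T e A" and i: "i \<in> I" and B: "B \<subseteq> A i" "B \<noteq> {}" and b: "b = card B / card (A i)"
  shows "near (2 * T / b) e (A(i := B))"
    and "\<And>j. j \<in> I - {i} \<Longrightarrow> \<eta> * b * (dens g B (A j) - dens g (A i) (A j))\<^sup>2 \<le> T"
proof -
  have T: "\<theta> \<le> T" and A: "\<And>k. k \<in> I \<Longrightarrow> finite (A k) \<and> A k \<noteq> {}" and eA: "energy A \<le> e + T"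
    and sub: "\<And>C. (\<forall>k\<in>I. C k \<noteq> {} \<and> C k \<subseteq> A k) \<Longrightarrow>
        energy A - (T - \<theta>) - \<theta> * entropy_loss A C \<le> energy C"
    using near unfolding near_def by auto
  have fB: "finite B" using A[OF i] B finite_subset by blast
  have cB: "card B > 0" "card B \<le> card (A i)" using fB B A[OF i] by (auto simp: card_gt_0_iff card_mono)
  have b01: "0 < b" "b \<le> 1" unfolding b using cB by (auto simp: divide_le_eq_1)
  have both: "near (2 * T / b) e (A(i := B)) \<and>
    (\<forall>j\<in>I - {i}. \<eta> * b * (dens g B (A j) - dens g (A i) (A j))\<^sup>2 \<le> T)"
  \<comment> \<open>The complement is a competitor only when it is nonempty.\<close>
  proof (cases "B = A i")
    case True
    then have "b = 1" using b cB by simp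
    moreover have "0 \<le> T" using T theta by simp
    ultimately show ?thesis using True near near_mono[OF near, of "2 * T"] by simp
  next
    case False
    define B' where "B' = A i - B"
    have B': "B' \<noteq> {}" "B' \<subseteq> A i" using B False unfolding B'_def by auto
    have cB': "card B' = card (A i) - card B" using B fB by (simp add: B'_def card_Diff_subset)
    have "card B < card (A i)" using B False A[OF i] by (meson psubset_card_mono psubsetI)
    then have b1: "b < 1" and b': "1 - b = card B' / card (A i)"
      unfolding b cB' using cB by (auto simp: field_simps)
    define e1 where "e1 = energy (A(i := B))"
    define e2 where "e2 = energy (A(i := B'))"
    have "energy A - (T - \<theta>) - \<theta> * ln (1 / b) \<le> e1"
      using sub[of "A(i := B)"] A B entropy_loss_update[OF i A] unfolding b e1_def by auto
    then have 1: "b * (energy A - (T - \<theta>)) - \<theta> * (b * ln (1 / b)) \<le> b * e1"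
      using mult_left_mono[of "energy A - (T - \<theta>) - \<theta> * ln (1 / b)" e1 b] b01 by (simp add: algebra_simps)
    have "energy A - (T - \<theta>) - \<theta> * ln (1 / (1 - b)) \<le> e2"
      using sub[of "A(i := B')"] A B' entropy_loss_update[OF i A] unfolding b' e2_def by auto
    then have 2: "(1 - b) * (energy A - (T - \<theta>)) - \<theta> * ((1 - b) * ln (1 / (1 - b))) \<le> (1 - b) * e2"
      using mult_left_mono[of "energy A - (T - \<theta>) - \<theta> * ln (1 / (1 - b))" e2 "1 - b"] b1
      by (simp add: algebra_simps)
    have l1: "\<theta> * (b * ln (1 / b)) \<le> \<theta> * (1 - b)" and l2: "\<theta> * ((1 - b) * ln (1 / (1 - b))) \<le> \<theta> * b"
      using ln_inverse_bound[of b] ln_inverse_bound[of "1 - b"] b01 b1 theta by (auto intro: mult_left_mono)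
    have split: "b * e1 + (1 - b) * e2
       \<le> energy A - (if j \<in> I - {i} then \<eta> * b * (dens g B (A j) - dens g (A i) (A j))\<^sup>2 else 0)" for j
      unfolding e1_def e2_def B'_def
      using A[OF i] B' B'_def by (intro energy_split[where A = A, OF i _ B(1,2) _ b]) auto
    have var: "\<eta> * b * (dens g B (A j) - dens g (A i) (A j))\<^sup>2 \<le> T" if "j \<in> I - {i}" for j
    proof -
      have "\<eta> * b * (dens g B (A j) - dens g (A i) (A j))\<^sup>2 \<le> energy A - b * e1 - (1 - b) * e2"
        using split[of j] that by simp
      also have "\<dots> \<le> energy A - b * (energy A - (T - \<theta>)) - (1 - b) * (energy A - (T - \<theta>)) + \<theta> * (1 - b) + \<theta> * b"
        using 1 2 l1 l2 by linarith
      also have "\<dots> = T" by (simp add: algebra_simps)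
      finally show ?thesis .
    qed
    have e1_le: "e1 \<le> energy A + (T - \<theta>) / b + \<theta>"
    proof -
      have "b * e1 \<le> energy A - (1 - b) * e2" using split[of i] by simp
      also have "\<dots> \<le> energy A - (1 - b) * (energy A - (T - \<theta>)) + \<theta> * b"
        using 2 l2 by linarith
      also have "\<dots> = b * (energy A + \<theta>) + (1 - b) * (T - \<theta>)" by (simp add: algebra_simps)
      also have "\<dots> \<le> b * (energy A + \<theta>) + (T - \<theta>)"
        using b01 T by (simp add: mult_left_le_one_le)
      also have "\<dots> = b * (energy A + (T - \<theta>) / b + \<theta>)" using b01 by (simp add: field_simps)
      finally show ?thesis using b01 by simp
    qed
    have inv: "1 \<le> 1 / b" using b01 by simp
    have T0: "0 < T" using T theta by linarith
    have th: "\<theta> \<le> \<theta> / b" using inv theta b01 by (simp add: field_simps)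
    have Tb: "T \<le> T / b" using inv T0 b01 by (simp add: field_simps)
    have near': "near (2 * T / b) e (A(i := B))"
      unfolding near_def
    proof (intro conjI allI impI ballI)
      show "\<theta> \<le> 2 * T / b" using T Tb T0 by simp
      show "energy (A(i := B)) \<le> e + 2 * T / b"
      proof -
        have "(T - \<theta>) / b + \<theta> \<le> T / b" using th by (simp add: diff_divide_distrib)
        then show ?thesis using e1_le eA Tb unfolding e1_def by simp
      qed
      fix C assume C: "\<forall>k\<in>I. C k \<noteq> {} \<and> C k \<subseteq> (A(i := B)) k"
      then have CA: "\<forall>k\<in>I. C k \<noteq> {} \<and> C k \<subseteq> A k" using B by (metis fun_upd_apply order_trans)
      have "entropy_loss A C = entropy_loss A (A(i := B)) + entropy_loss (A(i := B)) C"
        using A CA fB B by (intro entropy_loss_trans) (auto simp: card_gt_0_iff dest: finite_subset)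
      then have loss: "entropy_loss A C = ln (1 / b) + entropy_loss (A(i := B)) C"
        using entropy_loss_update[OF i A] b by simp
      have ln: "\<theta> * ln (1 / b) \<le> \<theta> * (1 / b - 1)"
        using theta b01 by (intro mult_left_mono ln_le_minus_one) auto
      have "energy A - (T - \<theta>) - \<theta> * ln (1 / b) - \<theta> * entropy_loss (A(i := B)) C \<le> energy C"
        using sub[OF CA] unfolding loss by (simp add: algebra_simps)
      \<comment> \<open>One \<open>T / b\<close> pays for the rise from the energy of
        \<open>A\<close> to \<open>e1\<close>, the other for the old slack together with the entropy
        of the passage to \<open>B\<close>.\<close>
      moreover have "(T - \<theta>) + \<theta> * ln (1 / b) + (T - \<theta>) / b + \<theta> \<le> 2 * T / b - \<theta>"
      proof -
        have "(T - \<theta>) * b \<le> T - \<theta>" using T b01 by (intro mult_left_le) auto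
        then have "T - \<theta> \<le> (T - \<theta>) / b" using b01 by (simp add: pos_le_divide_eq)
        moreover have "\<theta> * (1 / b - 1) = \<theta> / b - \<theta>" by (simp add: algebra_simps)
        moreover have "(T - \<theta>) / b = T / b - \<theta> / b" by (simp add: diff_divide_distrib)
        moreover have "2 * T / b = T / b + T / b" by simp
        moreover have "u + l + x + t \<le> y2 - t"
          if "u \<le> x" "l \<le> m" "m = z - t" "x = y - z" "y2 = y + y" "t \<le> z" for u l x t y2 m z y :: real
          using that by linarith
        ultimately show ?thesis using ln th by blast
      qed
      ultimately show "energy (A(i := B)) - (2 * T / b - \<theta>) - \<theta> * entropy_loss (A(i := B)) C \<le> energy C"
        using e1_le unfolding e1_def by linarith
    qed (use A fB B in \<open>auto\<close>)
    then show ?thesis using var by blast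
  qed
  then show "near (2 * T / b) e (A(i := B))" by blast
  fix j assume "j \<in> I - {i}"
  then show "\<eta> * b * (dens g B (A j) - dens g (A i) (A j))\<^sup>2 \<le> T" using both by blast
qed

text \<open>Minimise energy plus penalty over the finitely many tuples of nonempty subclusters. The
  energy is at most \<open>card I ^ 2\<close> in absolute value and \<open>A0\<close> itself has no
  penalty, which bounds the penalty of the minimiser and hence the shrinkage of each
  cluster.\<close>

lemma near_exists:
  assumes "\<And>i. i \<in> I \<Longrightarrow> finite (A0 i) \<and> A0 i \<noteq> {}"
  obtains A where "near \<theta> (energy A0) A" "\<And>i. i \<in> I \<Longrightarrow> A i \<subseteq> A0 i"
    "\<And>i. i \<in> I \<Longrightarrow> exp (- (2 * real (card I) ^ 2 / \<theta>)) * card (A0 i) \<le> card (A i)"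
proof -
  let ?S = "PiE I (\<lambda>i. Pow (A0 i) - {{}})"
  have "finite ?S" using fin_I assms by (intro finite_PiE) auto
  moreover have "restrict A0 I \<in> ?S" using assms by auto
  ultimately obtain A where "is_arg_min (\<lambda>C. energy C + \<theta> * entropy_loss A0 C) (\<lambda>C. C \<in> ?S) A"
    using ex_is_arg_min_if_finite[of ?S] by blast
  then have A: "A \<in> ?S"
    and min: "\<And>C. C \<in> ?S \<Longrightarrow> energy A + \<theta> * entropy_loss A0 A \<le> energy C + \<theta> * entropy_loss A0 C"
    unfolding is_arg_min_def by (auto simp: not_less)
  have sub: "A i \<subseteq> A0 i" "A i \<noteq> {}" "finite (A i)" if "i \<in> I" for i
    using A that assms finite_subset by (auto simp: PiE_iff)
  have min': "energy A + \<theta> * entropy_loss A0 A \<le> energy C + \<theta> * entropy_loss A0 C"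
    if "\<And>i. i \<in> I \<Longrightarrow> C i \<subseteq> A0 i \<and> C i \<noteq> {}" for C
  proof -
    have "energy (restrict C I) = energy C" by (rule energy_cong) simp
    moreover have "entropy_loss A0 (restrict C I) = entropy_loss A0 C"
      unfolding entropy_loss_def by (intro sum.cong) auto
    ultimately show ?thesis using min[of "restrict C I"] that by auto
  qed
  have c0: "card (A0 i) > 0" and cA: "card (A i) > 0" if "i \<in> I" for i
    using assms[OF that] sub[OF that] by (auto simp: card_gt_0_iff)
  have loss0: "entropy_loss A0 A0 = 0"
    unfolding entropy_loss_def using c0 by (intro sum.neutral) auto
  have lnn: "0 \<le> ln (card (A0 i) / card (A i))" if "i \<in> I" for i
    using card_mono[of "A0 i" "A i"] sub[OF that] assms[OF that] cA[OF that] by simp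
  have loss_nn: "0 \<le> entropy_loss A0 A"
    unfolding entropy_loss_def by (intro sum_nonneg lnn)
  have eA: "energy A + \<theta> * entropy_loss A0 A \<le> energy A0"
    using min'[of A0] assms loss0 by simp
  have "near \<theta> (energy A0) A"
    unfolding near_def
  proof (intro conjI allI impI ballI)
    show "energy A \<le> energy A0 + \<theta>"
    proof -
      have "0 \<le> \<theta> * entropy_loss A0 A" using theta loss_nn by simp
      then show ?thesis using eA theta by linarith
    qed
    fix C assume C: "\<forall>i\<in>I. C i \<noteq> {} \<and> C i \<subseteq> A i"
    have "entropy_loss A0 C = entropy_loss A0 A + entropy_loss A C"
      using c0 cA C sub by (intro entropy_loss_trans) (meson card_gt_0_iff finite_subset)
    moreover have "energy A + \<theta> * entropy_loss A0 A \<le> energy C + \<theta> * entropy_loss A0 C"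
      by (rule min') (use C sub in blast)
    ultimately show "energy A - (\<theta> - \<theta>) - \<theta> * entropy_loss A C \<le> energy C"
      by (simp add: algebra_simps)
  qed (use sub in auto)
  moreover have "exp (- (2 * real (card I) ^ 2 / \<theta>)) * card (A0 i) \<le> card (A i)" if i: "i \<in> I" for i
  proof -
    have "ln (card (A0 i) / card (A i)) \<le> entropy_loss A0 A"
      unfolding entropy_loss_def by (rule member_le_sum[OF i _ fin_I]) (use lnn in auto)
    then have "\<theta> * ln (card (A0 i) / card (A i)) \<le> \<theta> * entropy_loss A0 A"
      using theta by (intro mult_left_mono) auto
    also have "\<dots> \<le> energy A0 - energy A" using eA by simp
    also have "\<dots> \<le> 2 * real (card I) ^ 2"
    proof -
      have le: "(\<Sum>i\<in>I. \<Sum>j\<in>I - {i}. (1::real)) \<le> real (card I) ^ 2"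
      proof -
        have "(\<Sum>i\<in>I. \<Sum>j\<in>I - {i}. (1::real)) \<le> (\<Sum>i\<in>I. \<Sum>j\<in>I. 1)"
          using fin_I by (intro sum_mono sum_mono2) auto
        then show ?thesis by (simp add: power2_eq_square)
      qed
      have "energy A0 \<le> (\<Sum>i\<in>I. \<Sum>j\<in>I - {i}. 1)"
        unfolding energy_def by (intro sum_mono score_bounds)
      moreover have "- (\<Sum>i\<in>I. \<Sum>j\<in>I - {i}. 1) \<le> energy A"
        unfolding energy_def sum_negf[symmetric]
      proof (intro sum_mono)
        fix k l show "- 1 \<le> score (A k) (A l)" using score_bounds(1)[of "A k" "A l"] eta by linarith
      qed
      ultimately show ?thesis using le by linarith
    qed
    finally have "ln (card (A0 i) / card (A i)) \<le> 2 * real (card I) ^ 2 / \<theta>"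
      using theta by (simp add: field_simps)
    then have "card (A0 i) / card (A i) \<le> exp (2 * real (card I) ^ 2 / \<theta>)"
      using c0[OF i] cA[OF i] by (metis divide_pos_pos exp_le_cancel_iff exp_ln of_nat_0_less_iff)
    then show ?thesis using cA[OF i] by (simp add: exp_minus field_simps)
  qed
  ultimately show ?thesis using that sub by blast
qed

text \<open>Clusters are replaced one at a time, each at the price of a factor
  \<open>2 / \<sigma>\<close> in the slack. As \<open>Q\<close> concerns a single cluster, later
  replacements do not disturb it.\<close>

lemma near_shrink_all:
  fixes \<sigma> :: real
  assumes "near T e A" "0 < \<sigma>" "\<sigma> \<le> 1"
    and shrink: "\<And>i. i \<in> I \<Longrightarrow> \<exists>C\<subseteq>A i. C \<noteq> {} \<and> \<sigma> * card (A i) \<le> card C \<and> Q C"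
  obtains C where "near (T * (2 / \<sigma>) ^ card I) e C"
    "\<And>i. i \<in> I \<Longrightarrow> C i \<subseteq> A i \<and> \<sigma> * card (A i) \<le> card (C i) \<and> Q (C i)"
proof -
  have T: "0 < T" using assms(1) theta unfolding near_def by linarith
  have A: "finite (A i)" "A i \<noteq> {}" if "i \<in> I" for i using assms(1) that unfolding near_def by auto
  have "\<exists>C. near (T * (2 / \<sigma>) ^ card J) e C \<and> (\<forall>i\<in>I - J. C i = A i) \<and>
      (\<forall>i\<in>J. C i \<subseteq> A i \<and> \<sigma> * card (A i) \<le> card (C i) \<and> Q (C i))" if "finite J" "J \<subseteq> I" for J
    using that
  proof (induction J rule: finite_induct)
    case empty
    show ?case using assms(1) by (intro exI[of _ A]) auto
  next
    case (insert k J)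
    then obtain C where C: "near (T * (2 / \<sigma>) ^ card J) e C" "\<forall>i\<in>I - J. C i = A i"
      "\<forall>i\<in>J. C i \<subseteq> A i \<and> \<sigma> * card (A i) \<le> card (C i) \<and> Q (C i)" by auto
    have k: "k \<in> I" using insert.prems by simp
    obtain B where B: "B \<subseteq> A k" "B \<noteq> {}" "\<sigma> * card (A k) \<le> card B" "Q B"
      using shrink[OF k] by blast
    have Ck: "C k = A k" using C(2) insert k by auto
    let ?b = "card B / card (C k)"
    have "card (A k) > 0" using A[OF k] by (simp add: card_gt_0_iff)
    then have b: "\<sigma> \<le> ?b" unfolding Ck using B(3) by (simp add: field_simps)
    have "near (2 * (T * (2 / \<sigma>) ^ card J) / ?b) e (C(k := B))"
      using near_shrink(1)[OF C(1) k _ B(2) refl] B(1) Ck by simp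
    moreover have "2 * (T * (2 / \<sigma>) ^ card J) / ?b \<le> 2 * (T * (2 / \<sigma>) ^ card J) / \<sigma>"
      using b T assms(2) by (intro divide_left_mono mult_pos_pos) auto
    moreover have "2 * (T * (2 / \<sigma>) ^ card J) / \<sigma> = T * (2 / \<sigma>) ^ card (insert k J)"
      using insert.hyps by simp
    ultimately have "near (T * (2 / \<sigma>) ^ card (insert k J)) e (C(k := B))"
      using near_mono by metis
    moreover have "\<forall>i\<in>I - insert k J. (C(k := B)) i = A i" using C(2) by simp
    moreover have "\<forall>i\<in>insert k J. (C(k := B)) i \<subseteq> A i \<and> \<sigma> * card (A i) \<le> card ((C(k := B)) i) \<and> Q ((C(k := B)) i)"
      using C(3) B by simp
    ultimately show ?case by blast
  qed
  from this[OF fin_I order_refl] that show ?thesis by blast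
qed

text \<open>First \<open>A i\<close> is replaced by \<open>X\<close>, then \<open>A j\<close> by
  \<open>Y\<close> in the new tuple, whose slack is at most \<open>2 * T / \<pi>\<close>. Each
  replacement moves the density by at most the square root.\<close>

lemma near_regular:
  fixes \<pi> :: real
  assumes near: "near T e A" and ij: "i \<in> I" "j \<in> I" "i \<noteq> j" and XY: "X \<subseteq> A i" "Y \<subseteq> A j"
    and pi: "0 < \<pi>" "\<pi> * card (A i) \<le> card X" "\<pi> * card (A j) \<le> card Y"
  shows "\<bar>dens g X Y - dens g (A i) (A j)\<bar> \<le> 2 * sqrt (2 * T / (\<eta> * \<pi>\<^sup>2))"
proof -
  have T: "0 < T" using near theta unfolding near_def by linarith
  have A: "finite (A k)" "A k \<noteq> {}" if "k \<in> I" for k using near that unfolding near_def by auto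
  have c: "card (A i) > 0" "card (A j) > 0" using A ij by (auto simp: card_gt_0_iff)
  have X0: "X \<noteq> {}" and Y0: "Y \<noteq> {}"
    using pi c by (auto simp: mult_le_0_iff)
  define b where "b = card X / card (A i)"
  have bX: "card X \<le> card (A i)" and bY: "card Y \<le> card (A j)" using XY A ij by (auto intro: card_mono)
  have b: "\<pi> \<le> b" "b \<le> 1" unfolding b_def using pi c bX by (auto simp: field_simps)
  have near1: "near (2 * T / b) e (A(i := X))"
    using near_shrink(1)[OF near ij(1) XY(1) X0 b_def] .
  define c' where "c' = card Y / card (A j)"
  have c': "\<pi> \<le> c'" unfolding c'_def using pi c by (simp add: field_simps)
  have pi1: "\<pi> \<le> 1" using b by simp
  let ?R = "sqrt (2 * T / (\<eta> * \<pi>\<^sup>2))"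
  have root: "\<bar>d\<bar> \<le> ?R" if "\<eta> * \<pi> * d\<^sup>2 \<le> 2 * T / \<pi>" for d
  proof -
    have "d\<^sup>2 \<le> 2 * T / (\<eta> * \<pi>\<^sup>2)"
      using that pi(1) eta by (simp add: field_simps power2_eq_square)
    then show ?thesis by (metis real_sqrt_abs real_sqrt_le_mono)
  qed
  have "\<bar>dens g X (A j) - dens g (A i) (A j)\<bar> \<le> ?R"
  proof (rule root)
    let ?d = "dens g X (A j) - dens g (A i) (A j)"
    have "\<eta> * \<pi> * ?d\<^sup>2 \<le> \<eta> * b * ?d\<^sup>2" using b eta by (intro mult_right_mono mult_left_mono) auto
    also have "\<dots> \<le> T" using near_shrink(2)[OF near ij(1) XY(1) X0 b_def] ij by auto
    also have "T \<le> 2 * T / \<pi>" using pi(1) pi1 T by (simp add: field_simps)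
    finally show "\<eta> * \<pi> * ?d\<^sup>2 \<le> 2 * T / \<pi>" .
  qed
  moreover have "\<bar>dens g X Y - dens g X (A j)\<bar> \<le> ?R"
  proof (rule root)
    have "\<eta> * c' * (dens g Y ((A(i := X)) i) - dens g ((A(i := X)) j) ((A(i := X)) i))\<^sup>2 \<le> 2 * T / b"
      using near_shrink(2)[OF near1 ij(2), of Y c' i] XY Y0 ij c'_def by auto
    then have 1: "\<eta> * c' * (dens g X Y - dens g X (A j))\<^sup>2 \<le> 2 * T / b"
      using ij dens_commute[of g, OF g_commute] by auto
    let ?d = "dens g X Y - dens g X (A j)"
    have "\<eta> * \<pi> * ?d\<^sup>2 \<le> \<eta> * c' * ?d\<^sup>2" using c' eta by (intro mult_right_mono mult_left_mono) auto
    also note 1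
    also have "2 * T / b \<le> 2 * T / \<pi>" using b pi(1) T by (intro divide_left_mono mult_pos_pos) auto
    finally show "\<eta> * \<pi> * ?d\<^sup>2 \<le> 2 * T / \<pi>" .
  qed
  ultimately show ?thesis by linarith
qed

text \<open>Score and edit density differ by at most \<open>\<eta>\<close> per pair, and the energy
  exceeds that of \<open>A0\<close> by at most \<open>T\<close>.\<close>

lemma near_cost:
  assumes "near T (energy A0) A"
  shows "(\<Sum>i\<in>I. \<Sum>j\<in>I - {i}. dens w (A i) (A j))
     \<le> (\<Sum>i\<in>I. \<Sum>j\<in>I - {i}. dens w (A0 i) (A0 j)) + T + \<eta> * real (card I) ^ 2"
proof -
  have "(\<Sum>i\<in>I. \<Sum>j\<in>I - {i}. dens w (A i) (A j)) \<le> (\<Sum>i\<in>I. \<Sum>j\<in>I - {i}. score (A i) (A j) + \<eta>)"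
  proof (intro sum_mono)
    fix i j
    have "(dens g (A i) (A j))\<^sup>2 \<le> 1"
      using g_ge g_le by (simp add: power_le_one dens_nonneg dens_le_1)
    then have "\<eta> * (dens g (A i) (A j))\<^sup>2 \<le> \<eta> * 1" using eta by (intro mult_left_mono) auto
    then show "dens w (A i) (A j) \<le> score (A i) (A j) + \<eta>" by (simp add: score_def)
  qed
  also have "\<dots> = energy A + (\<Sum>i\<in>I. \<Sum>j\<in>I - {i}. \<eta>)" by (simp add: energy_def sum.distrib)
  also have "(\<Sum>i\<in>I. \<Sum>j\<in>I - {i}. \<eta>) \<le> (\<Sum>i\<in>I. \<Sum>j\<in>I. \<eta>)"
    using fin_I eta by (intro sum_mono sum_mono2) auto
  also have "\<dots> = \<eta> * real (card I) ^ 2" by (simp add: power2_eq_square)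
  also have "energy A \<le> energy A0 + T" using assms unfolding near_def by blast
  also have "energy A0 \<le> (\<Sum>i\<in>I. \<Sum>j\<in>I - {i}. dens w (A0 i) (A0 j))"
    unfolding energy_def score_def using eta by (intro sum_mono) auto
  finally show ?thesis by simp
qed

end

section \<open>Sparse subsets, cliques and embeddings\<close>

definition clique_in :: "('a \<Rightarrow> 'a \<Rightarrow> bool) \<Rightarrow> 'a set \<Rightarrow> bool" where
  "clique_in R K \<longleftrightarrow> (\<forall>x\<in>K. \<forall>y\<in>K. x \<noteq> y \<longrightarrow> R x y)"

lemma clique_in_insert:
  assumes "\<And>x y. R x y = R y x"
  shows "clique_in R (insert x K) \<longleftrightarrow> clique_in R K \<and> (\<forall>y\<in>K. x \<noteq> y \<longrightarrow> R x y)"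
  unfolding clique_in_def using assms by auto

text \<open>If \<open>A\<close> is not sparse, some vertex has more than
  \<open>\<delta> * card A\<close> neighbours in \<open>A\<close>, and among these the forbidden
  clique size drops by one. This cannot reach size 0, since the empty set is a clique.\<close>

lemma exists_sparse_subset:
  fixes \<delta> :: real
  assumes "0 < \<delta>" "\<delta> \<le> 1" and sym: "\<And>x y. R x y = R y x" and irr: "\<And>x. \<not> R x x"
    and "finite A" "A \<noteq> {}" "\<And>K. K \<subseteq> A \<Longrightarrow> clique_in R K \<Longrightarrow> card K \<noteq> h"
  shows "\<exists>C\<subseteq>A. C \<noteq> {} \<and> \<delta> ^ h * card A \<le> card C \<and>
           (\<Sum>x\<in>C. \<Sum>y\<in>C. of_bool (R x y)) \<le> \<delta> * real (card C) ^ 2"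
  using assms(5-7)
proof (induction h arbitrary: A)
  case 0
  from "0.prems"(3)[of "{}"] show ?case by (simp add: clique_in_def)
next
  case (Suc h)
  show ?case
  proof (cases "(\<Sum>x\<in>A. \<Sum>y\<in>A. of_bool (R x y)) \<le> \<delta> * real (card A) ^ 2")
    case True
    have "\<delta> ^ Suc h \<le> 1" using assms(1,2) by (intro power_le_one) auto
    then have "\<delta> ^ Suc h * card A \<le> card A" by (intro mult_left_le_one_le) (use assms(1) in auto)
    then show ?thesis using True Suc.prems(2) by blast
  next
    case False
    have "\<exists>x\<in>A. \<delta> * card A < (\<Sum>y\<in>A. of_bool (R x y))"
    proof (rule ccontr)
      assume "\<not> ?thesis"
      then have "(\<Sum>x\<in>A. \<Sum>y\<in>A. of_bool (R x y)) \<le> (\<Sum>x\<in>A. \<delta> * card A)"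
        by (intro sum_mono) auto
      then show False using False by (simp add: power2_eq_square mult_ac)
    qed
    then obtain x where x: "x \<in> A" "\<delta> * card A < (\<Sum>y\<in>A. of_bool (R x y))" by blast
    define N where "N = {y \<in> A. R x y}"
    have "(\<Sum>y\<in>A. of_bool (R x y)) = real (card N)"
      using Suc.prems(1) by (simp add: N_def Int_def)
    with x have N: "\<delta> * card A \<le> card N" by simp
    have "card A > 0" using Suc.prems by (simp add: card_gt_0_iff)
    then have "0 < \<delta> * card A" using assms(1) by simp
    then have "N \<noteq> {}" using N by auto
    moreover have "finite N" using Suc.prems(1) by (simp add: N_def)
    moreover have "card K \<noteq> h" if K: "K \<subseteq> N" "clique_in R K" for K
    proof
      assume "card K = h"
      moreover have "x \<notin> K" using K(1) irr by (auto simp: N_def)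
      moreover have "finite K" using K(1) \<open>finite N\<close> by (rule finite_subset)
      ultimately have "card (insert x K) = Suc h" by simp
      moreover have "clique_in R (insert x K)"
        using K by (auto simp: clique_in_insert[OF sym] N_def)
      moreover have "insert x K \<subseteq> A" using K(1) x(1) by (auto simp: N_def)
      ultimately show False using Suc.prems(3) by blast
    qed
    ultimately obtain C where C: "C \<subseteq> N" "C \<noteq> {}" "\<delta> ^ h * card N \<le> card C"
      "(\<Sum>x\<in>C. \<Sum>y\<in>C. of_bool (R x y)) \<le> \<delta> * real (card C) ^ 2"
      using Suc.IH[of N] by auto
    have "\<delta> ^ Suc h * card A = \<delta> ^ h * (\<delta> * card A)" by simp
    also have "\<dots> \<le> \<delta> ^ h * card N" using N assms(1) by (intro mult_left_mono) auto
    also note C(3)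
    finally show ?thesis using C by (intro exI[of _ C]) (auto simp: N_def)
  qed
qed

text \<open>Turan's bound for \<open>k + 1\<close> parts, in ordered pairs. Remove a clique of the
  largest allowed size \<open>k + 1\<close>: every other vertex misses one of its vertices. If there
  is no such clique, the bound for smaller \<open>k\<close> applies; hence the two nested
  inductions.\<close>

lemma turan_ordered:
  fixes V :: "'a set"
  assumes sym: "\<And>x y. R x y = R y x" and irr: "\<And>x. \<not> R x x"
    and "finite V" "\<And>K. K \<subseteq> V \<Longrightarrow> clique_in R K \<Longrightarrow> card K \<noteq> k + 2"
  shows "(\<Sum>x\<in>V. \<Sum>y\<in>V. of_bool (R x y)) \<le> (1 - 1 / (real k + 1)) * real (card V) ^ 2"
  using assms(3,4)
proof (induction k arbitrary: V)
  case 0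
  have "\<not> R x y" if "x \<in> V" "y \<in> V" for x y
  proof
    assume "R x y"
    then have "x \<noteq> y" "clique_in R {x, y}" using irr sym by (auto simp: clique_in_def)
    then show False using 0(2)[of "{x, y}"] that by simp
  qed
  then show ?case by simp
next
  case (Suc k)
  note outer = Suc.IH
  let ?q = "k + 2"
  have bound: "1 - 1 / (real (Suc k) + 1) = (real ?q - 1) / real ?q" by (simp add: field_simps)
  show ?case
    using Suc.prems
  proof (induction "card V" arbitrary: V rule: less_induct)
    case less
    show ?case
    proof (cases "\<exists>Q\<subseteq>V. clique_in R Q \<and> card Q = ?q")
      case False
      then have "(\<Sum>x\<in>V. \<Sum>y\<in>V. of_bool (R x y)) \<le> (1 - 1 / (real k + 1)) * real (card V) ^ 2"
        by (intro outer less.prems) auto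
      also have "\<dots> \<le> (1 - 1 / (real (Suc k) + 1)) * real (card V) ^ 2"
        by (intro mult_right_mono diff_left_mono divide_left_mono) auto
      finally show ?thesis .
    next
      case True
      then obtain Q where Q: "Q \<subseteq> V" "clique_in R Q" "card Q = ?q" by blast
      have fQ: "finite Q" using Q(1) less.prems(1) finite_subset by blast
      define V' where "V' = V - Q"
      have fV': "finite V'" using less.prems(1) by (simp add: V'_def)
      have cV: "real (card V) = card V' + real ?q"
        using Q fQ less.prems(1) card_mono[OF less.prems(1) Q(1)]
        by (simp add: V'_def card_Diff_subset of_nat_diff)
      have lt: "card V' < card V" using cV by linarith
      let ?r = "\<lambda>x y. of_bool (R x y) :: real"
      have IH: "(\<Sum>x\<in>V'. \<Sum>y\<in>V'. ?r x y) \<le> (real ?q - 1) / real ?q * real (card V') ^ 2"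
        unfolding bound[symmetric] by (rule less.hyps[OF lt fV']) (use less.prems(2) V'_def in blast)
      have out: "(\<Sum>y\<in>Q. ?r x y) \<le> real ?q - 1" if x: "x \<in> V'" for x
      proof -
        have "\<exists>y\<in>Q. \<not> R x y"
        proof (rule ccontr)
          assume "\<not> ?thesis"
          then have "clique_in R (insert x Q)" using Q(2) by (auto simp: clique_in_insert[OF sym])
          moreover have "card (insert x Q) = Suc k + 2" using x Q(3) fQ by (simp add: V'_def)
          ultimately show False using less.prems(2)[of "insert x Q"] x Q(1) by (auto simp: V'_def)
        qed
        then obtain z where z: "z \<in> Q" "\<not> R x z" by blast
        have "(\<Sum>y\<in>Q. ?r x y) = (\<Sum>y\<in>Q - {z}. ?r x y)"
          using fQ z by (intro sum.mono_neutral_right) auto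
        also have "\<dots> \<le> (\<Sum>y\<in>Q - {z}. 1)" by (intro sum_mono) auto
        also have "\<dots> = real ?q - 1" using fQ z Q(3) by simp
        finally show ?thesis .
      qed
      have inn: "(\<Sum>y\<in>Q. ?r x y) \<le> real ?q - 1" if x: "x \<in> Q" for x
      proof -
        have "(\<Sum>y\<in>Q. ?r x y) = (\<Sum>y\<in>Q - {x}. ?r x y)"
          using fQ x irr by (intro sum.mono_neutral_right) auto
        also have "\<dots> \<le> (\<Sum>y\<in>Q - {x}. 1)" by (intro sum_mono) auto
        also have "\<dots> = real ?q - 1" using fQ x Q(3) by simp
        finally show ?thesis .
      qed
      have split: "(\<Sum>y\<in>V. f y) = (\<Sum>y\<in>V'. f y) + (\<Sum>y\<in>Q. f y)" for f :: "'a \<Rightarrow> real"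
        unfolding V'_def using Q(1) less.prems(1) by (intro sum.subset_diff)
      have "(\<Sum>x\<in>V. \<Sum>y\<in>V. ?r x y)
          = (\<Sum>x\<in>V'. \<Sum>y\<in>V'. ?r x y) + (\<Sum>x\<in>V'. \<Sum>y\<in>Q. ?r x y)
            + ((\<Sum>x\<in>Q. \<Sum>y\<in>V'. ?r x y) + (\<Sum>x\<in>Q. \<Sum>y\<in>Q. ?r x y))"
        by (simp only: split sum.distrib)
      also have "(\<Sum>x\<in>Q. \<Sum>y\<in>V'. ?r x y) = (\<Sum>x\<in>V'. \<Sum>y\<in>Q. ?r x y)"
        by (subst sum.swap) (simp only: sym)
      also have "(\<Sum>x\<in>V'. \<Sum>y\<in>Q. ?r x y) \<le> card V' * (real ?q - 1)"
        using sum_mono[of V' "\<lambda>x. \<Sum>y\<in>Q. ?r x y" "\<lambda>_. real ?q - 1"] out by simp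
      also have "(\<Sum>x\<in>Q. \<Sum>y\<in>Q. ?r x y) \<le> real ?q * (real ?q - 1)"
        using sum_mono[of Q "\<lambda>x. \<Sum>y\<in>Q. ?r x y" "\<lambda>_. real ?q - 1"] inn Q(3) by simp
      also note IH
      also have "(real ?q - 1) / real ?q * real (card V') ^ 2 + card V' * (real ?q - 1)
           + (card V' * (real ?q - 1) + real ?q * (real ?q - 1))
         = (real ?q - 1) / real ?q * real (card V) ^ 2"
        unfolding cV by (simp add: field_simps power2_eq_square)
      finally show ?thesis unfolding bound by simp
    qed
  qed
qed

text \<open>Vertices are placed one at a time. An element of \<open>X u\<close> is bad for
  \<open>v\<close> if it has too few partners in \<open>X v\<close>; by the density hypothesis the
  bad ones are at most a fraction \<open>\<pi>\<close>, and the smallness of \<open>\<pi>\<close>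
  leaves a good choice. Each other candidate set keeps at least a fraction \<open>\<delta>\<close>,
  hence the passage from \<open>\<pi>\<close> to \<open>\<pi> / \<delta>\<close>. Candidate sets may
  coincide, so distinctness of the images has to be encoded in \<open>R\<close>.\<close>

lemma greedy_embedding:
  fixes R :: "'u \<Rightarrow> 'u \<Rightarrow> 'a \<Rightarrow> 'a \<Rightarrow> bool" and \<delta> \<pi> :: real
  assumes "finite U" and \<delta>: "0 < \<delta>" "\<delta> \<le> 1" and sym: "\<And>u v x y. R u v x y = R v u y x"
    and "0 < \<pi>" "card U * \<pi> < \<delta> ^ card U"
    and "\<And>u. u \<in> U \<Longrightarrow> finite (X u) \<and> X u \<noteq> {}"
    and "\<And>u v A B. u \<in> U \<Longrightarrow> v \<in> U \<Longrightarrow> u \<noteq> v \<Longrightarrow> A \<subseteq> X u \<Longrightarrow> B \<subseteq> X v \<Longrightarrow>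
           \<pi> * card (X u) \<le> card A \<Longrightarrow> \<pi> * card (X v) \<le> card B \<Longrightarrow>
           \<delta> * (real (card A) * real (card B)) \<le> (\<Sum>x\<in>A. \<Sum>y\<in>B. of_bool (R u v x y))"
  shows "\<exists>\<phi>. (\<forall>u\<in>U. \<phi> u \<in> X u) \<and> (\<forall>u\<in>U. \<forall>v\<in>U. u \<noteq> v \<longrightarrow> R u v (\<phi> u) (\<phi> v))"
  using assms(1,5-8)
proof (induction U arbitrary: X \<pi> rule: finite_induct)
  case empty
  show ?case by simp
next
  case (insert u U)
  have Xu: "finite (X u)" "X u \<noteq> {}" using insert.prems(3) by auto
  have cXu: "card (X u) > 0" using Xu by (simp add: card_gt_0_iff)
  have pi0: "0 < \<pi>" by fact
  have small: "(1 + real (card U)) * \<pi> < \<delta> * \<delta> ^ card U" using insert.prems(2) insert.hyps by simp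
  have dU: "\<delta> ^ card U \<le> 1" using \<delta> by (intro power_le_one) auto
  have "\<delta> * \<delta> ^ card U \<le> 1 * 1" using \<delta> dU by (intro mult_mono) auto
  then have small1: "\<pi> + card U * \<pi> < 1" using small by (simp add: algebra_simps)
  then have pi1: "\<pi> \<le> 1" using pi0 by (smt (verit) mult_nonneg_nonneg of_nat_0_le_iff)
  have Uu: "card U * \<pi> < 1" using small1 pi0 by linarith
  define bad where "bad v = {x \<in> X u. (\<Sum>y\<in>X v. of_bool (R u v x y)) < \<delta> * card (X v)}" for v
  have bad: "card (bad v) \<le> \<pi> * card (X u)" if v: "v \<in> U" for v
  proof (rule ccontr)
    assume "\<not> ?thesis"
    then have big: "\<pi> * card (X u) \<le> card (bad v)" by simp
    have "u \<noteq> v" using v insert.hyps by auto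
    have "0 < \<pi> * card (X u)" using pi0 cXu by simp
    then have "card (bad v) > 0" using big by linarith
    then have ne: "bad v \<noteq> {}" "finite (bad v)" by (auto simp: card_gt_0_iff)
    have "\<pi> * card (X v) \<le> card (X v)" using pi1 pi0 by (simp add: mult_left_le_one_le)
    then have "\<delta> * (real (card (bad v)) * real (card (X v)))
        \<le> (\<Sum>x\<in>bad v. \<Sum>y\<in>X v. of_bool (R u v x y))"
      using v \<open>u \<noteq> v\<close> big by (intro insert.prems(4)) (auto simp: bad_def)
    also have "\<dots> < (\<Sum>x\<in>bad v. \<delta> * card (X v))"
      using ne by (intro sum_strict_mono) (auto simp: bad_def)
    finally show False by (simp add: mult_ac)
  qed
  have "real (card (\<Union>v\<in>U. bad v)) \<le> (\<Sum>v\<in>U. real (card (bad v)))"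
    using card_UN_le[OF insert.hyps(1), of bad] by (metis of_nat_le_iff of_nat_sum)
  also have "\<dots> \<le> (\<Sum>v\<in>U. \<pi> * card (X u))" by (intro sum_mono bad)
  also have "\<dots> = card U * \<pi> * card (X u)" by simp
  also have "\<dots> < 1 * real (card (X u))" using Uu cXu by (intro mult_strict_right_mono) auto
  finally have "card (\<Union>v\<in>U. bad v) < card (X u)" by simp
  then have "\<not> X u \<subseteq> (\<Union>v\<in>U. bad v)"
    using card_mono[of "\<Union>v\<in>U. bad v" "X u"] insert.hyps(1) Xu by (force simp: bad_def)
  then obtain x where x: "x \<in> X u" "\<And>v. v \<in> U \<Longrightarrow> x \<notin> bad v" by blast
  define X' where "X' v = {y \<in> X v. R u v x y}" for v
  have fX: "finite (X v)" "X v \<noteq> {}" if "v \<in> U" for v using insert.prems(3) that by auto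
  have X': "\<delta> * card (X v) \<le> card (X' v)" if v: "v \<in> U" for v
  proof -
    have "(\<Sum>y\<in>X v. of_bool (R u v x y)) = real (card (X' v))"
      using fX(1)[OF v] by (simp add: X'_def Int_def)
    moreover have "\<not> (\<Sum>y\<in>X v. of_bool (R u v x y)) < \<delta> * card (X v)"
      using x(1) x(2)[OF v] unfolding bad_def by blast
    ultimately show ?thesis by linarith
  qed
  have X'ne: "finite (X' v) \<and> X' v \<noteq> {}" if v: "v \<in> U" for v
  proof -
    have "0 < \<delta> * card (X v)" using fX[OF v] \<delta> by (simp add: card_gt_0_iff)
    then have "card (X' v) > 0" using X'[OF v] by linarith
    then show ?thesis by (auto simp: card_gt_0_iff)
  qed
  have "\<exists>\<phi>. (\<forall>u\<in>U. \<phi> u \<in> X' u) \<and> (\<forall>u\<in>U. \<forall>v\<in>U. u \<noteq> v \<longrightarrow> R u v (\<phi> u) (\<phi> v))"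
  proof (rule insert.IH[of "\<pi> / \<delta>"])
    show "0 < \<pi> / \<delta>" using pi0 \<delta> by simp
    have "card U * \<pi> < \<delta> * \<delta> ^ card U" using small pi0 by (simp add: algebra_simps)
    then show "card U * (\<pi> / \<delta>) < \<delta> ^ card U" using \<delta> by (simp add: field_simps)
    show "finite (X' v) \<and> X' v \<noteq> {}" if "v \<in> U" for v using X'ne[OF that] .
    fix v v' A B
    assume *: "v \<in> U" "v' \<in> U" "v \<noteq> v'" "A \<subseteq> X' v" "B \<subseteq> X' v'"
      "\<pi> / \<delta> * card (X' v) \<le> card A" "\<pi> / \<delta> * card (X' v') \<le> card B"
    have up: "\<pi> * card (X t) \<le> \<pi> / \<delta> * card (X' t)" if "t \<in> U" for t
      using mult_left_mono[OF X'[OF that], of "\<pi> / \<delta>"] pi0 \<delta> by simp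
    show "\<delta> * (real (card A) * real (card B)) \<le> (\<Sum>x\<in>A. \<Sum>y\<in>B. of_bool (R v v' x y))"
      using * up[of v] up[of v'] by (intro insert.prems(4)) (auto simp: X'_def)
  qed
  then obtain \<phi> where \<phi>: "\<forall>u\<in>U. \<phi> u \<in> X' u" "\<forall>u\<in>U. \<forall>v\<in>U. u \<noteq> v \<longrightarrow> R u v (\<phi> u) (\<phi> v)" by blast
  let ?\<psi> = "\<phi>(u := x)"
  have "\<forall>v\<in>insert u U. ?\<psi> v \<in> X v" using \<phi>(1) x(1) by (auto simp: X'_def)
  moreover have "R v v' (?\<psi> v) (?\<psi> v')" if "v \<in> insert u U" "v' \<in> insert u U" "v \<noteq> v'" for v v'
  proof (cases "v = u")
    case True
    then show ?thesis using \<phi>(1) that by (auto simp: X'_def)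
  next
    case False
    then show ?thesis
      using \<phi> that sym[of v v'] by (cases "v' = u") (auto simp: X'_def)
  qed
  ultimately show ?case by blast
qed

text \<open>The second clause is sparsity inside a cluster, in a form that can be used for all large
  subsets: at least half of the ordered pairs are distinct and nonadjacent.\<close>

definition regular_tuple :: "nat \<Rightarrow> real \<Rightarrow> real \<Rightarrow> ('a \<Rightarrow> 'a \<Rightarrow> bool) \<Rightarrow> (nat \<Rightarrow> 'a set) \<Rightarrow> bool" where
  "regular_tuple s \<delta> \<pi> adj C \<longleftrightarrow>
     (\<forall>i<s. \<forall>j<s. i \<noteq> j \<longrightarrow> (\<forall>X\<subseteq>C i. \<forall>Y\<subseteq>C j.
        \<pi> * card (C i) \<le> card X \<longrightarrow> \<pi> * card (C j) \<le> card Y \<longrightarrow>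
        \<bar>dens (\<lambda>x y. of_bool (adj x y)) X Y - dens (\<lambda>x y. of_bool (adj x y)) (C i) (C j)\<bar> \<le> \<delta>)) \<and>
     (\<forall>i<s. \<forall>X\<subseteq>C i. \<forall>Y\<subseteq>C i.
        \<pi> * card (C i) \<le> card X \<longrightarrow> \<pi> * card (C i) \<le> card Y \<longrightarrow>
        real (card X) * real (card Y) / 2 \<le> (\<Sum>x\<in>X. \<Sum>y\<in>Y. of_bool (x \<noteq> y \<and> \<not> adj x y)))"

definition refines_to_regular :: "nat \<Rightarrow> real \<Rightarrow> real \<Rightarrow> real \<Rightarrow> real \<Rightarrow>
    ('a \<Rightarrow> 'a \<Rightarrow> real) \<Rightarrow> ('a \<Rightarrow> 'a \<Rightarrow> bool) \<Rightarrow> (nat \<Rightarrow> 'a set) \<Rightarrow> nat \<Rightarrow> bool" where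
  "refines_to_regular s \<delta> \<pi> \<eta> c w adj A0 N \<longleftrightarrow>
     (\<exists>C. (\<forall>i<s. C i \<subseteq> A0 i \<and> c * N \<le> card (C i)) \<and>
        (\<Sum>i<s. \<Sum>j\<in>{..<s} - {i}. dens w (C i) (C j))
           \<le> (\<Sum>i<s. \<Sum>j\<in>{..<s} - {i}. dens w (A0 i) (A0 j)) + 2 * \<eta> * real s ^ 2 \<and>
        regular_tuple s \<delta> \<pi> adj C)"

text \<open>\<open>c\<close> is fixed before the graph, so that the discrepancy of the quasirandom
  graph can be chosen small compared with the clusters. The potential is minimised first and the
  clusters are thinned to sparse ones afterwards, which multiplies the slack only by the constant
  \<open>K\<close>.\<close>

lemma exists_regular_tuple:
  fixes \<delta> \<pi> \<eta> :: real and s h :: nat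
  assumes \<delta>: "0 < \<delta>" and \<pi>: "0 < \<pi>" "\<pi> \<le> 1" and \<eta>: "0 < \<eta>" "\<eta> \<le> 1" and s: "0 < s"
  shows "\<exists>c>0. \<forall>(A0 :: nat \<Rightarrow> 'a set) w adj N.
      (\<forall>x y. w x y = w y x \<and> 0 \<le> w x y \<and> w x y \<le> 1) \<longrightarrow>
      (\<forall>x y. adj x y = adj y x \<and> \<not> adj x x) \<longrightarrow>
      (\<forall>i<s. finite (A0 i) \<and> card (A0 i) = N) \<longrightarrow> 1 \<le> c * real N \<longrightarrow>
      (\<forall>i<s. \<forall>K\<subseteq>A0 i. clique_in adj K \<longrightarrow> card K \<noteq> h) \<longrightarrow>
      refines_to_regular s \<delta> \<pi> \<eta> c w adj A0 N"
proof -
  \<comment> \<open>Adjacent pairs and diagonal pairs each make up at most a fraction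
    \<open>\<tau>\<close> of the ordered pairs of a cluster; together this is at most half of the
    pairs between two subsets of relative size \<open>\<pi>\<close>.\<close>
  define \<tau> where "\<tau> = \<pi>\<^sup>2 / 4"
  have \<tau>: "0 < \<tau>" "\<tau> \<le> 1" using \<pi> power_le_one[of \<pi> 2] by (auto simp: \<tau>_def)
  define \<sigma> where "\<sigma> = \<tau> ^ h"
  have \<sigma>: "0 < \<sigma>" "\<sigma> \<le> 1" using \<tau> by (auto simp: \<sigma>_def power_le_one)
  define K where "K = (2 / \<sigma>) ^ s"
  have "1 \<le> 2 / \<sigma>" using \<sigma> by (simp add: field_simps)
  then have K: "1 \<le> K" unfolding K_def by (rule one_le_power)
  \<comment> \<open>After thinning the slack is \<open>\<theta> * K\<close>. The first entry of the
    minimum controls the rise in cost, the second brings the bound of \<open>near_regular\<close>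
    down to \<open>\<delta>\<close>.\<close>
  define \<theta> where "\<theta> = min \<eta> (\<delta>\<^sup>2 * \<eta> * \<pi>\<^sup>2 / 8) / K"
  have \<theta>: "0 < \<theta>" using \<delta> \<eta> \<pi> K by (simp add: \<theta>_def)
  have T: "\<theta> * K \<le> \<eta>" "\<theta> * K \<le> \<delta>\<^sup>2 * \<eta> * \<pi>\<^sup>2 / 8" using K by (auto simp: \<theta>_def)
  define c0 where "c0 = exp (- (2 * real s ^ 2 / \<theta>)) * \<sigma>"
  have c0: "0 < c0" using \<sigma> by (simp add: c0_def)
  show ?thesis
  \<comment> \<open>With the factor \<open>\<tau>\<close>, the assumption on \<open>N\<close> also
    gives \<open>1 \<le> \<tau> * card (C i)\<close>, which makes the diagonal negligible.\<close>
  proof (intro exI[of _ "c0 * \<tau>"] conjI allI impI)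
    show "0 < c0 * \<tau>" using c0 \<tau> by simp
  next
    fix A0 :: "nat \<Rightarrow> 'a set" and w :: "'a \<Rightarrow> 'a \<Rightarrow> real" and adj :: "'a \<Rightarrow> 'a \<Rightarrow> bool" and N :: nat
    assume w: "\<forall>x y. w x y = w y x \<and> 0 \<le> w x y \<and> w x y \<le> 1"
      and adj: "\<forall>x y. adj x y = adj y x \<and> \<not> adj x x"
      and A0': "\<forall>i<s. finite (A0 i) \<and> card (A0 i) = N" and N: "1 \<le> c0 * \<tau> * real N"
      and free: "\<forall>i<s. \<forall>K\<subseteq>A0 i. clique_in adj K \<longrightarrow> card K \<noteq> h"
    note A0 = A0'[rule_format]
    define g :: "'a \<Rightarrow> 'a \<Rightarrow> real" where "g x y = of_bool (adj x y)" for x y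
    interpret potential "{..<s}" w g \<eta> \<theta>
    proof
      show "w x y = w y x" "0 \<le> w x y" "w x y \<le> 1" for x y using w by blast+
      show "g x y = g y x" for x y
        using adj[THEN spec, THEN spec, of x y] by (simp add: g_def)
    qed (use \<eta> \<theta> in \<open>auto simp: g_def\<close>)
    have "N \<noteq> 0" using N by (metis mult_zero_right not_one_le_zero of_nat_0)
    then have "finite (A0 i) \<and> A0 i \<noteq> {}" if "i < s" for i using A0[OF that] by auto
    then obtain A where A: "near \<theta> (energy A0) A" "\<And>i. i < s \<Longrightarrow> A i \<subseteq> A0 i"
      "\<And>i. i < s \<Longrightarrow> exp (- (2 * real s ^ 2 / \<theta>)) * card (A0 i) \<le> card (A i)"
      using near_exists[of A0] by (metis card_lessThan lessThan_iff)
    have fA: "finite (A i)" "A i \<noteq> {}" if "i < s" for i using A(1) that unfolding near_def by auto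
    define Q where "Q B \<longleftrightarrow> (\<Sum>x\<in>B. \<Sum>y\<in>B. of_bool (adj x y)) \<le> \<tau> * real (card B) ^ 2" for B
    have "\<exists>C\<subseteq>A i. C \<noteq> {} \<and> \<sigma> * card (A i) \<le> card C \<and> Q C" if "i \<in> {..<s}" for i
      unfolding \<sigma>_def Q_def
    proof (rule exists_sparse_subset[OF \<tau>])
      show "adj x y = adj y x" "\<not> adj x x" for x y using adj by blast+
      show "finite (A i)" "A i \<noteq> {}" using that fA by auto
      show "card K \<noteq> h" if "K \<subseteq> A i" "clique_in adj K" for K
        using that \<open>i \<in> {..<s}\<close> A(2)[of i] free by blast
    qed
    then obtain C where C: "near (\<theta> * (2 / \<sigma>) ^ card {..<s}) (energy A0) C"
      "\<And>i. i \<in> {..<s} \<Longrightarrow> C i \<subseteq> A i \<and> \<sigma> * card (A i) \<le> card (C i) \<and> Q (C i)"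
      using near_shrink_all[OF A(1) \<sigma>, of Q] by blast
    have C1: "near (\<theta> * K) (energy A0) C" using C(1) by (simp add: K_def)
    have size: "c0 * N \<le> card (C i)" if i: "i < s" for i
    proof -
      have "c0 * N = \<sigma> * (exp (- (2 * real s ^ 2 / \<theta>)) * card (A0 i))" using A0[OF i] by (simp add: c0_def)
      also have "\<dots> \<le> \<sigma> * card (A i)" using A(3)[OF i] \<sigma> by (intro mult_left_mono) auto
      also have "\<dots> \<le> card (C i)" using C(2) i by blast
      finally show ?thesis .
    qed
    have big: "1 \<le> \<tau> * card (C i)" if i: "i < s" for i
    proof -
      have "1 \<le> \<tau> * (c0 * N)" using N by (simp add: mult_ac)
      also have "\<dots> \<le> \<tau> * card (C i)" using size[OF i] \<tau> by (intro mult_left_mono) auto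
      finally show ?thesis .
    qed
    have fC: "finite (C i)" if "i < s" for i using C(2) fA that finite_subset by blast
    have "C i \<subseteq> A0 i \<and> c0 * \<tau> * N \<le> card (C i)" if i: "i < s" for i
    proof -
      have "c0 * \<tau> * N \<le> c0 * N" using c0 \<tau> by (intro mult_right_mono) auto
      then show ?thesis using size[OF i] C(2) A(2)[OF i] i by fastforce
    qed
    moreover have "(\<Sum>i<s. \<Sum>j\<in>{..<s} - {i}. dens w (C i) (C j))
           \<le> (\<Sum>i<s. \<Sum>j\<in>{..<s} - {i}. dens w (A0 i) (A0 j)) + 2 * \<eta> * real s ^ 2"
    proof -
      have "1 \<le> real s ^ 2" using s by (simp add: one_le_power)
      then have "\<theta> * K \<le> \<eta> * real s ^ 2" using T(1) \<eta> mult_left_mono[of 1 "real s ^ 2" \<eta>] by linarith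
      then show ?thesis using near_cost[OF C1] by simp
    qed
    moreover have "\<bar>dens g X Y - dens g (C i) (C j)\<bar> \<le> \<delta>"
      if "i < s" "j < s" "i \<noteq> j" "X \<subseteq> C i" "Y \<subseteq> C j" "\<pi> * card (C i) \<le> card X" "\<pi> * card (C j) \<le> card Y"
      for i j X Y
    proof -
      have "\<bar>dens g X Y - dens g (C i) (C j)\<bar> \<le> 2 * sqrt (2 * (\<theta> * K) / (\<eta> * \<pi>\<^sup>2))"
        using that \<pi> by (intro near_regular[OF C1]) auto
      also have "\<dots> \<le> 2 * sqrt ((\<delta> / 2)\<^sup>2)"
      proof -
        have "2 * (\<theta> * K) / (\<eta> * \<pi>\<^sup>2) \<le> 2 * (\<delta>\<^sup>2 * \<eta> * \<pi>\<^sup>2 / 8) / (\<eta> * \<pi>\<^sup>2)"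
          by (intro divide_right_mono mult_left_mono T(2)) (use \<eta> in auto)
        also have "\<dots> = (\<delta> / 2)\<^sup>2" using \<eta> \<pi> by (simp add: power_divide)
        finally show ?thesis by (intro mult_left_mono real_sqrt_le_mono) auto
      qed
      also have "\<dots> = \<delta>" using \<delta> by simp
      finally show ?thesis .
    qed
    moreover have "real (card X) * real (card Y) / 2 \<le> (\<Sum>x\<in>X. \<Sum>y\<in>Y. of_bool (x \<noteq> y \<and> \<not> adj x y))"
      if i: "i < s" and XY: "X \<subseteq> C i" "Y \<subseteq> C i" "\<pi> * card (C i) \<le> card X" "\<pi> * card (C i) \<le> card Y" for i X Y
    proof -
      let ?c = "real (card (C i))"
      have "(\<Sum>x\<in>X. \<Sum>y\<in>Y. of_bool (adj x y) + of_bool (x = y))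
          \<le> (\<Sum>x\<in>C i. \<Sum>y\<in>Y. (of_bool (adj x y) + of_bool (x = y) :: real))"
        using XY fC[OF i] by (intro sum_mono2) (auto simp: sum_nonneg)
      also have "\<dots> \<le> (\<Sum>x\<in>C i. \<Sum>y\<in>C i. of_bool (adj x y) + of_bool (x = y))"
        using XY fC[OF i] by (intro sum_mono sum_mono2) auto
      also have "\<dots> = (\<Sum>x\<in>C i. \<Sum>y\<in>C i. of_bool (adj x y)) + (\<Sum>x\<in>C i. 1)"
      proof -
        have "(\<Sum>y\<in>C i. of_bool (x = y)) = (1::real)" if "x \<in> C i" for x
          using that fC[OF i] by (simp add: of_bool_def)
        then have "(\<Sum>x\<in>C i. \<Sum>y\<in>C i. of_bool (x = y)) = (\<Sum>x\<in>C i. (1::real))"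
          by (intro sum.cong) auto
        then show ?thesis by (simp only: sum.distrib)
      qed
      also have "\<dots> \<le> \<tau> * ?c ^ 2 + \<tau> * ?c ^ 2"
      proof (rule add_mono)
        show "(\<Sum>x\<in>C i. \<Sum>y\<in>C i. of_bool (adj x y)) \<le> \<tau> * ?c ^ 2"
          using C(2)[of i] i unfolding Q_def by auto
        show "(\<Sum>x\<in>C i. (1::real)) \<le> \<tau> * ?c ^ 2"
          using mult_right_mono[OF big[OF i], of ?c] by (simp add: power2_eq_square mult_ac)
      qed
      also have "\<dots> = (\<pi> * ?c) * (\<pi> * ?c) / 2"
        by (simp add: \<tau>_def power2_eq_square)
      also have "\<dots> \<le> real (card X) * real (card Y) / 2"
        using XY \<pi> by (intro divide_right_mono mult_mono) auto
      finally have bad: "(\<Sum>x\<in>X. \<Sum>y\<in>Y. of_bool (adj x y) + of_bool (x = y)) \<le> real (card X) * real (card Y) / 2" .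
      have "real (card X) * real (card Y) = (\<Sum>x\<in>X. \<Sum>y\<in>Y. 1)" by simp
      also have "\<dots> \<le> (\<Sum>x\<in>X. \<Sum>y\<in>Y. of_bool (x \<noteq> y \<and> \<not> adj x y) + (of_bool (adj x y) + of_bool (x = y)))"
        by (intro sum_mono) auto
      also have "\<dots> = (\<Sum>x\<in>X. \<Sum>y\<in>Y. of_bool (x \<noteq> y \<and> \<not> adj x y))
           + (\<Sum>x\<in>X. \<Sum>y\<in>Y. of_bool (adj x y) + of_bool (x = y))"
        by (simp only: sum.distrib)
      finally show ?thesis using bad by linarith
    qed
    ultimately show "refines_to_regular s \<delta> \<pi> \<eta> (c0 * \<tau>) w adj A0 N"
      unfolding refines_to_regular_def regular_tuple_def g_def by (intro exI[of _ C] conjI allI impI) blast+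
  qed
qed

text \<open>Vertices sharing a cluster are nonadjacent, and the sparse interior serves them. Between
  clusters the margin \<open>2 * \<delta>\<close> and regularity leave density at least
  \<open>\<delta>\<close> for the required edges or nonedges between all large subsets.\<close>

lemma cluster_embedding:
  fixes \<delta> \<pi> :: real and C :: "nat \<Rightarrow> nat set" and G :: ugraph
  defines "d X Y \<equiv> dens (\<lambda>x y. of_bool ({x, y} \<in> edges G)) X Y"
  assumes H: "hereditary \<H>" "G \<in> \<H>" and F: "finite_simple F"
    and \<delta>: "0 < \<delta>" "\<delta> \<le> 1 / 2" and \<pi>: "0 < \<pi>" "card (verts F) * \<pi> < \<delta> ^ card (verts F)"
    and C: "\<And>i. i < s \<Longrightarrow> finite (C i) \<and> C i \<noteq> {} \<and> C i \<subseteq> verts G"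
    and disj: "\<And>i j. i < s \<Longrightarrow> j < s \<Longrightarrow> i \<noteq> j \<Longrightarrow> C i \<inter> C j = {}"
    and regular: "regular_tuple s \<delta> \<pi> (\<lambda>x y. {x, y} \<in> edges G) C"
    and \<kappa>: "\<And>u. u \<in> verts F \<Longrightarrow> \<kappa> u < s"
    and proper: "\<And>u v. {u, v} \<in> edges F \<Longrightarrow> \<kappa> u \<noteq> \<kappa> v"
    and edge: "\<And>u v. {u, v} \<in> edges F \<Longrightarrow> 2 * \<delta> \<le> d (C (\<kappa> u)) (C (\<kappa> v))"
    and nonedge: "\<And>u v. u \<in> verts F \<Longrightarrow> v \<in> verts F \<Longrightarrow> \<kappa> u \<noteq> \<kappa> v \<Longrightarrow> {u, v} \<notin> edges F \<Longrightarrow>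
           d (C (\<kappa> u)) (C (\<kappa> v)) \<le> 1 - 2 * \<delta>"
  shows "F \<in> \<H>"
proof -
  have reg: "\<bar>d X Y - d (C i) (C j)\<bar> \<le> \<delta>"
    if "i < s" "j < s" "i \<noteq> j" "X \<subseteq> C i" "Y \<subseteq> C j" "\<pi> * card (C i) \<le> card X" "\<pi> * card (C j) \<le> card Y" for i j X Y
    unfolding d_def by (rule regular[unfolded regular_tuple_def, THEN conjunct1, rule_format, OF that])
  have inner: "real (card X) * real (card Y) / 2 \<le> (\<Sum>x\<in>X. \<Sum>y\<in>Y. of_bool (x \<noteq> y \<and> {x, y} \<notin> edges G))"
    if "i < s" "X \<subseteq> C i" "Y \<subseteq> C i" "\<pi> * card (C i) \<le> card X" "\<pi> * card (C i) \<le> card Y" for i X Y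
    by (rule regular[unfolded regular_tuple_def, THEN conjunct2, rule_format, OF that])
  define R where "R u v x y \<longleftrightarrow> x \<noteq> y \<and> ({x, y} \<in> edges G \<longleftrightarrow> {u, v} \<in> edges F)" for u v x y
  have "\<exists>\<phi>. (\<forall>u\<in>verts F. \<phi> u \<in> C (\<kappa> u)) \<and>
      (\<forall>u\<in>verts F. \<forall>v\<in>verts F. u \<noteq> v \<longrightarrow> R u v (\<phi> u) (\<phi> v))"
  proof (rule greedy_embedding[OF finite_simpleD(1)[OF F] \<delta>(1) _ _ \<pi>])
    show "\<delta> \<le> 1" using \<delta> by simp
    show "R u v x y = R v u y x" for u v x y by (auto simp: R_def insert_commute)
    show "finite (C (\<kappa> u)) \<and> C (\<kappa> u) \<noteq> {}" if "u \<in> verts F" for u using C \<kappa> that by blast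
  next
    fix u v A B
    assume uv: "u \<in> verts F" "v \<in> verts F" "u \<noteq> v" and AB: "A \<subseteq> C (\<kappa> u)" "B \<subseteq> C (\<kappa> v)"
      "\<pi> * card (C (\<kappa> u)) \<le> card A" "\<pi> * card (C (\<kappa> v)) \<le> card B"
    let ?ab = "real (card A) * real (card B)"
    have fin: "finite A" "finite B" using AB C \<kappa> uv finite_subset by blast+
    show "\<delta> * ?ab \<le> (\<Sum>x\<in>A. \<Sum>y\<in>B. of_bool (R u v x y))"
    proof (cases "\<kappa> u = \<kappa> v")
      case True
      then have ne: "{u, v} \<notin> edges F" using proper by blast
      have "\<delta> * ?ab \<le> 1 / 2 * ?ab" using \<delta> by (intro mult_right_mono) auto
      also have "\<dots> \<le> (\<Sum>x\<in>A. \<Sum>y\<in>B. of_bool (x \<noteq> y \<and> {x, y} \<notin> edges G))"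
        using inner[of "\<kappa> u" A B] \<kappa> uv AB True by simp
      finally show ?thesis by (simp add: R_def ne del: sum_of_bool_eq)
    next
      case False
      have pos: "card A > 0" "card B > 0"
      proof -
        have "0 < \<pi> * card (C (\<kappa> u))" "0 < \<pi> * card (C (\<kappa> v))"
          using C \<kappa> uv \<pi>(1) by (auto simp: card_gt_0_iff)
        then show "card A > 0" "card B > 0" using AB by linarith+
      qed
      have ab: "0 < ?ab" using pos by simp
      have ne: "x \<noteq> y" if "x \<in> A" "y \<in> B" for x y
        using that AB disj[of "\<kappa> u" "\<kappa> v"] \<kappa> uv False by blast
      let ?S = "\<Sum>x\<in>A. \<Sum>y\<in>B. (of_bool ({x, y} \<in> edges G) :: real)"
      have d: "d A B * ?ab = ?S" using pos by (simp add: d_def dens_def del: sum_of_bool_eq)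
      have reg': "\<bar>d A B - d (C (\<kappa> u)) (C (\<kappa> v))\<bar> \<le> \<delta>"
        using reg[of "\<kappa> u" "\<kappa> v" A B] \<kappa> uv False AB by blast
      show ?thesis
      proof (cases "{u, v} \<in> edges F")
        case True
        then have "\<delta> \<le> d A B" using reg' edge[OF True] by linarith
        then have "\<delta> * ?ab \<le> ?S" unfolding d[symmetric] by (intro mult_right_mono) auto
        also have "?S = (\<Sum>x\<in>A. \<Sum>y\<in>B. of_bool (R u v x y))"
          using True ne by (intro sum.cong) (auto simp: R_def)
        finally show ?thesis .
      next
        case False
        then have "\<delta> \<le> 1 - d A B" using reg' nonedge[OF uv(1,2) \<open>\<kappa> u \<noteq> \<kappa> v\<close> False] by linarith
        then have "\<delta> * ?ab \<le> (1 - d A B) * ?ab" by (intro mult_right_mono) auto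
        also have "\<dots> = (\<Sum>x\<in>A. \<Sum>y\<in>B. 1) - ?S" using d by (simp add: left_diff_distrib)
        also have "\<dots> = (\<Sum>x\<in>A. \<Sum>y\<in>B. 1 - of_bool ({x, y} \<in> edges G))" by (simp only: sum_subtractf)
        also have "\<dots> = (\<Sum>x\<in>A. \<Sum>y\<in>B. of_bool (R u v x y))"
          using False ne by (intro sum.cong) (auto simp: R_def)
        finally show ?thesis .
      qed
    qed
  qed
  then obtain \<phi> where \<phi>: "\<forall>u\<in>verts F. \<phi> u \<in> C (\<kappa> u)"
    "\<And>u v. u \<in> verts F \<Longrightarrow> v \<in> verts F \<Longrightarrow> u \<noteq> v \<Longrightarrow> R u v (\<phi> u) (\<phi> v)" by blast
  show ?thesis
  proof (rule hereditary_induced_copy[OF H F])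
    show "inj_on \<phi> (verts F)" by (rule inj_onI) (use \<phi>(2) R_def in blast)
    show "\<phi> ` verts F \<subseteq> verts G" using \<phi>(1) C \<kappa> by blast
    show "{\<phi> u, \<phi> v} \<in> edges G \<longleftrightarrow> {u, v} \<in> edges F" if "u \<in> verts F" "v \<in> verts F" "u \<noteq> v" for u v
      using \<phi>(2)[OF that] by (simp add: R_def)
  qed
qed

section \<open>The lower bound\<close>

text \<open>The identity is a proper colouring with boundedly many colours, so the
  \<open>LEAST\<close> is attained.\<close>

lemma chromatic_colouring:
  assumes "finite_simple F"
  obtains c where "c ` verts F \<subseteq> {..<chromatic_number F}" "\<And>u v. {u, v} \<in> edges F \<Longrightarrow> c u \<noteq> c v"
proof -
  let ?P = "\<lambda>k. \<exists>c. c ` verts F \<subseteq> {..<k} \<and> (\<forall>u v. {u, v} \<in> edges F \<longrightarrow> c u \<noteq> (c v :: nat))"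
  obtain k where "\<forall>v\<in>verts F. v < k"
    using finite_simpleD(1)[OF assms] unfolding finite_nat_set_iff_bounded ..
  then have "(\<lambda>v. v) ` verts F \<subseteq> {..<k}" by auto
  moreover have "u \<noteq> v" if "{u, v} \<in> edges F" for u v
    using finite_simple_edge_distinct[OF assms that] by simp
  ultimately have "?P k" by (intro exI[of _ "\<lambda>v. v"] conjI) auto
  from LeastI[of ?P, OF this] obtain c where "c ` verts F \<subseteq> {..<chromatic_number F}"
    "\<forall>u v. {u, v} \<in> edges F \<longrightarrow> c u \<noteq> c v"
    unfolding chromatic_number_def[symmetric] by (elim exE conjE)
  then show ?thesis using that[of c] by simp
qed

lemma complete_multipartite_colouring:
  assumes "finite_simple F" "complete_multipartite m F"
  obtains c where "c ` verts F \<subseteq> {..<m}"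
    "\<And>u v. u \<in> verts F \<Longrightarrow> v \<in> verts F \<Longrightarrow> {u, v} \<in> edges F \<longleftrightarrow> c u \<noteq> c v"
proof -
  obtain P where P: "partition_on (verts F) P" "card P = m"
    "edges F = {e \<in> all_pairs (verts F). \<not> (\<exists>A\<in>P. e \<subseteq> A)}"
    using assms(2) unfolding complete_multipartite_def by blast
  have "finite P" using finite_elements[OF finite_simpleD(1)[OF assms(1)] P(1)] .
  then obtain idx where idx: "bij_betw idx P {0..<m}" using ex_bij_betw_finite_nat P(2) by blast
  have "\<exists>A. A \<in> P \<and> v \<in> A" if "v \<in> verts F" for v using P(1) that unfolding partition_on_def by blast
  then obtain part where part: "\<And>v. v \<in> verts F \<Longrightarrow> part v \<in> P \<and> v \<in> part v" by metis
  have uniq: "A = part v" if "A \<in> P" "v \<in> A" "v \<in> verts F" for A v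
    using partition_onD2[OF P(1)] part[OF that(3)] that unfolding disjoint_def by blast
  show ?thesis
  proof (rule that[of "\<lambda>v. idx (part v)"])
    show "(\<lambda>v. idx (part v)) ` verts F \<subseteq> {..<m}"
      using part idx by (auto dest: bij_betwE)
    fix u v assume uv: "u \<in> verts F" "v \<in> verts F"
    have "idx (part u) = idx (part v) \<longleftrightarrow> part u = part v"
      using part uv idx by (metis bij_betw_imp_inj_on inj_on_eq_iff)
    moreover have "part u = part v \<longleftrightarrow> (\<exists>A\<in>P. {u, v} \<subseteq> A)"
      using part uv uniq by (metis empty_subsetI insert_subset)
    ultimately show "{u, v} \<in> edges F \<longleftrightarrow> idx (part u) \<noteq> idx (part v)"
      unfolding P(3) using uv by (auto simp: doubleton_in_all_pairs)
  qed
qed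

text \<open>Each pair costs at least \<open>p - e\<close> less multiples of the indicators of gray
  and nonwhite, and Turan's theorem bounds how often these occur. The subtracted \<open>s\<close>
  makes up for the missing diagonal.\<close>

lemma reduced_graph_cost:
  fixes d cost :: "nat \<Rightarrow> nat \<Rightarrow> real" and p e \<delta> :: real and k l s :: nat
  defines "gray i j \<equiv> i \<noteq> j \<and> 2 * \<delta> \<le> d i j \<and> d i j \<le> 1 - 2 * \<delta>"
    and "nonwhite i j \<equiv> i \<noteq> j \<and> 2 * \<delta> \<le> d i j"
  assumes p: "0 \<le> p" "p \<le> 1" and e: "0 \<le> e" and d: "\<And>i j. d i j = d j i"
    and cost0: "\<And>i j. i < s \<Longrightarrow> j < s \<Longrightarrow> i \<noteq> j \<Longrightarrow> 0 \<le> cost i j"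
    and white: "\<And>i j. i < s \<Longrightarrow> j < s \<Longrightarrow> i \<noteq> j \<Longrightarrow> d i j < 2 * \<delta> \<Longrightarrow> p - e \<le> cost i j"
    and black: "\<And>i j. i < s \<Longrightarrow> j < s \<Longrightarrow> i \<noteq> j \<Longrightarrow> 1 - 2 * \<delta> < d i j \<Longrightarrow> 1 - p - e \<le> cost i j"
    and gray_free: "\<And>K. K \<subseteq> {..<s} \<Longrightarrow> clique_in gray K \<Longrightarrow> card K \<noteq> k + 2"
    and nonwhite_free: "\<And>K. K \<subseteq> {..<s} \<Longrightarrow> clique_in nonwhite K \<Longrightarrow> card K \<noteq> l + 2"
  shows "real s ^ 2 * (min (p / (real k + 1)) ((1 - p) / (real k + 1) + (2 * p - 1) / (real l + 1)) - e) - s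
     \<le> (\<Sum>i<s. \<Sum>j\<in>{..<s} - {i}. cost i j)"
proof -
  have offdiag: "(\<Sum>i<s. \<Sum>j\<in>{..<s} - {i}. of_bool (R i j)) \<le> (1 - 1 / (real n + 1)) * real s ^ 2"
    if "\<And>i j. R i j = R j i" "\<And>i. \<not> R i i" "\<And>K. K \<subseteq> {..<s} \<Longrightarrow> clique_in R K \<Longrightarrow> card K \<noteq> n + 2"
    for R :: "nat \<Rightarrow> nat \<Rightarrow> bool" and n
  proof -
    have "(\<Sum>i<s. \<Sum>j\<in>{..<s} - {i}. of_bool (R i j)) \<le> (\<Sum>i<s. \<Sum>j<s. (of_bool (R i j) :: real))"
      by (intro sum_mono sum_mono2) auto
    also have "\<dots> \<le> (1 - 1 / (real n + 1)) * real (card {..<s}) ^ 2"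
      by (rule turan_ordered[OF that(1,2)]) (use that(3) in auto)
    finally show ?thesis by simp
  qed
  let ?gr = "\<Sum>i<s. \<Sum>j\<in>{..<s} - {i}. (of_bool (gray i j) :: real)"
  let ?nw = "\<Sum>i<s. \<Sum>j\<in>{..<s} - {i}. (of_bool (nonwhite i j) :: real)"
  have gr: "?gr \<le> (1 - 1 / (real k + 1)) * real s ^ 2"
  proof (rule offdiag)
    show "gray i j = gray j i" for i j unfolding gray_def using d[of i j] by auto
    show "\<not> gray i i" for i unfolding gray_def by simp
  qed (rule gray_free)
  have nw: "?nw \<le> (1 - 1 / (real l + 1)) * real s ^ 2"
  proof (rule offdiag)
    show "nonwhite i j = nonwhite j i" for i j unfolding nonwhite_def using d[of i j] by auto
    show "\<not> nonwhite i i" for i unfolding nonwhite_def by simp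
  qed (rule nonwhite_free)
  have const: "real s ^ 2 * (p - e) - s \<le> (\<Sum>i<s. \<Sum>j\<in>{..<s} - {i}. p - e)"
  proof -
    have "(\<Sum>i<s. \<Sum>j\<in>{..<s} - {i}. p - e) = (\<Sum>i<s. (real s - 1) * (p - e))"
      by (intro sum.cong) (auto simp: of_nat_diff)
    also have "\<dots> = real s ^ 2 * (p - e) - real s * (p - e)" by (simp add: power2_eq_square algebra_simps)
    finally have "(\<Sum>i<s. \<Sum>j\<in>{..<s} - {i}. p - e) = real s ^ 2 * (p - e) - real s * (p - e)" .
    moreover have "real s * (p - e) \<le> real s * 1" using p e by (intro mult_left_mono) auto
    ultimately show ?thesis by linarith
  qed
  let ?tot = "\<Sum>i<s. \<Sum>j\<in>{..<s} - {i}. cost i j"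
  show ?thesis
  proof (cases "p \<le> 1 / 2")
    case True
    \<comment> \<open>White and black pairs both cost at least \<open>p - e\<close>, because here
      \<open>1 - p\<close> is at least \<open>p\<close>.\<close>
    have "(\<Sum>i<s. \<Sum>j\<in>{..<s} - {i}. (p - e) - p * of_bool (gray i j)) \<le> ?tot"
    proof (intro sum_mono)
      fix i j assume ij: "i \<in> {..<s}" "j \<in> {..<s} - {i}"
      then show "(p - e) - p * of_bool (gray i j) \<le> cost i j"
        using cost0[of i j] white[of i j] black[of i j] True e by (auto simp: gray_def)
    qed
    then have "(\<Sum>i<s. \<Sum>j\<in>{..<s} - {i}. p - e) - p * ?gr \<le> ?tot"
      by (simp only: sum_subtractf sum_distrib_left)
    moreover have "p * ?gr \<le> p * ((1 - 1 / (real k + 1)) * real s ^ 2)"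
      using gr p by (intro mult_left_mono) auto
    ultimately have "real s ^ 2 * (p - e) - s - p * ((1 - 1 / (real k + 1)) * real s ^ 2) \<le> ?tot"
      using const by linarith
    moreover have "real s ^ 2 * (p - e) - s - p * ((1 - 1 / (real k + 1)) * real s ^ 2)
        = real s ^ 2 * (p / (real k + 1) - e) - s" by (simp add: field_simps)
    moreover have "real s ^ 2 * (min (p / (real k + 1)) ((1 - p) / (real k + 1) + (2 * p - 1) / (real l + 1)) - e)
        \<le> real s ^ 2 * (p / (real k + 1) - e)" by (intro mult_left_mono) auto
    ultimately show ?thesis by linarith
  next
    case False
    \<comment> \<open>The summand on the left is \<open>p - e\<close> on white,
      \<open>1 - p - e\<close> on black and \<open>- e\<close> on gray pairs.\<close>
    have "(\<Sum>i<s. \<Sum>j\<in>{..<s} - {i}. (p - e) - ((2 * p - 1) * of_bool (nonwhite i j) + (1 - p) * of_bool (gray i j))) \<le> ?tot"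
    proof (intro sum_mono)
      fix i j assume ij: "i \<in> {..<s}" "j \<in> {..<s} - {i}"
      then show "(p - e) - ((2 * p - 1) * of_bool (nonwhite i j) + (1 - p) * of_bool (gray i j)) \<le> cost i j"
        using cost0[of i j] white[of i j] black[of i j] e by (auto simp: gray_def nonwhite_def)
    qed
    then have "(\<Sum>i<s. \<Sum>j\<in>{..<s} - {i}. p - e) - ((2 * p - 1) * ?nw + (1 - p) * ?gr) \<le> ?tot"
      by (simp only: sum_subtractf sum_distrib_left sum.distrib)
    moreover have "(2 * p - 1) * ?nw \<le> (2 * p - 1) * ((1 - 1 / (real l + 1)) * real s ^ 2)"
      using nw False by (intro mult_left_mono) auto
    moreover have "(1 - p) * ?gr \<le> (1 - p) * ((1 - 1 / (real k + 1)) * real s ^ 2)"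
      using gr p by (intro mult_left_mono) auto
    ultimately have "real s ^ 2 * (p - e) - s - ((2 * p - 1) * ((1 - 1 / (real l + 1)) * real s ^ 2)
        + (1 - p) * ((1 - 1 / (real k + 1)) * real s ^ 2)) \<le> ?tot"
      using const by linarith
    moreover have "real s ^ 2 * (p - e) - s - ((2 * p - 1) * ((1 - 1 / (real l + 1)) * real s ^ 2)
        + (1 - p) * ((1 - 1 / (real k + 1)) * real s ^ 2))
        = real s ^ 2 * ((1 - p) / (real k + 1) + (2 * p - 1) / (real l + 1) - e) - s"
    proof -
      have "S * (p - e) - t - ((2 * p - 1) * ((1 - b) * S) + (1 - p) * ((1 - a) * S))
          = S * ((1 - p) * a + (2 * p - 1) * b - e) - t" for S t a b :: real
        by (simp add: algebra_simps)
      from this[of "real s ^ 2" s "1 / (real l + 1)" "1 / (real k + 1)"] show ?thesis by simp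
    qed
    moreover have "real s ^ 2 * (min (p / (real k + 1)) ((1 - p) / (real k + 1) + (2 * p - 1) / (real l + 1)) - e)
        \<le> real s ^ 2 * ((1 - p) / (real k + 1) + (2 * p - 1) / (real l + 1) - e)"
      by (intro mult_left_mono) auto
    ultimately show ?thesis by linarith
  qed
qed

lemma cluster_pair_sum:
  assumes "D \<subseteq> all_pairs {..<n}" "s * N \<le> n" "0 < N"
  defines "A i \<equiv> {i * N..<i * N + N}"
  shows "real N ^ 2 * (\<Sum>i<s. \<Sum>j\<in>{..<s} - {i}. dens (\<lambda>x y. of_bool ({x, y} \<in> D)) (A i) (A j)) \<le> 2 * real (card D)"
proof -
  let ?w = "\<lambda>x y. of_bool ({x, y} \<in> D) :: real"
  have "real N ^ 2 * dens ?w (A i) (A j) = (\<Sum>x\<in>A i. \<Sum>y\<in>A j. ?w x y)" for i j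
    using assms(3) by (simp add: dens_def A_def power2_eq_square)
  then have "real N ^ 2 * (\<Sum>i<s. \<Sum>j\<in>{..<s} - {i}. dens ?w (A i) (A j))
      = (\<Sum>i<s. \<Sum>j\<in>{..<s} - {i}. \<Sum>x\<in>A i. \<Sum>y\<in>A j. ?w x y)"
    by (simp add: sum_distrib_left)
  also have "\<dots> \<le> (\<Sum>i<s. \<Sum>j<s. \<Sum>x\<in>A i. \<Sum>y\<in>A j. ?w x y)"
    by (intro sum_mono sum_mono2) (auto intro!: sum_nonneg)
  also have "\<dots> = (\<Sum>i<s. \<Sum>x\<in>A i. \<Sum>j<s. \<Sum>y\<in>A j. ?w x y)"
    by (rule sum.cong[OF refl], rule sum.swap)
  also have "\<dots> = (\<Sum>x<s * N. \<Sum>y<s * N. ?w x y)"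
    unfolding A_def by (simp only: sum.nat_group)
  also have "\<dots> \<le> (\<Sum>x<n. \<Sum>y<s * N. ?w x y)"
    using assms(2) by (intro sum_mono2) (auto intro!: sum_nonneg)
  also have "\<dots> \<le> (\<Sum>x<n. \<Sum>y<n. ?w x y)"
    using assms(2) by (intro sum_mono sum_mono2) auto
  also have "\<dots> = (\<Sum>x<n. \<Sum>y\<in>{..<n} - {x}. ?w x y)"
  proof (rule sum.cong[OF refl], rule sum.mono_neutral_right)
    fix x show "\<forall>y\<in>{..<n} - ({..<n} - {x}). ?w x y = 0"
      using assms(1) by (auto simp: all_pairs_def)
  qed auto
  also have "\<dots> = 2 * real (card D)" using assms(1) by (intro sum_ordered_pairs) auto
  finally show ?thesis .
qed

section \<open>Graphs far from the property\<close>

lemma hereditary_homogeneous_copy: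
  assumes "hereditary \<H>" "G \<in> \<H>" "finite_simple F" "Q \<subseteq> verts G" "card Q = card (verts F)"
    and "\<And>x y u v. x \<in> Q \<Longrightarrow> y \<in> Q \<Longrightarrow> x \<noteq> y \<Longrightarrow> u \<in> verts F \<Longrightarrow> v \<in> verts F \<Longrightarrow> u \<noteq> v \<Longrightarrow>
           {x, y} \<in> edges G \<longleftrightarrow> {u, v} \<in> edges F"
  shows "F \<in> \<H>"
proof -
  have "finite Q"
    using assms(4) finite_simpleD(1)[OF hereditary_finite_simple[OF assms(1,2)]] finite_subset by blast
  then obtain f where f: "bij_betw f (verts F) Q"
    using finite_same_card_bij[OF finite_simpleD(1)[OF assms(3)]] assms(5) by metis
  then have fQ: "f x \<in> Q" if "x \<in> verts F" for x using that by (simp add: bij_betwE)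
  have inj: "inj_on f (verts F)" using f by (rule bij_betw_imp_inj_on)
  show ?thesis
  proof (rule hereditary_induced_copy[OF assms(1-3) inj])
    show "f ` verts F \<subseteq> verts G" using fQ assms(4) by blast
    fix x y assume xy: "x \<in> verts F" "y \<in> verts F" "x \<noteq> y"
    then have "f x \<noteq> f y" using inj by (simp add: inj_on_eq_iff)
    then show "{f x, f y} \<in> edges G \<longleftrightarrow> {x, y} \<in> edges F" using xy fQ by (intro assms(6))
  qed
qed

lemma finite_simple_complete_graph: "finite_simple (complete_graph n)"
  by (simp add: complete_graph_def finite_simple_def)

lemma verts_complete_graph: "verts (complete_graph n) = {..<n}"
  by (simp add: complete_graph_def)

lemma edge_complete_graph: "{x, y} \<in> edges (complete_graph n) \<longleftrightarrow> x < n \<and> y < n \<and> x \<noteq> y"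
  by (simp add: complete_graph_def doubleton_in_all_pairs)

lemma complete_graph_in_property:
  assumes "hereditary \<H>" "G \<in> \<H>" "Q \<subseteq> verts G" "card Q = h"
    and "\<forall>x\<in>Q. \<forall>y\<in>Q. x \<noteq> y \<longrightarrow> {x, y} \<in> edges G"
  shows "complete_graph h \<in> \<H>"
  by (rule hereditary_homogeneous_copy[OF assms(1,2) finite_simple_complete_graph assms(3)])
    (use assms(4,5) in \<open>auto simp: verts_complete_graph edge_complete_graph\<close>)

text \<open>The constants are fixed in the order \<open>\<delta>\<close> and \<open>s\<close>,
  \<open>\<pi>\<close>, \<open>c\<close>, \<open>\<epsilon>1\<close>, \<open>n\<close>, each
  depending on the earlier ones. \<open>F1\<close> forbids \<open>k + 2\<close> pairwise gray
  clusters, \<open>F2\<close> forbids \<open>l + 2\<close> pairwise nonwhite ones.\<close>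

lemma far_graph:
  fixes p \<epsilon> :: real and k l h n0 :: nat
  assumes H: "hereditary \<H>" and K: "complete_graph h \<notin> \<H>"
    and F1: "finite_simple F1" "F1 \<notin> \<H>" "c1 ` verts F1 \<subseteq> {..<k + 2}"
      "\<And>u v. {u, v} \<in> edges F1 \<Longrightarrow> c1 u \<noteq> (c1 v :: nat)"
    and F2: "finite_simple F2" "F2 \<notin> \<H>" "c2 ` verts F2 \<subseteq> {..<l + 2}"
      "\<And>u v. u \<in> verts F2 \<Longrightarrow> v \<in> verts F2 \<Longrightarrow> {u, v} \<in> edges F2 \<longleftrightarrow> c2 u \<noteq> (c2 v :: nat)"
    and p: "0 \<le> p" "p \<le> 1" and \<epsilon>: "0 < \<epsilon>"
  defines "\<beta> \<equiv> min (p / (real k + 1)) ((1 - p) / (real k + 1) + (2 * p - 1) / (real l + 1))"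
  shows "\<exists>n\<ge>n0. \<exists>G. finite_simple G \<and> verts G = {..<n} \<and>
    \<bar>real (card (edges G)) - p * real (n choose 2)\<bar> \<le> \<epsilon> * real n ^ 2 \<and>
    (\<forall>G'\<in>\<H>. verts G' = {..<n} \<longrightarrow> (\<beta> - \<epsilon>) * real n ^ 2 / 2 \<le> edit_dist G G')"
proof -
  \<comment> \<open>The error \<open>\<epsilon> / 2\<close> is made up of six units of at most
    \<open>\<epsilon> / 12\<close>: \<open>2 * \<delta>\<close> for the thresholds of white and
    black, \<open>\<delta>\<close> for the density of \<open>G\<close>, \<open>2 * \<delta>\<close>
    for passing to subclusters, and \<open>1 / s\<close> for the diagonal.\<close>
  define \<delta> where "\<delta> = min (\<epsilon> / 12) (1 / 4)"
  have \<delta>: "0 < \<delta>" "\<delta> \<le> \<epsilon> / 12" "\<delta> \<le> 1 / 4" using \<epsilon> by (auto simp: \<delta>_def)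
  then have \<delta>1: "\<delta> \<le> 1" by simp
  define s where "s = nat \<lceil>12 / \<epsilon>\<rceil> + 1"
  have s0: "0 < s" and "12 / \<epsilon> \<le> s" unfolding s_def by linarith+
  then have s: "1 / real s \<le> \<epsilon> / 12" using \<epsilon> by (simp add: field_simps)
  define M where "M = max (card (verts F1)) (card (verts F2))"
  \<comment> \<open>Small enough for \<open>greedy_embedding\<close> with any number of vertices up
    to \<open>M\<close>.\<close>
  define \<pi> where "\<pi> = \<delta> ^ M / (2 * (real M + 1))"
  have \<pi>0: "0 < \<pi>" using \<delta> by (simp add: \<pi>_def)
  have dM: "\<delta> ^ M \<le> 1" using \<delta> by (intro power_le_one) auto
  have \<pi>1: "\<pi> \<le> 1"
  proof -
    have "\<pi> \<le> 1 / 1" unfolding \<pi>_def using dM \<delta> by (intro frac_le) auto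
    then show ?thesis by simp
  qed
  have \<pi>F: "real f * \<pi> < \<delta> ^ f" if "f \<le> M" for f
  proof -
    have "real f * \<pi> \<le> M * \<pi>" using that \<pi>0 by (intro mult_right_mono) auto
    also have "\<dots> = \<delta> ^ M * (real M / (2 * (real M + 1)))" by (simp add: \<pi>_def)
    also have "\<dots> < \<delta> ^ M * 1" using \<delta> by (intro mult_strict_left_mono) (auto simp: field_simps)
    also have "\<dots> \<le> \<delta> ^ f" using \<delta> that by (simp add: power_decreasing)
    finally show ?thesis .
  qed
  obtain c where c: "0 < c" and tuple: "\<forall>(A0 :: nat \<Rightarrow> nat set) w adj N.
      (\<forall>x y. w x y = w y x \<and> 0 \<le> w x y \<and> w x y \<le> 1) \<longrightarrow>
      (\<forall>x y. adj x y = adj y x \<and> \<not> adj x x) \<longrightarrow>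
      (\<forall>i<s. finite (A0 i) \<and> card (A0 i) = N) \<longrightarrow> 1 \<le> c * real N \<longrightarrow>
      (\<forall>i<s. \<forall>K\<subseteq>A0 i. clique_in adj K \<longrightarrow> card K \<noteq> h) \<longrightarrow>
      refines_to_regular s \<delta> \<pi> \<delta> c w adj A0 N"
    using exists_regular_tuple[where 'a = nat, OF \<delta>(1) \<pi>0 \<pi>1 \<delta>(1) \<delta>1 s0, of h]
    by (elim exE conjE)
  \<comment> \<open>Subclusters have at least \<open>c * n / (2 * s)\<close> vertices, so a
    discrepancy of this size shifts the densities between them by at most
    \<open>\<delta>\<close>.\<close>
  define \<epsilon>1 where "\<epsilon>1 = min \<epsilon> (\<delta> * (c / (2 * real s)) ^ 2)"
  have \<epsilon>1: "0 < \<epsilon>1" "\<epsilon>1 \<le> \<epsilon>" "\<epsilon>1 \<le> \<delta> * (c / (2 * real s)) ^ 2"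
    using \<epsilon> \<delta> c s0 by (auto simp: \<epsilon>1_def)
  \<comment> \<open>\<open>t1\<close> covers the vertices left over when \<open>s\<close> does not
    divide \<open>n\<close>, \<open>t2\<close> gives \<open>1 \<le> c * N\<close>, and
    \<open>t3\<close> covers the loops and the gap between n^2/2 and n choose 2.\<close>
  define t1 where "t1 = nat \<lceil>4 * s / \<epsilon>\<rceil>"
  define t2 where "t2 = nat \<lceil>2 * s / c\<rceil>"
  define t3 where "t3 = nat \<lceil>2 / \<epsilon>\<rceil>"
  define n1 where "n1 = n0 + t1 + 2 * s + t2 + t3"
  obtain n and adj :: "nat \<Rightarrow> nat \<Rightarrow> bool" where n: "n1 \<le> n" and adj: "\<forall>x y. adj x y = adj y x"
    and disc': "\<forall>X\<subseteq>{..<n}. \<forall>Y\<subseteq>{..<n}.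
       \<bar>(\<Sum>x\<in>X. \<Sum>y\<in>Y. of_bool (adj x y)) - p * real (card X) * real (card Y)\<bar> \<le> \<epsilon>1 * real n ^ 2"
    using exists_quasirandom[OF p \<epsilon>1(1), of n1] by (elim exE conjE)
  have disc: "\<And>X Y. X \<subseteq> {..<n} \<Longrightarrow> Y \<subseteq> {..<n} \<Longrightarrow>
       \<bar>(\<Sum>x\<in>X. \<Sum>y\<in>Y. of_bool (adj x y)) - p * real (card X) * real (card Y)\<bar> \<le> \<epsilon>1 * real n ^ 2"
    using disc' by blast
  have "n0 \<le> n" "t1 \<le> n" "2 * s \<le> n" "t2 \<le> n" "t3 \<le> n" using n by (auto simp: n1_def)
  then have n_big: "n0 \<le> n" "4 * s / \<epsilon> \<le> n" "2 * s \<le> n" "2 * s / c \<le> n" "2 / \<epsilon> \<le> n"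
    unfolding t1_def t2_def t3_def by linarith+
  have n0': "0 < n" using n_big(3) s0 by linarith
  define G where "G = UGraph {..<n} {e \<in> all_pairs {..<n}. \<exists>x y. e = {x, y} \<and> adj x y}"
  have edgeG: "{x, y} \<in> edges G \<longleftrightarrow> adj x y" if "x < n" "y < n" "x \<noteq> y" for x y
  proof -
    have "(\<exists>u v. {x, y} = {u, v} \<and> adj u v) \<longleftrightarrow> adj x y"
      using adj[THEN spec, THEN spec, of x y] unfolding doubleton_eq_iff by blast
    then show ?thesis using that by (simp add: G_def doubleton_in_all_pairs)
  qed
  have G: "finite_simple G" by (auto simp: G_def finite_simple_def)
  define N where "N = n div s"
  have sN: "s * N \<le> n" by (simp add: N_def)
  have sN': "real n \<le> real s * real N + real s"
  proof -
    have "n \<le> s * N + s" unfolding N_def using mult_div_mod_eq[of s n] mod_less_divisor[OF s0, of n]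
      by linarith
    then have "real n \<le> real (s * N + s)" by (simp only: of_nat_le_iff)
    then show ?thesis by simp
  qed
  have half: "real n / (2 * real s) \<le> real N"
  proof -
    have "real n \<le> 2 * (real s * real N)" using sN' n_big(3) by linarith
    then show ?thesis using s0 by (simp add: field_simps)
  qed
  have N0: "0 < N" using n_big(3) s0 by (simp add: N_def div_greater_zero_iff)
  have cN: "1 \<le> c * real N"
  proof -
    have "c * (2 * s / c) \<le> c * real n" using n_big(4) c by (intro mult_left_mono) auto
    then have "1 \<le> c * (real n / (2 * real s))" using c s0 by (simp add: field_simps)
    also have "\<dots> \<le> c * real N" using half c by (intro mult_left_mono) auto
    finally show ?thesis .
  qed
  show ?thesis
  proof (intro exI[of _ n] exI[of _ G] conjI ballI impI)
    show "n0 \<le> n" "finite_simple G" "verts G = {..<n}" using n_big(1) G by (auto simp: G_def)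
    show "\<bar>real (card (edges G)) - p * real (n choose 2)\<bar> \<le> \<epsilon> * real n ^ 2"
    proof -
      have e2: "2 * real (card (edges G)) = (\<Sum>x<n. \<Sum>y\<in>{..<n} - {x}. of_bool ({x, y} \<in> edges G))"
        by (rule sum_ordered_pairs[symmetric]) (auto simp: G_def)
      also have "\<dots> = (\<Sum>x<n. \<Sum>y\<in>{..<n} - {x}. of_bool (adj x y))"
        using edgeG by (intro sum.cong) auto
      also have "\<dots> = (\<Sum>x<n. (\<Sum>y<n. of_bool (adj x y)) - of_bool (adj x x))"
        by (intro sum.cong refl) (simp add: sum_diff1 del: sum_of_bool_eq)
      also have "\<dots> = (\<Sum>x<n. \<Sum>y<n. of_bool (adj x y)) - (\<Sum>x<n. of_bool (adj x x))"
        by (simp only: sum_subtractf)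
      finally have 1: "2 * real (card (edges G)) = \<dots>" .
      have "(\<Sum>x<n. (of_bool (adj x x) :: real)) \<le> (\<Sum>x<n. 1)" by (intro sum_mono) auto
      then have 2: "(\<Sum>x<n. (of_bool (adj x x) :: real)) \<le> n" "0 \<le> (\<Sum>x<n. (of_bool (adj x x) :: real))"
        by (auto intro: sum_nonneg)
      have "\<bar>(\<Sum>x<n. \<Sum>y<n. of_bool (adj x y)) - p * real n * real n\<bar> \<le> \<epsilon>1 * real n ^ 2"
        using disc[of "{..<n}" "{..<n}"] by simp
      moreover have "p * real n * real n - 2 * (p * real (n choose 2)) = p * real n"
        by (simp add: choose_two_real field_simps)
      moreover have "0 \<le> p * real n" "p * real n \<le> 1 * real n" using p by (auto simp: mult_left_le_one_le)
      moreover have "\<epsilon>1 * real n ^ 2 \<le> \<epsilon> * real n ^ 2" using \<epsilon>1 by (intro mult_right_mono) auto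
      moreover have "2 * real n \<le> \<epsilon> * real n ^ 2"
      proof -
        have "2 \<le> \<epsilon> * real n" using n_big(5) \<epsilon> by (simp add: field_simps)
        from mult_right_mono[OF this, of "real n"] show ?thesis by (simp add: power2_eq_square mult_ac)
      qed
      ultimately show ?thesis using 1 2 by linarith
    qed
  next
    fix G' assume G': "G' \<in> \<H>" "verts G' = {..<n}"
    have fsG': "finite_simple G'" using hereditary_finite_simple[OF H G'(1)] .
    define D where "D = (edges G - edges G') \<union> (edges G' - edges G)"
    have D: "D \<subseteq> all_pairs {..<n}"
      using finite_simpleD(2)[OF fsG'] finite_simpleD(2)[OF G] G'(2) by (auto simp: D_def G_def)
    define w where "w x y = (of_bool ({x, y} \<in> D) :: real)" for x y
    define a where "a x y \<longleftrightarrow> {x, y} \<in> edges G'" for x y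
    define A0 where "A0 i = {i * N..<i * N + N}" for i
    have A0n: "A0 i \<subseteq> {..<n}" if "i < s" for i
    proof -
      have "i * N + N = Suc i * N" by simp
      also have "\<dots> \<le> s * N" using that by (intro mult_le_mono1) simp
      finally show ?thesis using sN by (auto simp: A0_def)
    qed
    have A0disj: "A0 i \<inter> A0 j = {}" if "i \<noteq> j" for i j
    proof -
      have "x div N = i" if "x \<in> A0 i" for x i
        using that N0 by (auto simp: A0_def intro!: div_nat_eqI simp: mult.commute)
      then show ?thesis using that by blast
    qed
    have free: "card Q \<noteq> h" if "i < s" "Q \<subseteq> A0 i" "clique_in a Q" for i Q
      using complete_graph_in_property[OF H G'(1), of Q h] that A0n G'(2) K
      unfolding clique_in_def a_def by blast
    have "refines_to_regular s \<delta> \<pi> \<delta> c w a A0 N"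
    proof (rule tuple[THEN spec, THEN spec, THEN spec, THEN spec, THEN mp, THEN mp, THEN mp, THEN mp, THEN mp, OF _ _ _ cN])
      show "\<forall>x y. w x y = w y x \<and> 0 \<le> w x y \<and> w x y \<le> 1" by (simp add: w_def insert_commute)
      show "\<forall>x y. a x y = a y x \<and> \<not> a x x"
        using finite_simpleD(2)[OF fsG'] by (auto simp: a_def insert_commute all_pairs_def)
      show "\<forall>i<s. finite (A0 i) \<and> card (A0 i) = N" by (simp add: A0_def)
      show "\<forall>i<s. \<forall>Q\<subseteq>A0 i. clique_in a Q \<longrightarrow> card Q \<noteq> h" using free by blast
    qed
    then obtain C where C: "\<And>i. i < s \<Longrightarrow> C i \<subseteq> A0 i" "\<And>i. i < s \<Longrightarrow> c * N \<le> card (C i)"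
      and cost: "(\<Sum>i<s. \<Sum>j\<in>{..<s} - {i}. dens w (C i) (C j))
           \<le> (\<Sum>i<s. \<Sum>j\<in>{..<s} - {i}. dens w (A0 i) (A0 j)) + 2 * \<delta> * real s ^ 2"
      and regular: "regular_tuple s \<delta> \<pi> a C" unfolding refines_to_regular_def by blast
    have Cfin: "finite (C i) \<and> C i \<noteq> {} \<and> C i \<subseteq> {..<n}" if i: "i < s" for i
    proof -
      have "0 < card (C i)" using C(2)[OF i] cN by linarith
      then show ?thesis using C(1)[OF i] A0n[OF i] by (auto simp: card_gt_0_iff)
    qed
    have Cdisj: "C i \<inter> C j = {}" if "i < s" "j < s" "i \<noteq> j" for i j
      using C(1) A0disj that by blast
    define d where "d i j = dens (\<lambda>x y. of_bool (a x y)) (C i) (C j)" for i j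
    have embed: "F \<in> \<H>"
      if F: "finite_simple F" "card (verts F) \<le> M" and \<kappa>: "\<And>u. u \<in> verts F \<Longrightarrow> \<kappa> u < s"
        "\<And>u v. {u, v} \<in> edges F \<Longrightarrow> \<kappa> u \<noteq> \<kappa> v"
        "\<And>u v. {u, v} \<in> edges F \<Longrightarrow> 2 * \<delta> \<le> d (\<kappa> u) (\<kappa> v)"
        "\<And>u v. u \<in> verts F \<Longrightarrow> v \<in> verts F \<Longrightarrow> \<kappa> u \<noteq> \<kappa> v \<Longrightarrow> {u, v} \<notin> edges F \<Longrightarrow>
           d (\<kappa> u) (\<kappa> v) \<le> 1 - 2 * \<delta>" for F \<kappa>
    proof (rule cluster_embedding[OF H G'(1) F(1) \<delta>(1) _ \<pi>0 \<pi>F[OF F(2)], where C = C and s = s and \<kappa> = \<kappa>])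
      show "\<delta> \<le> 1 / 2" using \<delta> by simp
      show "finite (C i) \<and> C i \<noteq> {} \<and> C i \<subseteq> verts G'" if "i < s" for i using Cfin[OF that] G'(2) by simp
      show "regular_tuple s \<delta> \<pi> (\<lambda>x y. {x, y} \<in> edges G') C"
        using regular unfolding a_def[abs_def] .
    qed (use Cdisj \<kappa> in \<open>auto simp: a_def d_def\<close>)
    have cost_lower: "\<bar>dens (\<lambda>x y. of_bool (adj x y)) (C i) (C j) - d i j\<bar> \<le> dens w (C i) (C j)"
      if ij: "i < s" "j < s" "i \<noteq> j" for i j
    proof -
      let ?P = "real (card (C i)) * real (card (C j))"
      have P: "0 < ?P" using Cfin ij by (simp add: card_gt_0_iff)
      have "\<bar>(\<Sum>x\<in>C i. \<Sum>y\<in>C j. of_bool (adj x y)) - (\<Sum>x\<in>C i. \<Sum>y\<in>C j. of_bool (a x y))\<bar>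
          = \<bar>\<Sum>x\<in>C i. \<Sum>y\<in>C j. (of_bool (adj x y) - of_bool (a x y) :: real)\<bar>"
        by (simp only: sum_subtractf)
      also have "\<dots> \<le> (\<Sum>x\<in>C i. \<bar>\<Sum>y\<in>C j. (of_bool (adj x y) - of_bool (a x y) :: real)\<bar>)"
        by (rule sum_abs)
      also have "\<dots> \<le> (\<Sum>x\<in>C i. \<Sum>y\<in>C j. \<bar>of_bool (adj x y) - of_bool (a x y)\<bar>)"
        by (intro sum_mono sum_abs)
      also have "\<dots> \<le> (\<Sum>x\<in>C i. \<Sum>y\<in>C j. w x y)"
      proof (intro sum_mono)
        fix x y assume "x \<in> C i" "y \<in> C j"
        then have "x < n" "y < n" "x \<noteq> y" using Cfin Cdisj[OF ij] ij by blast+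
        then have "{x, y} \<in> edges G \<longleftrightarrow> adj x y" by (rule edgeG)
        then show "\<bar>of_bool (adj x y) - of_bool (a x y)\<bar> \<le> w x y" by (auto simp: w_def D_def a_def)
      qed
      finally have "\<bar>(\<Sum>x\<in>C i. \<Sum>y\<in>C j. of_bool (adj x y)) - (\<Sum>x\<in>C i. \<Sum>y\<in>C j. of_bool (a x y))\<bar> / ?P
          \<le> (\<Sum>x\<in>C i. \<Sum>y\<in>C j. w x y) / ?P" using P by (intro divide_right_mono) auto
      moreover have "\<bar>S / ?P - T / ?P\<bar> = \<bar>S - T\<bar> / ?P" for S T
        using P by (simp only: diff_divide_distrib[symmetric] abs_divide abs_of_pos)
      ultimately show ?thesis unfolding d_def dens_def by simp
    qed
    have adj_dens: "\<bar>dens (\<lambda>x y. of_bool (adj x y)) (C i) (C j) - p\<bar> \<le> \<delta>"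
      if ij: "i < s" "j < s" for i j
    proof -
      let ?P = "real (card (C i)) * real (card (C j))"
      have P: "0 < ?P" using Cfin ij by (simp add: card_gt_0_iff)
      let ?S = "\<Sum>x\<in>C i. \<Sum>y\<in>C j. (of_bool (adj x y) :: real)"
      have *: "c / (2 * real s) * real n \<le> card (C i)" if "i < s" for i
      proof -
        have "c / (2 * real s) * real n = c * (real n / (2 * real s))" by simp
        also have "\<dots> \<le> c * N" using half c by (intro mult_left_mono) auto
        finally show ?thesis using C(2)[OF that] by linarith
      qed
      have "\<bar>?S - p * real (card (C i)) * real (card (C j))\<bar> \<le> \<epsilon>1 * real n ^ 2"
        using disc[of "C i" "C j"] Cfin ij by blast
      also have "\<dots> \<le> \<delta> * (c / (2 * real s)) ^ 2 * real n ^ 2" using \<epsilon>1 by (intro mult_right_mono) auto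
      also have "\<dots> = \<delta> * ((c / (2 * real s) * real n) * (c / (2 * real s) * real n))"
        by (simp add: power2_eq_square)
      also have "\<dots> \<le> \<delta> * ?P"
        using *[OF ij(1)] *[OF ij(2)] \<delta> c by (intro mult_left_mono mult_mono) auto
      finally have "\<bar>?S - p * ?P\<bar> / ?P \<le> \<delta>" using P by (simp only: pos_divide_le_eq mult.assoc)
      moreover have "\<bar>?S / ?P - p\<bar> = \<bar>?S - p * ?P\<bar> / ?P"
      proof -
        have "S / P - p = (S - p * P) / P" if "0 < P" for S P :: real
          using that by (simp add: diff_divide_distrib)
        from this[OF P] have "?S / ?P - p = (?S - p * ?P) / ?P" .
        then show ?thesis using P by (simp only: abs_divide abs_of_pos)
      qed
      ultimately show ?thesis unfolding dens_def by linarith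
    qed
    have place: "\<exists>\<beta>. bij_betw \<beta> {..<q} Q" if "Q \<subseteq> {..<s}" "card Q = q" for Q and q :: nat
      using ex_bij_betw_nat_finite[of Q] that finite_subset[OF that(1)] by (simp add: atLeast0LessThan)
    \<comment> \<open>Colour class \<open>a\<close> of \<open>F\<close> goes to the cluster
      \<open>b a\<close> of the clique. In a gray clique the upper bound on the densities always
      holds. For a complete multipartite \<open>F\<close> it concerns no pair at all, which is how
      black pairs are allowed.\<close>
    have no_clique: "card Q \<noteq> q"
      if F: "finite_simple F" "F \<notin> \<H>" "f ` verts F \<subseteq> {..<q}"
          "\<And>u v. {u, v} \<in> edges F \<Longrightarrow> f u \<noteq> f v" "card (verts F) \<le> M"
        and Q: "Q \<subseteq> {..<s}" "\<And>i j. i \<in> Q \<Longrightarrow> j \<in> Q \<Longrightarrow> i \<noteq> j \<Longrightarrow> 2 * \<delta> \<le> d i j"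
          "\<And>i j u v. i \<in> Q \<Longrightarrow> j \<in> Q \<Longrightarrow> i \<noteq> j \<Longrightarrow> u \<in> verts F \<Longrightarrow> v \<in> verts F \<Longrightarrow>
             f u \<noteq> f v \<Longrightarrow> {u, v} \<notin> edges F \<Longrightarrow> d i j \<le> 1 - 2 * \<delta>"
      for F Q q and f :: "nat \<Rightarrow> nat"
    proof
      assume "card Q = q"
      then obtain b where b: "bij_betw b {..<q} Q" using place Q(1) by blast
      have bQ: "b (f u) \<in> Q" if "u \<in> verts F" for u using b F(3) that by (auto simp: bij_betw_def)
      have bf: "b (f u) = b (f v) \<longleftrightarrow> f u = f v" if "u \<in> verts F" "v \<in> verts F" for u v
      proof -
        have "f u \<in> {..<q}" "f v \<in> {..<q}" using F(3) that by blast+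
        then show ?thesis using inj_on_eq_iff[OF bij_betw_imp_inj_on[OF b]] by blast
      qed
      have proper: "b (f u) \<noteq> b (f v)" if "{u, v} \<in> edges F" for u v
        using bf F(4)[OF that] finite_simple_edge_distinct[OF F(1) that] by blast
      have "F \<in> \<H>"
      proof (rule embed[OF F(1,5), where \<kappa> = "\<lambda>u. b (f u)"])
        show "b (f u) < s" if "u \<in> verts F" for u using bQ[OF that] Q(1) by blast
        show "b (f u) \<noteq> b (f v)" if "{u, v} \<in> edges F" for u v using proper[OF that] .
        show "2 * \<delta> \<le> d (b (f u)) (b (f v))" if "{u, v} \<in> edges F" for u v
          using Q(2) bQ proper[OF that] finite_simple_edge_distinct[OF F(1) that] by blast
        show "d (b (f u)) (b (f v)) \<le> 1 - 2 * \<delta>"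
          if "u \<in> verts F" "v \<in> verts F" "b (f u) \<noteq> b (f v)" "{u, v} \<notin> edges F" for u v
          using Q(3)[of "b (f u)" "b (f v)" u v] bQ bf that by blast
      qed
      then show False using F(2) by blast
    qed
    have "real s ^ 2 * (\<beta> - 3 * \<delta>) - s \<le> (\<Sum>i<s. \<Sum>j\<in>{..<s} - {i}. dens w (C i) (C j))"
      unfolding \<beta>_def
    proof (rule reduced_graph_cost[where d = d and \<delta> = \<delta>])
      show "0 \<le> p" "p \<le> 1" "0 \<le> 3 * \<delta>" using p \<delta> by auto
      show "d i j = d j i" for i j
        unfolding d_def by (rule dens_commute) (simp add: a_def insert_commute)
      fix i j assume ij: "i < s" "j < s" "i \<noteq> j"
      show "0 \<le> dens w (C i) (C j)" by (rule dens_nonneg) (simp add: w_def)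
      show "p - 3 * \<delta> \<le> dens w (C i) (C j)" if "d i j < 2 * \<delta>"
        using cost_lower[OF ij] adj_dens[OF ij(1,2)] that by linarith
      show "1 - p - 3 * \<delta> \<le> dens w (C i) (C j)" if "1 - 2 * \<delta> < d i j"
        using cost_lower[OF ij] adj_dens[OF ij(1,2)] that by linarith
    next
      fix Q assume Q: "Q \<subseteq> {..<s}" "clique_in (\<lambda>i j. i \<noteq> j \<and> 2 * \<delta> \<le> d i j \<and> d i j \<le> 1 - 2 * \<delta>) Q"
      show "card Q \<noteq> k + 2"
        by (rule no_clique[OF F1 _ Q(1)]) (use Q(2) in \<open>auto simp: M_def clique_in_def\<close>)
    next
      fix Q assume Q: "Q \<subseteq> {..<s}" "clique_in (\<lambda>i j. i \<noteq> j \<and> 2 * \<delta> \<le> d i j) Q"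
      have "c2 u \<noteq> c2 v" if "{u, v} \<in> edges F2" for u v
        using F2(4) finite_simple_edge_distinct[OF F2(1) that] that by blast
      then show "card Q \<noteq> l + 2"
        by (rule no_clique[OF F2(1-3) _ _ Q(1)]) (use Q(2) F2(4) in \<open>auto simp: M_def clique_in_def\<close>)
    qed
    then have "real s ^ 2 * (\<beta> - 3 * \<delta>) - s - 2 * \<delta> * real s ^ 2
        \<le> (\<Sum>i<s. \<Sum>j\<in>{..<s} - {i}. dens w (A0 i) (A0 j))" using cost by linarith
    moreover have "real s ^ 2 * (\<beta> - \<epsilon> / 2) \<le> real s ^ 2 * (\<beta> - 3 * \<delta>) - s - 2 * \<delta> * real s ^ 2"
    proof -
      have "real s ^ 2 * (1 / real s) = s" using s0 by (simp add: power2_eq_square)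
      then have "real s ^ 2 * (\<beta> - 3 * \<delta>) - s - 2 * \<delta> * real s ^ 2 = real s ^ 2 * (\<beta> - 5 * \<delta> - 1 / s)"
        by (simp add: algebra_simps)
      moreover have "\<beta> - \<epsilon> / 2 \<le> \<beta> - 5 * \<delta> - 1 / s" using \<delta>(2) s by linarith
      ultimately show ?thesis by (simp add: mult_left_mono)
    qed
    ultimately have "real N ^ 2 * (real s ^ 2 * (\<beta> - \<epsilon> / 2))
       \<le> real N ^ 2 * (\<Sum>i<s. \<Sum>j\<in>{..<s} - {i}. dens w (A0 i) (A0 j))"
      by (intro mult_left_mono) auto
    also have "\<dots> \<le> 2 * real (card D)"
      using cluster_pair_sum[OF D sN N0] unfolding w_def A0_def .
    finally have main: "(real s * real N) ^ 2 * (\<beta> - \<epsilon> / 2) \<le> 2 * real (card D)"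
      by (simp add: power_mult_distrib mult_ac)
    have D_edit: "card D = edit_dist G G'" by (simp add: D_def edit_dist_def)
    have "(\<beta> - \<epsilon>) * real n ^ 2 \<le> 2 * real (card D)"
    \<comment> \<open>The comparison of \<open>s * N\<close> with \<open>n\<close> is multiplied by
      this factor, so its sign matters; for a nonpositive factor the claim is trivial.\<close>
    proof (cases "\<beta> - \<epsilon> / 2 \<le> 0")
      case True
      then have "(\<beta> - \<epsilon>) * real n ^ 2 \<le> 0" using \<epsilon> by (intro mult_nonpos_nonneg) auto
      then show ?thesis by linarith
    next
      case False
      have \<beta>1: "\<beta> \<le> 1"
      proof -
        have "p / (real k + 1) \<le> 1" using p by (simp add: divide_le_eq_1)
        then show ?thesis unfolding \<beta>_def by linarith
      qed
      have sq: "real n ^ 2 - 2 * real n * s \<le> (real s * real N) ^ 2"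
      proof -
        have "real n - s \<le> real s * real N" "0 \<le> real n - s" using sN' n_big(3) by linarith+
        then have "(real n - s) ^ 2 \<le> (real s * real N) ^ 2" by (intro power_mono)
        moreover have "(real n - s) ^ 2 = real n ^ 2 - 2 * real n * s + real s ^ 2"
          by (simp add: power2_diff)
        ultimately show ?thesis using zero_le_power2[of "real s"] by linarith
      qed
      have "(\<beta> - \<epsilon> / 2) * (2 * real n * s) \<le> 1 * (2 * real n * s)"
        using \<beta>1 \<epsilon> by (intro mult_right_mono) auto
      also have "\<dots> \<le> \<epsilon> / 2 * real n ^ 2"
      proof -
        have "4 * real s \<le> \<epsilon> * n" using n_big(2) \<epsilon> by (simp add: field_simps)
        from mult_right_mono[OF this, of "real n"] show ?thesis by (simp add: power2_eq_square mult_ac)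
      qed
      finally have "(\<beta> - \<epsilon>) * real n ^ 2 \<le> (\<beta> - \<epsilon> / 2) * (real n ^ 2 - 2 * real n * s)"
        by (simp add: algebra_simps)
      also have "\<dots> \<le> (\<beta> - \<epsilon> / 2) * (real s * real N) ^ 2"
        using sq False by (intro mult_left_mono) auto
      also have "\<dots> \<le> 2 * real (card D)" using main by (simp add: mult.commute)
      finally show ?thesis .
    qed
    then show "(\<beta> - \<epsilon>) * real n ^ 2 / 2 \<le> edit_dist G G'" using D_edit by simp
  qed
qed

text \<open>A smaller limit would bound all late terms, so a single large \<open>n\<close> from
  \<open>far_graph\<close> contradicts it.\<close>

lemma edit_distance_function_lower:
  fixes p :: real and k l h :: nat
  assumes H: "hereditary \<H>" "nontrivial \<H>" and K: "complete_graph h \<notin> \<H>"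
    and F1: "F1 \<in> forbidden_graphs \<H>" "chromatic_number F1 = k + 2"
    and F2: "F2 \<in> forbidden_graphs \<H>" "complete_multipartite (l + 2) F2"
    and p: "0 \<le> p" "p \<le> 1"
  shows "min (p / (real k + 1)) ((1 - p) / (real k + 1) + (2 * p - 1) / (real l + 1))
     \<le> edit_distance_function \<H> p" (is "?\<beta> \<le> ?L")
proof (rule ccontr)
  assume "\<not> ?\<beta> \<le> ?L"
  moreover have "\<exists>\<epsilon>>0. z + 8 * \<epsilon> = b" if "\<not> b \<le> z" for b z :: real
    using that by (intro exI[of _ "b / 8 - z / 8"]) simp
  \<comment> \<open>Measured against \<open>n^2 / 2\<close>, \<open>far_graph\<close> loses one of
    the eight units and the correction of the number of edges four; the remaining three exceed the
    one that the limit permits.\<close>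
  ultimately obtain \<epsilon> where \<epsilon>: "0 < \<epsilon>" "?L + 8 * \<epsilon> = ?\<beta>" by blast
  let ?a = "\<lambda>n. real (max_dist \<H> p n) / real (n choose 2)"
  have "\<forall>\<^sub>F n in sequentially. ?a n < ?L + \<epsilon>"
    using order_tendstoD(2)[OF edit_distance_function_tendsto[OF H p]] \<epsilon>(1) by simp
  then obtain n0 where n0: "\<And>n. n0 \<le> n \<Longrightarrow> ?a n < ?L + \<epsilon>"
    unfolding eventually_sequentially by blast
  \<comment> \<open>The factor must be nonnegative when \<open>n^2 / 2\<close> is replaced by the
    smaller n choose 2.\<close>
  have L0: "0 \<le> ?L"
    by (rule LIMSEQ_le_const[OF edit_distance_function_tendsto[OF H p]]) auto
  obtain c1 where c1: "c1 ` verts F1 \<subseteq> {..<k + 2}" "\<And>u v. {u, v} \<in> edges F1 \<Longrightarrow> c1 u \<noteq> c1 v"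
    using chromatic_colouring[OF forbidden_graphs_finite_simple[OF F1(1)]] F1(2) by metis
  obtain c2 where c2: "c2 ` verts F2 \<subseteq> {..<l + 2}"
    "\<And>u v. u \<in> verts F2 \<Longrightarrow> v \<in> verts F2 \<Longrightarrow> {u, v} \<in> edges F2 \<longleftrightarrow> c2 u \<noteq> c2 v"
    using complete_multipartite_colouring[OF forbidden_graphs_finite_simple[OF F2(1)] F2(2)] by metis
  have "\<exists>n\<ge>n0 + 2 + nat \<lceil>1 / \<epsilon>\<rceil>. \<exists>G. finite_simple G \<and> verts G = {..<n} \<and>
    \<bar>real (card (edges G)) - p * real (n choose 2)\<bar> \<le> \<epsilon> * real n ^ 2 \<and>
    (\<forall>G'\<in>\<H>. verts G' = {..<n} \<longrightarrow> (?\<beta> - \<epsilon>) * real n ^ 2 / 2 \<le> edit_dist G G')"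
    by (rule far_graph[OF H(1) K forbidden_graphs_finite_simple[OF F1(1)] forbidden_graphs_notin[OF F1(1)] c1(1) _
        forbidden_graphs_finite_simple[OF F2(1)] forbidden_graphs_notin[OF F2(1)] c2(1) _ p \<epsilon>(1)])
      (fact c1(2) c2(2))+
  then obtain n G where n: "n0 + 2 + nat \<lceil>1 / \<epsilon>\<rceil> \<le> n" and G: "finite_simple G" "verts G = {..<n}"
    and edges: "\<bar>real (card (edges G)) - p * real (n choose 2)\<bar> \<le> \<epsilon> * real n ^ 2"
    and far: "\<forall>G'\<in>\<H>. verts G' = {..<n} \<longrightarrow> (?\<beta> - \<epsilon>) * real n ^ 2 / 2 \<le> edit_dist G G'"
    by (elim exE conjE)
  obtain G' where "G' \<in> \<H>" "verts G' = verts G" "dist_to_property G \<H> = edit_dist G G'"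
    using dist_to_property_attained[OF H G(1)] .
  then have d: "(?\<beta> - \<epsilon>) * real n ^ 2 / 2 \<le> real (dist_to_property G \<H>)" using far G(2) by simp
  have "real (dist_to_property G \<H>) - \<bar>real (card (edges G)) - real (edge_target p n)\<bar> \<le> real (max_dist \<H> p n)"
    by (rule max_dist_ge[OF H p G(1)]) (simp add: G(2))
  moreover have "\<bar>real (card (edges G)) - real (edge_target p n)\<bar> \<le> \<epsilon> * real n ^ 2 + 1"
    using edges edge_target_bounds(3,4)[OF p, of n] by linarith
  moreover have "1 \<le> \<epsilon> * real n ^ 2"
  proof -
    have "1 / \<epsilon> \<le> n" "1 \<le> real n" using n by linarith+
    then have "1 \<le> \<epsilon> * n" using \<epsilon>(1) by (simp add: field_simps)
    also have "\<dots> \<le> \<epsilon> * real n ^ 2" using \<epsilon>(1) \<open>1 \<le> real n\<close> by (simp add: power2_eq_square)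
    finally show ?thesis .
  qed
  moreover have "(?\<beta> - \<epsilon>) * real n ^ 2 / 2 = (?L + 3 * \<epsilon>) * (real n ^ 2 / 2) + 2 * (\<epsilon> * real n ^ 2)"
  proof -
    have "(b - \<epsilon>) * x / 2 = (z + 3 * \<epsilon>) * (x / 2) + 2 * (\<epsilon> * x)" if "z + 8 * \<epsilon> = b" for b x z
      using that by (auto simp: algebra_simps)
    from this[OF \<epsilon>(2)] show ?thesis .
  qed
  ultimately have low: "(?L + 3 * \<epsilon>) * (real n ^ 2 / 2) \<le> real (max_dist \<H> p n)" using d by linarith
  have C: "0 < real (n choose 2)" "real (n choose 2) \<le> real n ^ 2 / 2"
    using n by (auto simp: choose_two_real power2_eq_square)
  have "(?L + 3 * \<epsilon>) * real (n choose 2) \<le> (?L + 3 * \<epsilon>) * (real n ^ 2 / 2)"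
    using C L0 \<epsilon>(1) by (intro mult_left_mono) auto
  then have "?L + 3 * \<epsilon> \<le> ?a n" using low C(1) by (simp add: pos_le_divide_eq)
  then show False using n0[of n] n \<epsilon>(1) by simp
qed

lemma edit_distance_function_upper:
  fixes p :: real and k l :: nat
  assumes H: "hereditary \<H>" "nontrivial \<H>" and k: "0 < k" "k < property_chromatic_number \<H>"
    and l: "0 < l" "\<And>j F. 0 < j \<Longrightarrow> j \<le> l \<Longrightarrow> F \<in> forbidden_graphs \<H> \<Longrightarrow> \<not> complete_multipartite j F"
    and p: "0 \<le> p" "p \<le> 1"
  shows "edit_distance_function \<H> p \<le> min (p / k) (1 - p + (2 * p - 1) / l)"
proof -
  let ?a = "\<lambda>n. real (max_dist \<H> p n) / real (n choose 2)" and ?C = "\<lambda>n. real (n choose 2)"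
  note lim = edit_distance_function_tendsto[OF H p]
  have C: "0 < ?C n" if "2 \<le> n" for n using that by simp
  have "edit_distance_function \<H> p \<le> p / k"
  proof (rule LIMSEQ_le_const2[OF lim], intro exI[of _ 2] allI impI)
    fix n :: nat assume "2 \<le> n"
    then show "?a n \<le> p / k"
      using max_dist_upper_chromatic[OF H p k, of n] C[of n] by (simp only: pos_divide_le_eq)
  qed
  moreover have "edit_distance_function \<H> p \<le> 1 - p + (2 * p - 1) / l"
  proof (rule LIMSEQ_le[OF lim])
    have "(\<lambda>n. 1 / real n ^ 2) \<longlonglongrightarrow> 0"
      using tendsto_power[OF lim_1_over_n, of 2] by (simp add: power_one_over)
    then have "(\<lambda>n. 1 / real n ^ 2 / (?C n / real n ^ 2)) \<longlonglongrightarrow> 0 / (1 / 2)"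
      by (intro tendsto_divide choose_two_asymp) auto
    then have "(\<lambda>n. 1 - p + (2 * p - 1) / l + 1 / real n ^ 2 / (?C n / real n ^ 2)) \<longlonglongrightarrow> 1 - p + (2 * p - 1) / l + 0 / (1 / 2)"
      by (intro tendsto_add tendsto_const)
    then show "(\<lambda>n. 1 - p + (2 * p - 1) / l + 1 / real n ^ 2 / (?C n / real n ^ 2)) \<longlonglongrightarrow> 1 - p + (2 * p - 1) / l"
      by simp
    show "\<exists>N. \<forall>n\<ge>N. ?a n \<le> 1 - p + (2 * p - 1) / l + 1 / real n ^ 2 / (?C n / real n ^ 2)"
    proof (intro exI[of _ 2] allI impI)
      fix n :: nat assume n: "2 \<le> n"
      have "?a n \<le> ((1 - p + (2 * p - 1) / l) * ?C n + 1) / ?C n"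
        using max_dist_upper_multipartite[OF H p l, of n] by (intro divide_right_mono) auto
      also have "\<dots> = 1 - p + (2 * p - 1) / l + 1 / ?C n"
        using C[OF n] by (simp only: add_divide_distrib) simp
      also have "1 / ?C n = 1 / real n ^ 2 / (?C n / real n ^ 2)" using n by simp
      finally show "?a n \<le> 1 - p + (2 * p - 1) / l + 1 / real n ^ 2 / (?C n / real n ^ 2)" .
    qed
  qed
  ultimately show ?thesis by simp
qed

section \<open>Comparison of the parameters\<close>

lemma property_chromatic_number_attained:
  assumes "forbidden_graphs \<H> \<noteq> {}"
  obtains F where "F \<in> forbidden_graphs \<H>" "chromatic_number F = property_chromatic_number \<H>"
  using Inf_nat_def1[of "chromatic_number ` forbidden_graphs \<H>"] assms that
  unfolding property_chromatic_number_def by force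

text \<open>A forbidden graph of chromatic number at most 1 has no edges. By Ramsey's theorem a
  large member contains a clique on \<open>h\<close> vertices or an independent set as large as that
  graph, both impossible. It follows that the denominators in the bounds are positive.\<close>

lemma property_chromatic_number_ge_2:
  assumes H: "hereditary \<H>" "nontrivial \<H>" and K: "complete_graph h \<notin> \<H>" "forbidden_graphs \<H> \<noteq> {}"
  shows "2 \<le> property_chromatic_number \<H>"
proof (rule ccontr)
  assume "\<not> ?thesis"
  then obtain F where F: "F \<in> forbidden_graphs \<H>" "chromatic_number F \<le> 1"
    using property_chromatic_number_attained[OF K(2)] by (metis One_nat_def not_less_eq_eq numeral_2_eq_2)
  note fs = forbidden_graphs_finite_simple[OF F(1)]
  obtain c where c: "c ` verts F \<subseteq> {..<chromatic_number F}" "\<And>u v. {u, v} \<in> edges F \<Longrightarrow> c u \<noteq> c v"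
    using chromatic_colouring[OF fs] by blast
  have no_edge: "{u, v} \<notin> edges F" if "u \<in> verts F" "v \<in> verts F" for u v
  proof -
    have "c u < chromatic_number F" "c v < chromatic_number F" using c(1) that by blast+
    then have "c u = c v" using F(2) by linarith
    then show ?thesis using c(2) by blast
  qed
  obtain r where r: "\<forall>(V :: nat set) E. finite V \<and> r \<le> card V \<longrightarrow>
      (\<exists>R\<subseteq>V. card R = h \<and> clique R E \<or> card R = card (verts F) \<and> indep R E)"
    using ramsey2[where 'a = nat, of h "card (verts F)"] by (elim exE conjE)
  obtain G where G: "G \<in> \<H>" "r \<le> card (verts G)" using H(2) unfolding nontrivial_def by blast
  have "finite (verts G)" using finite_simpleD(1)[OF hereditary_finite_simple[OF H(1) G(1)]] .
  with G(2) r[THEN spec, THEN spec, of "verts G" "edges G"]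
  have "\<exists>R\<subseteq>verts G. card R = h \<and> clique R (edges G) \<or> card R = card (verts F) \<and> indep R (edges G)"
    by (elim mp) simp
  then obtain R where R: "R \<subseteq> verts G"
    "card R = h \<and> clique R (edges G) \<or> card R = card (verts F) \<and> indep R (edges G)" by (elim exE conjE)
  from R(2) show False
  proof
    assume "card R = h \<and> clique R (edges G)"
    then have "complete_graph h \<in> \<H>"
      using complete_graph_in_property[OF H(1) G(1) R(1)] unfolding clique_def by blast
    then show False using K(1) by blast
  next
    assume "card R = card (verts F) \<and> indep R (edges G)"
    then have "card R = card (verts F)" and indep: "\<And>x y. x \<in> R \<Longrightarrow> y \<in> R \<Longrightarrow> x \<noteq> y \<Longrightarrow> {x, y} \<notin> edges G"
      unfolding indep_def by blast+
    then have "F \<in> \<H>"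
      using no_edge by (intro hereditary_homogeneous_copy[OF H(1) G(1) fs R(1)]) blast+
    then show False using forbidden_graphs_notin[OF F(1)] by blast
  qed
qed

section \<open>Properties given by one forbidden graph\<close>

lemma graph_iso_refl: "graph_iso G G"
  unfolding graph_iso_def by (intro exI[of _ "\<lambda>x. x"]) (simp add: bij_betw_def)

lemma graph_iso_trans:
  assumes "graph_iso G1 G2" "graph_iso G2 G3"
  shows "graph_iso G1 G3"
proof -
  obtain f where f: "bij_betw f (verts G1) (verts G2)" "edges G2 = (\<lambda>e. f ` e) ` edges G1"
    using assms(1) unfolding graph_iso_def by (elim exE conjE)
  obtain g where g: "bij_betw g (verts G2) (verts G3)" "edges G3 = (\<lambda>e. g ` e) ` edges G2"
    using assms(2) unfolding graph_iso_def by (elim exE conjE)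
  have "(\<lambda>e. (g \<circ> f) ` e) = (\<lambda>e. g ` e) \<circ> (\<lambda>e. f ` e)" by (simp add: fun_eq_iff image_comp)
  then have "edges G3 = (\<lambda>e. (g \<circ> f) ` e) ` edges G1" using f(2) g(2) by (simp only: image_comp)
  then show ?thesis
    unfolding graph_iso_def using bij_betw_trans[OF f(1) g(1)] by (intro exI[of _ "g \<circ> f"] conjI)
qed

text \<open>This allows \<open>h\<close> to be read as the least positive order of a complete graph
  outside the property.\<close>

lemma subset_Forb_iff:
  assumes "hereditary \<H>" "finite_simple F"
  shows "\<H> \<subseteq> Forb F \<longleftrightarrow> F \<notin> \<H>"
proof
  assume "\<H> \<subseteq> Forb F"
  moreover have "F \<notin> Forb F"
    using graph_iso_refl[of F] induced_subgraph_self[OF assms(2)] unfolding Forb_def by force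
  ultimately show "F \<notin> \<H>" by blast
next
  assume "F \<notin> \<H>"
  then show "\<H> \<subseteq> Forb F"
    using assms(1) unfolding Forb_def hereditary_def by blast
qed

lemma hereditary_Forb: "hereditary (Forb F)"
  unfolding hereditary_def
proof (intro conjI ballI allI impI)
  show "finite_simple G" if "G \<in> Forb F" for G using that by (simp add: Forb_def)
next
  fix G W assume G: "G \<in> Forb F" and W: "W \<subseteq> verts G"
  have "induced_subgraph (induced_subgraph G W) U = induced_subgraph G U" if "U \<subseteq> W" for U
    using that by (auto simp: induced_subgraph_def)
  then show "induced_subgraph G W \<in> Forb F"
    using G W finite_simple_induced[of G W] unfolding Forb_def
    by (auto simp: induced_subgraph_def)
next
  fix G G' assume G: "G \<in> Forb F" and iso: "graph_iso G G'"
  then obtain f where f: "bij_betw f (verts G) (verts G')" "edges G' = (\<lambda>e. f ` e) ` edges G"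
    unfolding graph_iso_def by blast
  have fs: "finite_simple G" using G by (simp add: Forb_def)
  have inj: "inj_on f (verts G)" and im: "f ` verts G = verts G'" using f(1) by (auto simp: bij_betw_def)
  have "finite_simple G'"
    unfolding finite_simple_def
  proof
    show "finite (verts G')" using finite_simpleD(1)[OF fs] im by (metis finite_imageI)
    show "edges G' \<subseteq> all_pairs (verts G')"
    proof
      fix e assume "e \<in> edges G'"
      then obtain d where d: "d \<in> edges G" "e = f ` d" unfolding f(2) by blast
      then have "d \<subseteq> verts G" "card d = 2" using finite_simpleD(2)[OF fs] by (auto simp: all_pairs_def)
      then show "e \<in> all_pairs (verts G')"
        using d(2) im card_image[OF inj_on_subset[OF inj]] by (auto simp: all_pairs_def)
    qed
  qed
  moreover have False if W': "W' \<subseteq> verts G'" "graph_iso (induced_subgraph G' W') F" for W'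
  proof -
    define W where "W = {x \<in> verts G. f x \<in> W'}"
    have fW: "f ` W = W'" using W'(1) im by (auto simp: W_def)
    have "(\<lambda>e. f ` e) ` {e \<in> edges G. e \<subseteq> W} = {e \<in> edges G'. e \<subseteq> W'}"
    proof (intro equalityI subsetI)
      fix e assume "e \<in> {e \<in> edges G'. e \<subseteq> W'}"
      then obtain d where d: "d \<in> edges G" "e = f ` d" "e \<subseteq> W'" unfolding f(2) by blast
      then have "d \<subseteq> W" using finite_simpleD(2)[OF fs] by (auto simp: all_pairs_def W_def)
      then show "e \<in> (\<lambda>e. f ` e) ` {e \<in> edges G. e \<subseteq> W}" using d by blast
    qed (use f(2) fW in auto)
    moreover have "bij_betw f W W'"
      using fW inj_on_subset[OF inj, of W] by (auto simp: bij_betw_def W_def)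
    ultimately have "graph_iso (induced_subgraph G W) (induced_subgraph G' W')"
      unfolding graph_iso_def induced_subgraph_def by (intro exI[of _ f]) simp
    then have "graph_iso (induced_subgraph G W) F" using W'(2) graph_iso_trans by blast
    moreover have "W \<subseteq> verts G" by (auto simp: W_def)
    ultimately show False using G by (auto simp: Forb_def)
  qed
  ultimately show "G' \<in> Forb F" by (auto simp: Forb_def)
qed

text \<open>Edgeless graphs avoid every clique that has an edge, whence the bound on
  \<open>h\<close>.\<close>

lemma nontrivial_Forb_complete_graph:
  assumes "2 \<le> h"
  shows "nontrivial (Forb (complete_graph h))"
  unfolding nontrivial_def
proof
  fix N
  let ?G = "UGraph {..<N} {}"
  have "\<not> graph_iso (induced_subgraph ?G W) (complete_graph h)" for W
  proof
    assume "graph_iso (induced_subgraph ?G W) (complete_graph h)"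
    then have "edges (complete_graph h) = {}" by (auto simp: graph_iso_def induced_subgraph_def)
    moreover have "{0, 1} \<in> edges (complete_graph h)" using assms by (simp add: edge_complete_graph)
    ultimately show False by blast
  qed
  then have "?G \<in> Forb (complete_graph h)" by (simp add: Forb_def finite_simple_def)
  then show "\<exists>G\<in>Forb (complete_graph h). N \<le> card (verts G)" by (intro bexI[of _ ?G]) auto
qed

text \<open>Proper induced subgraphs are copies of smaller complete graphs, which are members by
  minimality; order 0 lies outside the range of the \<open>LEAST\<close> and is settled by
  nontriviality.\<close>

lemma least_clique_forbidden:
  assumes H: "hereditary \<H>" "nontrivial \<H>" and k: "complete_graph k \<notin> \<H>"
    and h: "h = (LEAST k. 0 < k \<and> \<H> \<subseteq> Forb (complete_graph k))"
  shows "0 < h" "h \<le> k" "complete_graph h \<in> forbidden_graphs \<H>"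
proof -
  let ?P = "\<lambda>k. 0 < k \<and> \<H> \<subseteq> Forb (complete_graph k)"
  have P: "?P k \<longleftrightarrow> 0 < k \<and> complete_graph k \<notin> \<H>" for k
    using subset_Forb_iff[OF H(1) finite_simple_complete_graph] by simp
  obtain G0 where G0: "G0 \<in> \<H>" "verts G0 = {}" using exists_on_vertex_set[OF H] by blast
  have K0: "complete_graph 0 \<in> \<H>"
    by (rule complete_graph_in_property[OF H(1) G0(1), of "{}"]) auto
  then have "0 < k" using k by (cases k) auto
  then have Pk: "?P k" using P k by blast
  have Ph: "?P h" unfolding h using Pk by (rule LeastI)
  then show "0 < h" by simp
  show "h \<le> k" unfolding h using Pk by (rule Least_le)
  have "induced_subgraph (complete_graph h) W \<in> \<H>" if W: "W \<subset> {..<h}" for W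
  proof -
    have "card W < h" using psubset_card_mono[OF _ W] by simp
    then have "\<not> ?P (card W)" unfolding h by (rule not_less_Least)
    then have KW: "complete_graph (card W) \<in> \<H>" using P K0 by (cases "card W = 0") auto
    show ?thesis
    proof (rule hereditary_homogeneous_copy[OF H(1) KW])
      show "finite_simple (induced_subgraph (complete_graph h) W)"
        using W by (intro finite_simple_induced finite_simple_complete_graph) (auto simp: verts_complete_graph)
      show "{..<card W} \<subseteq> verts (complete_graph (card W))" by (simp add: verts_complete_graph)
      show "card {..<card W} = card (verts (induced_subgraph (complete_graph h) W))"
        by (simp add: induced_subgraph_def)
      fix x y u v :: nat
      assume "x \<in> {..<card W}" "y \<in> {..<card W}" "x \<noteq> y"
        "u \<in> verts (induced_subgraph (complete_graph h) W)" "v \<in> verts (induced_subgraph (complete_graph h) W)" "u \<noteq> v"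
      then show "{x, y} \<in> edges (complete_graph (card W)) \<longleftrightarrow> {u, v} \<in> edges (induced_subgraph (complete_graph h) W)"
        using W by (auto simp: induced_subgraph_def edge_complete_graph)
    qed
  qed
  then show "complete_graph h \<in> forbidden_graphs \<H>"
    using Ph P finite_simple_complete_graph by (auto simp: forbidden_graphs_def verts_complete_graph)
qed

lemma complete_multipartite_complete_graph: "complete_multipartite n (complete_graph n)"
proof -
  have "edges (complete_graph n) = {e \<in> all_pairs (verts (complete_graph n)). \<not> (\<exists>a. id ` e = {a})}"
    by (auto simp: complete_graph_def all_pairs_def)
  from complete_multipartite_by_colouring[OF this] show ?thesis by (simp add: verts_complete_graph)
qed

text \<open>Assuming merely some complete graph outside the property makes this easy to apply again,
  to \<open>Forb (complete_graph h)\<close>. The parts of a multipartite graph are colour classes,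
  which gives \<open>\<chi> \<le> m\<close>; the forbidden complete graph has singleton parts, which
  gives \<open>m \<le> h\<close>.\<close>

lemma clique_bounds:
  assumes H: "hereditary \<H>" "nontrivial \<H>" and k: "complete_graph k \<notin> \<H>"
    and h: "h = (LEAST k. 0 < k \<and> \<H> \<subseteq> Forb (complete_graph k))"
    and \<chi>: "\<chi> = property_chromatic_number \<H>"
    and m: "m = (LEAST k. 0 < k \<and> (\<exists>F\<in>forbidden_graphs \<H>. complete_multipartite k F))"
  shows "2 \<le> \<chi>" "\<chi> \<le> m" "m \<le> h"
    and "\<And>p. 0 \<le> p \<Longrightarrow> p \<le> 1 \<Longrightarrow>
       min (p / (real \<chi> - 1)) ((1 - p) / (real \<chi> - 1) + (2 * p - 1) / (real m - 1))
         \<le> edit_distance_function \<H> p"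
    and "\<And>p. 0 \<le> p \<Longrightarrow> p \<le> 1 \<Longrightarrow> edit_distance_function \<H> p
         \<le> min (p / (real \<chi> - 1)) (1 - p + (2 * p - 1) / (real m - 1))"
proof -
  let ?P = "\<lambda>k. 0 < k \<and> (\<exists>F\<in>forbidden_graphs \<H>. complete_multipartite k F)"
  note Kh = least_clique_forbidden[OF H k h]
  have "?P h" using Kh complete_multipartite_complete_graph by blast
  then have Pm: "?P m" and mh: "m \<le> h" unfolding m by (rule LeastI, rule Least_le)
  have ne: "forbidden_graphs \<H> \<noteq> {}" using Kh(3) by blast
  show \<chi>2: "2 \<le> \<chi>" unfolding \<chi> using property_chromatic_number_ge_2[OF H k ne] .
  obtain F2 where F2: "F2 \<in> forbidden_graphs \<H>" "complete_multipartite m F2" using Pm by blast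
  obtain c where c: "c ` verts F2 \<subseteq> {..<m}"
    "\<And>u v. u \<in> verts F2 \<Longrightarrow> v \<in> verts F2 \<Longrightarrow> {u, v} \<in> edges F2 \<longleftrightarrow> c u \<noteq> c v"
    using complete_multipartite_colouring[OF forbidden_graphs_finite_simple[OF F2(1)] F2(2)] by blast
  have "chromatic_number F2 \<le> m"
    using c finite_simple_edge_distinct[OF forbidden_graphs_finite_simple[OF F2(1)]]
    by (intro chromatic_number_le[of c]) blast+
  then show \<chi>m: "\<chi> \<le> m" unfolding \<chi> using property_chromatic_number_le[OF F2(1)] by simp
  show "m \<le> h" by (rule mh)
  obtain F1 where F1: "F1 \<in> forbidden_graphs \<H>" "chromatic_number F1 = \<chi>"
    unfolding \<chi> using property_chromatic_number_attained[OF ne] .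
  fix p :: real assume p: "0 \<le> p" "p \<le> 1"
  have m2: "2 \<le> m" using \<chi>2 \<chi>m by simp
  have cast: "real (\<chi> - 2) + 1 = real \<chi> - 1" "real (m - 2) + 1 = real m - 1"
    "real (\<chi> - 1) = real \<chi> - 1" "real (m - 1) = real m - 1"
    using \<chi>2 m2 by (auto simp: of_nat_diff)
  have "min (p / (real (\<chi> - 2) + 1)) ((1 - p) / (real (\<chi> - 2) + 1) + (2 * p - 1) / (real (m - 2) + 1))
     \<le> edit_distance_function \<H> p"
  proof (rule edit_distance_function_lower[OF H k F1(1) _ F2(1) _ p])
    show "chromatic_number F1 = \<chi> - 2 + 2" using \<chi>2 F1(2) by simp
    show "complete_multipartite (m - 2 + 2) F2" using le_add_diff_inverse2[OF m2] F2(2) by (rule ssubst)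
  qed
  then show "min (p / (real \<chi> - 1)) ((1 - p) / (real \<chi> - 1) + (2 * p - 1) / (real m - 1))
     \<le> edit_distance_function \<H> p" unfolding cast .
  have "edit_distance_function \<H> p \<le> min (p / real (\<chi> - 1)) (1 - p + (2 * p - 1) / real (m - 1))"
  proof (rule edit_distance_function_upper[OF H _ _ _ _ p])
    show "0 < \<chi> - 1" "\<chi> - 1 < property_chromatic_number \<H>" "0 < m - 1" using \<chi>2 m2 \<chi> by auto
    fix j F assume "0 < j" "j \<le> m - 1" "F \<in> forbidden_graphs \<H>"
    moreover from this have "\<not> ?P j" using m2 by (intro not_less_Least[of j ?P, folded m]) simp
    ultimately show "\<not> complete_multipartite j F" by blast
  qed
  then show "edit_distance_function \<H> p \<le> min (p / (real \<chi> - 1)) (1 - p + (2 * p - 1) / (real m - 1))"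
    unfolding cast .
qed

text \<open>A proper colouring is injective on a clique.\<close>

lemma chromatic_number_ge_clique:
  assumes "finite_simple F" "F \<notin> Forb (complete_graph h)"
  shows "h \<le> chromatic_number F"
proof -
  obtain W where W: "W \<subseteq> verts F" "graph_iso (induced_subgraph F W) (complete_graph h)"
    using assms unfolding Forb_def by blast
  then obtain f where f: "bij_betw f W {..<h}" "edges (complete_graph h) = (\<lambda>e. f ` e) ` {e \<in> edges F. e \<subseteq> W}"
    by (auto simp: graph_iso_def induced_subgraph_def verts_complete_graph)
  obtain c where c: "c ` verts F \<subseteq> {..<chromatic_number F}" "\<And>u v. {u, v} \<in> edges F \<Longrightarrow> c u \<noteq> c v"
    using chromatic_colouring[OF assms(1)] by blast
  have inj: "inj_on f W" using f(1) by (rule bij_betw_imp_inj_on)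
  have edge: "{x, y} \<in> edges F" if xy: "x \<in> W" "y \<in> W" "x \<noteq> y" for x y
  proof -
    have "f x < h" "f y < h" "f x \<noteq> f y"
      using xy f(1) inj by (auto simp: inj_on_eq_iff dest: bij_betwE)
    then have "{f x, f y} \<in> edges (complete_graph h)" by (simp add: edge_complete_graph)
    then obtain e where e: "e \<in> edges F" "e \<subseteq> W" "f ` {x, y} = f ` e" unfolding f(2) by auto
    then have "{x, y} = e" using inj xy by (metis inj_on_image_eq_iff insert_subset empty_subsetI)
    then show ?thesis using e by simp
  qed
  have "inj_on c W" by (rule inj_onI) (use edge c(2) in blast)
  moreover have "c ` W \<subseteq> {..<chromatic_number F}" using c(1) W(1) by blast
  ultimately have "card W \<le> chromatic_number F" using card_inj_on_le[of c W "{..<chromatic_number F}"] by simp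
  moreover have "card W = h" using bij_betw_same_card[OF f(1)] by simp
  ultimately show ?thesis by simp
qed

theorem theorem1p1:
  fixes \<H> :: "ugraph set" and h m \<chi> :: nat
  assumes "hereditary \<H>" and "nontrivial \<H>"
    and "\<exists>n. complete_graph n \<in> forbidden_graphs \<H>"
    and "h = (LEAST k. 0 < k \<and> \<H> \<subseteq> Forb (complete_graph k))"
    and "\<chi> = property_chromatic_number \<H>"
    and "m = (LEAST k. 0 < k \<and> (\<exists>F\<in>forbidden_graphs \<H>. complete_multipartite k F))"
  shows "\<chi> \<le> m \<and> m \<le> h \<and>
    (\<forall>p::real. 0 \<le> p \<and> p \<le> 1 \<longrightarrow>
       min (p / (real \<chi> - 1)) ((1 - p) / (real \<chi> - 1) + (2 * p - 1) / (real m - 1))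
         \<le> edit_distance_function \<H> p \<and>
       edit_distance_function \<H> p
         \<le> min (p / (real \<chi> - 1)) (1 - p + (2 * p - 1) / (real m - 1))) \<and>
    property_chromatic_number (Forb (complete_graph h)) = h \<and>
    (\<forall>p::real. 0 \<le> p \<and> p \<le> 1 \<longrightarrow>
       edit_distance_function (Forb (complete_graph h)) p =
         p / (real (property_chromatic_number (Forb (complete_graph h))) - 1))"
proof -
  obtain n where n: "complete_graph n \<notin> \<H>" using assms(3) forbidden_graphs_notin by blast
  note main = clique_bounds[OF assms(1,2) n assms(4-6)]
  let ?F = "Forb (complete_graph h)"
  define h' where "h' = (LEAST k. 0 < k \<and> ?F \<subseteq> Forb (complete_graph k))"
  define \<chi>' where "\<chi>' = property_chromatic_number ?F"
  define m' where "m' = (LEAST k. 0 < k \<and> (\<exists>F\<in>forbidden_graphs ?F. complete_multipartite k F))"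
  \<comment> \<open>For \<open>h = 1\<close> only the empty graph would lie in \<open>?F\<close>,
    which would then not be nontrivial.\<close>
  have h2: "2 \<le> h" using main(1-3) by simp
  have K: "complete_graph h \<notin> ?F"
    using subset_Forb_iff[OF hereditary_Forb finite_simple_complete_graph] by blast
  note F = hereditary_Forb[of "complete_graph h"] nontrivial_Forb_complete_graph[OF h2]
  note mainF = clique_bounds[OF F K h'_def \<chi>'_def m'_def]
  have "h' \<le> h" using least_clique_forbidden(2)[OF F K h'_def] .
  moreover have "h \<le> \<chi>'"
  proof -
    have "forbidden_graphs ?F \<noteq> {}" using least_clique_forbidden(3)[OF F K h'_def] by blast
    then obtain G where "G \<in> forbidden_graphs ?F" "chromatic_number G = \<chi>'"
      unfolding \<chi>'_def by (rule property_chromatic_number_attained)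
    then show ?thesis
      using chromatic_number_ge_clique forbidden_graphs_finite_simple forbidden_graphs_notin by blast
  qed
  \<comment> \<open>The chain \<open>h \<le> \<chi>' \<le> m' \<le> h' \<le> h\<close> closes
    up.\<close>
  ultimately have eq: "\<chi>' = h" "m' = h" using mainF(2,3) by auto
  have "edit_distance_function ?F p = p / (real h - 1)" if p: "0 \<le> p" "p \<le> 1" for p
  proof -
    \<comment> \<open>With \<open>m' = \<chi>'\<close> both terms of the lower minimum agree with
      the first term of the upper one.\<close>
    have "(1 - p) / (real h - 1) + (2 * p - 1) / (real h - 1) = p / (real h - 1)"
      by (simp add: add_divide_distrib[symmetric])
    then show ?thesis using mainF(4,5)[OF p] unfolding eq by auto
  qed
  then show ?thesis using main(2-5) eq(1) unfolding \<chi>'_def by auto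
qed

end
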